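(* Let $\kappa>0$, $s\ge 2$, let $X=\{x_1,\dots,x_s\}\subset\mathbb R^3$ be a set of $s$ distinct points with minimum separation $\delta_X=\min_{j\ne k}|x_j-x_k|$, and let $\rho>0$ satisfy $$\bigcup_{j=1}^s\overline{B_\rho(x_j)}\subset B_1(0),\qquad \rho\le\frac{\delta_X}{2}.$$ Put $\gamma:=\rho\kappa$ and assume $\mu_X:=\frac92\frac{s^{2/3}}{\kappa\delta_X}<1$. Let $\widetilde{\mathcal U}$ be any $s$-dimensional subspace of $\mathcal H$ and set $\varepsilon_{\rm sub}:=\|P_{\widetilde{\mathcal U}}-P_{\mathcal U_X}\|_2$. With the constants $\nu_X,C_1,C_2,b_\gamma,A_\gamma$ given in the context, assume $$A_\gamma>0,\qquad C_2<\frac23,\qquad \varepsilon_{\rm sub}<\min\left\{\frac{\frac{\sqrt3}{2}\gamma\left(\frac23-C_2\right)}{1+\frac{\sqrt3}{2}\gamma\left(\frac2{\sqrt5}+\frac23\right)},\ \sin\left(\tfrac12\arcsin\sqrt{A_\gamma}\right)\right\}.$$ Define $$\tau_0:=\varepsilon_{\rm sub}^2,\qquad \tau_1:=\sin^2\left(\arcsin\sqrt{A_\gamma}-\arcsin\varepsilon_{\rm sub}\right),$$ $$C_0^-:=\frac23-C_2-\left(\frac2{\sqrt5}+\frac23\right)\varepsilon_{\rm sub},\qquad C_0^+:=\frac23+C_2+\left(\frac2{\sqrt5}+\frac23\right)\varepsilon_{\rm sub}.$$ Then $\tau_0<\tau_1$ and: (i) $C_0^->\dfrac{\frac23-C_2}{1+\frac{\sqrt3}{2}\gamma\left(\frac2{\sqrt5}+\frac23\right)}$,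 and for every $j$ and every $z\in\overline{B_\rho(x_j)}$, $$C_0^-\kappa^2I_3\preceq\nabla^2\widetilde q(z)\preceq C_0^+\kappa^2I_3.$$ (ii) $\widetilde q(z)\ge\tau_1$ for every $z\in B_1(0)\setminus\bigcup_{j=1}^sB_\rho(x_j)$. (iii) Each $B_\rho(x_j)$ contains exactly one critical point $\widetilde x_j$ of $\widetilde q$, which is the unique minimizer of $\widetilde q$ there, and $$|\widetilde x_j-x_j|\le\frac{2\varepsilon_{\rm sub}}{\sqrt3\,C_0^-\kappa}<\rho,\qquad \widetilde q(\widetilde x_j)\le\tau_0.$$ (iv) If $G\subset B_1(0)$ is a finite set whose fill distance $\operatorname{mesh}_{B_1}(G):=\sup_{z\in B_1(0)}\min_{g\in G}|z-g|$ satisfies $$\operatorname{mesh}_{B_1}(G)<\min\left\{\rho-\frac{2\varepsilon_{\rm sub}}{\sqrt3\,C_0^-\kappa},\ \frac{\sqrt3}{2\kappa}(\tau_1-\tau_0)\right\},$$ then $G_{\tau_1}:=\{g\in G:\widetilde q(g)<\tau_1\}$ contains at least one point in every ball $B_\rho(x_j)$ and no point outside $\bigcup_{j=1}^sB_\rho(x_j)$. (v) For every $h$ with $0<h\le\frac{2}{(C_0^-+C_0^+)\kappa^2}=\frac{3}{2\kappa^2}$, the gradient map $T_h(z):=z-h\nabla\widetilde q(z)$ maps every $\overline{B_\rho(x_j)}$ into $B_\rho(x_j)$ and is a contraction on $\overline{B_\rho(x_j)}$ with factor $r_h:=1-hC_0^-\kappa^2<1$. Consequently, the iterates of $T_h$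 started at any accepted initialization (a point of $G_{\tau_1}$, which lies in some $B_\rho(x_j)$) converge geometrically to the unique minimizer $\widetilde x_j$ in its ball.
   Context: $B_r(x)$ is the open Euclidean ball in $\mathbb R^3$. $\mathcal H=L^2(\mathbb S^2,\frac{d\omega}{4\pi})$ is the complex Hilbert space with $\langle f,g\rangle=\frac1{4\pi}\int_{\mathbb S^2}f\bar g\,d\omega$; $\|\cdot\|_2$ denotes its norm and the corresponding operator norm. For $z\in\mathbb R^3$, $\varphi_z(\omega)=e^{i\kappa\omega\cdot z}$. $\mathcal U_X=\operatorname{span}\{\varphi_{x_1},\dots,\varphi_{x_s}\}$ (of dimension $s$), and $P_{\mathcal V}$ is the orthogonal projector onto a subspace $\mathcal V$. The perturbed MUSIC function is $\widetilde q(z)=\|(I-P_{\widetilde{\mathcal U}})\varphi_z\|_2^2$. Constants: $c_\nu:=\sup_{t>0}|t\cos t-\sin t|/t$ ($\approx1.0631$), $$\nu_X:=\frac{64c_\nu^2}{27}\frac{\mu_X^2}{s}=48c_\nu^2\frac{s^{1/3}}{\kappa^2\delta_X^2},\qquad C_1:=\frac{\gamma^2}{9}+\nu_X+\sqrt{1+\nu_X}\sqrt{\left(\frac13+\frac{\gamma^2}{10}\right)^2+4\nu_X},$$ $$C_2:=\frac{8}{15}\gamma^2+6\nu_X+\frac{2\mu_X}{1-\mu_X}C_1,\qquad b_\gamma:=1-\sup_{t\ge\gamma}\left(\frac{\sin t}{t}\right)^2,\qquad A_\gamma:=\frac{b_\gamma-\mu_X-\nu_X}{1-\mu_X}.$$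 *)

theory Defs
  imports "HOL-Analysis.Analysis"
begin

section \<open>The Hilbert space \<open>L\<^sup>2(S\<^sup>2, d\<omega>/4\<pi>)\<close>\<close>

text \<open>
  Surface measure on the unit sphere by polar coordinates: the area of a Borel set \<open>E\<close> is
  \<open>3\<close> times the volume of the cone \<open>{r \<omega> | 0 < r < 1, \<omega> \<in> E}\<close>, since
  \<open>\<integral>\<^sub>0\<^sup>1 r\<^sup>2 dr = 1/3\<close>. Note \<open>sgn x = x / norm x\<close>.
\<close>

definition sphere_area :: "(real^3) measure" where
  "sphere_area = scale_measure 3
     (distr (restrict_space lborel (ball 0 1 - {0})) (restrict_space borel (sphere 0 1)) sgn)"

definition sphere_measure :: "(real^3) measure" where
  "sphere_measure = scale_measure (ennreal (1 / (4 * pi))) sphere_area"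

lemma space_sphere_measure [simp]: "space sphere_measure = sphere 0 1"
  and sets_sphere_measure [measurable_cong]:
    "sets sphere_measure = sets (restrict_space borel (sphere 0 1))"
  by (simp_all add: sphere_measure_def sphere_area_def space_scale_measure space_restrict_space)

lemma emeasure_sphere_area: "emeasure sphere_area (sphere 0 1) = ennreal (4 * pi)"
proof -
  let ?M = "restrict_space lborel (ball 0 1 - {0::real^3})"
  have sgn: "sgn \<in> measurable ?M (restrict_space borel (sphere 0 1))"
  proof (rule measurable_restrict_space2)
    show "sgn \<in> space ?M \<rightarrow> sphere 0 1"
      by (auto simp: space_restrict_space norm_sgn)
    have "(\<lambda>x::real^3. inverse (norm x) *\<^sub>R x) \<in> borel_measurable borel"
      by measurable
    then have "(sgn :: real^3 \<Rightarrow> _) \<in> borel_measurable borel"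
      by (simp add: sgn_div_norm[abs_def])
    then show "sgn \<in> measurable ?M borel"
      by (intro measurable_restrict_space1) simp
  qed
  have "emeasure sphere_area (sphere 0 1) = 3 * emeasure ?M (sgn -` sphere 0 1 \<inter> space ?M)"
    unfolding sphere_area_def
    by (simp add: emeasure_distr[OF sgn] sets_restrict_space_iff)
  also have "sgn -` sphere 0 1 \<inter> space ?M = ball 0 1 - {0}"
    by (auto simp: space_restrict_space norm_sgn)
  also have "emeasure ?M (ball 0 1 - {0}) = emeasure lborel (ball (0::real^3) 1 - {0})"
    by (simp add: emeasure_restrict_space)
  also have "\<dots> = emeasure lborel (ball (0::real^3) 1)"
    by (rule emeasure_Diff_null_set) (auto simp: null_sets_def)
  also have "\<dots> = ennreal (4 / 3 * pi)"
    by (simp add: emeasure_ball unit_ball_vol_3)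
  also have "3 * ennreal (4 / 3 * pi) = ennreal (4 * pi)"
    using ennreal_mult[of 3 "4 / 3 * pi"] by simp
  finally show ?thesis .
qed

lemma prob_sphere_measure: "emeasure sphere_measure (space sphere_measure) = 1"
proof -
  have "emeasure sphere_measure (space sphere_measure) = ennreal (1 / (4 * pi)) * ennreal (4 * pi)"
    unfolding space_sphere_measure
    by (simp add: sphere_measure_def emeasure_sphere_area)
  also have "\<dots> = 1"
    by (simp flip: ennreal_mult)
  finally show ?thesis .
qed

interpretation sphere_measure: finite_measure sphere_measure
  by standard (simp only: prob_sphere_measure, simp)

definition sq_integrable :: "(real^3 \<Rightarrow> complex) \<Rightarrow> bool" where
  "sq_integrable f \<longleftrightarrow> f \<in> borel_measurable sphere_measure \<and>
     integrable sphere_measure (\<lambda>\<omega>. (cmod (f \<omega>))\<^sup>2)"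

lemma sq_integrable_0: "sq_integrable (\<lambda>\<omega>. 0)"
  by (simp add: sq_integrable_def)

lemma sq_integrable_cmult:
  assumes "sq_integrable f" shows "sq_integrable (\<lambda>\<omega>. c * f \<omega>)"
  using assms by (auto simp: sq_integrable_def norm_mult power_mult_distrib)

lemma sq_integrable_add:
  assumes "sq_integrable f" "sq_integrable g" shows "sq_integrable (\<lambda>\<omega>. f \<omega> + g \<omega>)"
  unfolding sq_integrable_def
proof
  have [measurable]: "f \<in> borel_measurable sphere_measure" "g \<in> borel_measurable sphere_measure"
    using assms by (auto simp: sq_integrable_def)
  show "(\<lambda>\<omega>. f \<omega> + g \<omega>) \<in> borel_measurable sphere_measure" by measurable
  have "(cmod (a + b))\<^sup>2 \<le> 2 * (cmod a)\<^sup>2 + 2 * (cmod b)\<^sup>2" for a b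
  proof -
    have "(cmod (a + b))\<^sup>2 \<le> (cmod a + cmod b)\<^sup>2"
      by (intro power_mono norm_triangle_ineq) auto
    also have "\<dots> \<le> 2 * (cmod a)\<^sup>2 + 2 * (cmod b)\<^sup>2"
      using sum_squares_bound[of "cmod a" "cmod b"] by (simp add: power2_sum)
    finally show ?thesis .
  qed
  note * = this
  show "integrable sphere_measure (\<lambda>\<omega>. (cmod (f \<omega> + g \<omega>))\<^sup>2)"
  proof (rule Bochner_Integration.integrable_bound)
    show "integrable sphere_measure (\<lambda>\<omega>. 2 * (cmod (f \<omega>))\<^sup>2 + 2 * (cmod (g \<omega>))\<^sup>2)"
      using assms by (auto simp: sq_integrable_def)
  qed (use * in auto)
qed

lemma integrable_mult_cnj:
  assumes "sq_integrable f" "sq_integrable g"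
  shows "integrable sphere_measure (\<lambda>\<omega>. f \<omega> * cnj (g \<omega>))"
proof -
  have [measurable]: "f \<in> borel_measurable sphere_measure" "g \<in> borel_measurable sphere_measure"
    using assms by (auto simp: sq_integrable_def)
  have "cnj \<in> borel_measurable borel"
    by (intro borel_measurable_continuous_onI continuous_intros)
  then have [measurable]: "(\<lambda>\<omega>. f \<omega> * cnj (g \<omega>)) \<in> borel_measurable sphere_measure"
    by (intro borel_measurable_times measurable_compose[of g _ borel cnj]) auto
  have "cmod a * cmod b \<le> (cmod a)\<^sup>2 + (cmod b)\<^sup>2" for a b
    using sum_squares_bound[of "cmod a" "cmod b"] zero_le_power2[of "cmod a"] 
      mult_nonneg_nonneg[OF norm_ge_zero norm_ge_zero, of a b] by linarith
  note * = this
  show ?thesis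
  proof (rule Bochner_Integration.integrable_bound)
    show "integrable sphere_measure (\<lambda>\<omega>. (cmod (f \<omega>))\<^sup>2 + (cmod (g \<omega>))\<^sup>2)"
      using assms by (auto simp: sq_integrable_def)
  qed (use * in \<open>auto simp: norm_mult\<close>)
qed

quotient_type L2_sphere = "real^3 \<Rightarrow> complex" /
  partial: "\<lambda>f g. sq_integrable f \<and> sq_integrable g \<and> (AE \<omega> in sphere_measure. f \<omega> = g \<omega>)"
proof (rule part_equivpI)
  show "\<exists>f. sq_integrable f \<and> sq_integrable f \<and> (AE \<omega> in sphere_measure. f \<omega> = f \<omega>)"
    using sq_integrable_0 by auto
qed (auto intro!: sympI transpI)

lift_definition cinner :: "L2_sphere \<Rightarrow> L2_sphere \<Rightarrow> complex" is
  "\<lambda>f g. \<integral>\<omega>. f \<omega> * cnj (g \<omega>) \<partial>sphere_measure"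
proof -
  fix f f' g g' :: "real^3 \<Rightarrow> complex"
  assume *: "sq_integrable f \<and> sq_integrable f' \<and> (AE \<omega> in sphere_measure. f \<omega> = f' \<omega>)"
     "sq_integrable g \<and> sq_integrable g' \<and> (AE \<omega> in sphere_measure. g \<omega> = g' \<omega>)"
  then have "AE \<omega> in sphere_measure. f \<omega> * cnj (g \<omega>) = f' \<omega> * cnj (g' \<omega>)"
    by auto
  then show "(\<integral>\<omega>. f \<omega> * cnj (g \<omega>) \<partial>sphere_measure) = (\<integral>\<omega>. f' \<omega> * cnj (g' \<omega>) \<partial>sphere_measure)"
    using * by (intro integral_cong_AE borel_measurable_integrable integrable_mult_cnj) auto
qed

lift_definition scaleC :: "complex \<Rightarrow> L2_sphere \<Rightarrow> L2_sphere" is "\<lambda>c f \<omega>. c * f \<omega>"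
  by (auto intro: sq_integrable_cmult)

instantiation L2_sphere :: ab_group_add
begin

lift_definition zero_L2_sphere :: L2_sphere is "\<lambda>\<omega>. 0"
  by (simp add: sq_integrable_0)

lift_definition plus_L2_sphere :: "L2_sphere \<Rightarrow> L2_sphere \<Rightarrow> L2_sphere" is "\<lambda>f g \<omega>. f \<omega> + g \<omega>"
  by (auto intro: sq_integrable_add)

definition uminus_L2_sphere :: "L2_sphere \<Rightarrow> L2_sphere" where
  "uminus_L2_sphere f = scaleC (- 1) f"

definition minus_L2_sphere :: "L2_sphere \<Rightarrow> L2_sphere \<Rightarrow> L2_sphere" where
  "minus_L2_sphere f g = f + - g"

instance
proof
  fix a b c :: L2_sphere
  show "a + b + c = a + (b + c)"
    by transfer (auto simp: add.assoc intro!: sq_integrable_add)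
  show "a + b = b + a"
    by transfer (auto simp: add.commute intro!: sq_integrable_add)
  show "0 + a = a"
    by transfer auto
  show "- a + a = 0"
    unfolding uminus_L2_sphere_def
    by transfer (auto intro!: sq_integrable_add sq_integrable_cmult sq_integrable_0)
  show "a - b = a + - b"
    by (simp add: minus_L2_sphere_def)
qed

end

interpretation complex_L2: vector_space scaleC
proof
  fix a b :: complex and x y :: L2_sphere
  show "scaleC a (x + y) = scaleC a x + scaleC a y"
    by transfer (simp add: distrib_left sq_integrable_add sq_integrable_cmult)
  show "scaleC (a + b) x = scaleC a x + scaleC b x"
    by transfer (simp add: distrib_right sq_integrable_add sq_integrable_cmult)
  show "scaleC a (scaleC b x) = scaleC (a * b) x"
    by transfer (simp add: mult.assoc sq_integrable_cmult)
  show "scaleC 1 x = x"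
    by transfer auto
qed

lemma cinner_add_left: "cinner (x + y) z = cinner x z + cinner y z"
  by transfer (simp add: distrib_right integrable_mult_cnj)

lemma cinner_scaleC_left: "cinner (scaleC c x) y = c * cinner x y"
  by transfer (simp add: mult.assoc integrable_mult_cnj)

lemma cinner_commute: "cinner y x = cnj (cinner x y)"
proof transfer
  fix f g :: "real^3 \<Rightarrow> complex"
  have "cnj (\<integral>\<omega>. f \<omega> * cnj (g \<omega>) \<partial>sphere_measure) = (\<integral>\<omega>. cnj (f \<omega> * cnj (g \<omega>)) \<partial>sphere_measure)"
    by (rule Bochner_Integration.integral_cnj[symmetric])
  also have "\<dots> = (\<integral>\<omega>. g \<omega> * cnj (f \<omega>) \<partial>sphere_measure)"
    by (intro Bochner_Integration.integral_cong) (simp_all add: mult.commute)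
  finally show "(\<integral>\<omega>. g \<omega> * cnj (f \<omega>) \<partial>sphere_measure) = cnj (\<integral>\<omega>. f \<omega> * cnj (g \<omega>) \<partial>sphere_measure)" ..
qed

lemma cinner_self: "cinner x x = complex_of_real (Re (cinner x x)) \<and> 0 \<le> Re (cinner x x) \<and>
    (Re (cinner x x) = 0 \<longleftrightarrow> x = 0)"
proof transfer
  fix f :: "real^3 \<Rightarrow> complex"
  assume f: "sq_integrable f \<and> sq_integrable f \<and> (AE \<omega> in sphere_measure. f \<omega> = f \<omega>)"
  have *: "(\<integral>\<omega>. f \<omega> * cnj (f \<omega>) \<partial>sphere_measure) =
      complex_of_real (\<integral>\<omega>. (cmod (f \<omega>))\<^sup>2 \<partial>sphere_measure)"
    unfolding complex_norm_square[symmetric] by (rule integral_complex_of_real)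
  have "(\<integral>\<omega>. (cmod (f \<omega>))\<^sup>2 \<partial>sphere_measure) = 0 \<longleftrightarrow> (AE \<omega> in sphere_measure. (cmod (f \<omega>))\<^sup>2 = 0)"
    using f by (intro integral_nonneg_eq_0_iff_AE) (auto simp: sq_integrable_def)
  then show "(\<integral>\<omega>. f \<omega> * cnj (f \<omega>) \<partial>sphere_measure) =
       complex_of_real (Re (\<integral>\<omega>. f \<omega> * cnj (f \<omega>) \<partial>sphere_measure)) \<and>
       0 \<le> Re (\<integral>\<omega>. f \<omega> * cnj (f \<omega>) \<partial>sphere_measure) \<and>
       (Re (\<integral>\<omega>. f \<omega> * cnj (f \<omega>) \<partial>sphere_measure) = 0 \<longleftrightarrow>
        sq_integrable f \<and> sq_integrable (\<lambda>\<omega>. 0) \<and> (AE \<omega> in sphere_measure. f \<omega> = 0))"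
    unfolding * using f sq_integrable_0 by (auto intro!: integral_nonneg_AE)
qed

text \<open>
  The library has no class of complex inner product spaces. The norm of the complex inner product
  is that of its real part, so the type is made an instance of \<^class>\<open>real_inner\<close>;
  subspaces, spans and dimensions are taken over the complex numbers.
\<close>

instantiation L2_sphere :: real_inner
begin

definition scaleR_L2_sphere :: "real \<Rightarrow> L2_sphere \<Rightarrow> L2_sphere" where
  "scaleR_L2_sphere r f = scaleC (complex_of_real r) f"

definition inner_L2_sphere :: "L2_sphere \<Rightarrow> L2_sphere \<Rightarrow> real" where
  "inner_L2_sphere f g = Re (cinner f g)"

definition norm_L2_sphere :: "L2_sphere \<Rightarrow> real" where
  "norm_L2_sphere f = sqrt (Re (cinner f f))"

definition dist_L2_sphere :: "L2_sphere \<Rightarrow> L2_sphere \<Rightarrow> real" where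
  "dist_L2_sphere f g = norm (f - g)"

definition sgn_L2_sphere :: "L2_sphere \<Rightarrow> L2_sphere" where
  "sgn_L2_sphere f = inverse (norm f) *\<^sub>R f"

definition uniformity_L2_sphere :: "(L2_sphere \<times> L2_sphere) filter" where
  "uniformity_L2_sphere = (INF e\<in>{0<..}. principal {(f, g). dist f g < e})"

definition open_L2_sphere :: "L2_sphere set \<Rightarrow> bool" where
  "open_L2_sphere U \<longleftrightarrow> (\<forall>f\<in>U. eventually (\<lambda>(f', g). f' = f \<longrightarrow> g \<in> U) uniformity)"

instance
proof
  fix x y z :: L2_sphere and a b :: real
  show "dist x y = norm (x - y)" by (rule dist_L2_sphere_def)
  show "a *\<^sub>R (x + y) = a *\<^sub>R x + a *\<^sub>R y"
    by (simp add: scaleR_L2_sphere_def complex_L2.scale_right_distrib)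
  show "(a + b) *\<^sub>R x = a *\<^sub>R x + b *\<^sub>R x"
    by (simp add: scaleR_L2_sphere_def complex_L2.scale_left_distrib)
  show "a *\<^sub>R b *\<^sub>R x = (a * b) *\<^sub>R x"
    by (simp add: scaleR_L2_sphere_def)
  show "1 *\<^sub>R x = x"
    by (simp add: scaleR_L2_sphere_def)
  show "sgn x = inverse (norm x) *\<^sub>R x" by (rule sgn_L2_sphere_def)
  show "inner x y = inner y x"
    by (metis inner_L2_sphere_def cinner_commute complex_cnj(1) cnj.simps(1))
  show "inner (x + y) z = inner x z + inner y z"
    by (simp add: inner_L2_sphere_def cinner_add_left)
  show "inner (a *\<^sub>R x) y = a * inner x y"
    by (simp add: inner_L2_sphere_def scaleR_L2_sphere_def cinner_scaleC_left)
  show "0 \<le> inner x x" "(inner x x = 0) = (x = 0)"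
    using cinner_self[of x] by (auto simp: inner_L2_sphere_def)
  show "norm x = sqrt (inner x x)"
    by (simp add: norm_L2_sphere_def inner_L2_sphere_def)
qed (rule uniformity_L2_sphere_def open_L2_sphere_def)+

end

definition orth_proj :: "L2_sphere set \<Rightarrow> L2_sphere \<Rightarrow> L2_sphere" where
  "orth_proj V f = (THE v. v \<in> V \<and> (\<forall>w\<in>V. cinner (f - v) w = 0))"


section \<open>Plane waves and the MUSIC function\<close>

lift_definition plane_wave :: "real \<Rightarrow> real^3 \<Rightarrow> L2_sphere" is
  "\<lambda>\<kappa> z \<omega>. exp (\<i> * complex_of_real (\<kappa> * (\<omega> \<bullet> z)))"
proof -
  fix \<kappa> :: real and z :: "real^3"
  have "(\<lambda>\<omega>. exp (\<i> * complex_of_real (\<kappa> * (\<omega> \<bullet> z)))) \<in> borel_measurable borel"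
    by (intro borel_measurable_continuous_onI continuous_intros)
  then have "(\<lambda>\<omega>. exp (\<i> * complex_of_real (\<kappa> * (\<omega> \<bullet> z)))) \<in> borel_measurable sphere_measure"
    by (subst measurable_cong_sets[OF sets_sphere_measure refl]) (rule measurable_restrict_space1)
  then show "sq_integrable (\<lambda>\<omega>. exp (\<i> * complex_of_real (\<kappa> * (\<omega> \<bullet> z)))) \<and>
      sq_integrable (\<lambda>\<omega>. exp (\<i> * complex_of_real (\<kappa> * (\<omega> \<bullet> z)))) \<and>
      (AE \<omega> in sphere_measure. exp (\<i> * complex_of_real (\<kappa> * (\<omega> \<bullet> z))) =
         exp (\<i> * complex_of_real (\<kappa> * (\<omega> \<bullet> z))))"
    by (auto simp: sq_integrable_def)
qed

definition signal_space :: "real \<Rightarrow> (real^3) set \<Rightarrow> L2_sphere set" where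
  "signal_space \<kappa> X = complex_L2.span (plane_wave \<kappa> ` X)"

definition music :: "L2_sphere set \<Rightarrow> real \<Rightarrow> real^3 \<Rightarrow> real" where
  "music V \<kappa> z = (norm (plane_wave \<kappa> z - orth_proj V (plane_wave \<kappa> z)))\<^sup>2"

definition min_separation :: "(real^3) set \<Rightarrow> real" where
  "min_separation X = Min {dist x y |x y. x \<in> X \<and> y \<in> X \<and> x \<noteq> y}"

text \<open>Extended real valued, so that the empty set has fill distance \<open>\<infinity>\<close>.\<close>

definition fill_distance :: "(real^3) set \<Rightarrow> ereal" where
  "fill_distance G = (SUP z\<in>ball 0 1. INF g\<in>G. ereal (dist z g))"


section \<open>Gradient, Hessian, Loewner order\<close>

definition gradient :: "(real^'n \<Rightarrow> real) \<Rightarrow> real^'n \<Rightarrow> real^'n" where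
  "gradient f z = (\<chi> i. frechet_derivative f (at z) (axis i 1))"

definition hessian :: "(real^'n \<Rightarrow> real) \<Rightarrow> real^'n \<Rightarrow> real^'n^'n" where
  "hessian f z = matrix (frechet_derivative (gradient f) (at z))"

text \<open>
  \<^const>\<open>frechet_derivative\<close> is arbitrary where no derivative exists; this is the
  condition under which \<^const>\<open>hessian\<close> is meaningful.
\<close>

definition twice_differentiable_at :: "(real^'n \<Rightarrow> real) \<Rightarrow> real^'n \<Rightarrow> bool" where
  "twice_differentiable_at f z \<longleftrightarrow>
     (\<forall>\<^sub>F y in nhds z. f differentiable (at y)) \<and> gradient f differentiable (at z)"

definition critical_point :: "(real^'n \<Rightarrow> real) \<Rightarrow> real^'n \<Rightarrow> bool" where
  "critical_point f z \<longleftrightarrow> f differentiable (at z) \<and> gradient f z = 0"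

definition loewner_le :: "real^'n^'n \<Rightarrow> real^'n^'n \<Rightarrow> bool" where
  "loewner_le A B \<longleftrightarrow> transpose A = A \<and> transpose B = B \<and> (\<forall>v. v \<bullet> (A *v v) \<le> v \<bullet> (B *v v))"

definition grad_step :: "(real^'n \<Rightarrow> real) \<Rightarrow> real \<Rightarrow> real^'n \<Rightarrow> real^'n" where
  "grad_step f h z = z - h *\<^sub>R gradient f z"


section \<open>Constants\<close>

definition c_nu :: real where
  "c_nu = (SUP t\<in>{0<..}. \<bar>t * cos t - sin t\<bar> / t)"

definition mu_const :: "nat \<Rightarrow> real \<Rightarrow> real \<Rightarrow> real" where
  "mu_const s \<kappa> \<delta> = 9 / 2 * (real s powr (2/3) / (\<kappa> * \<delta>))"

definition nu_const :: "nat \<Rightarrow> real \<Rightarrow> real \<Rightarrow> real" where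
  "nu_const s \<kappa> \<delta> = 64 * c_nu\<^sup>2 / 27 * ((mu_const s \<kappa> \<delta>)\<^sup>2 / real s)"

lemma nu_const_eq:
  assumes "s > 0"
  shows "nu_const s \<kappa> \<delta> = 48 * c_nu\<^sup>2 * (real s powr (1/3) / (\<kappa>\<^sup>2 * \<delta>\<^sup>2))"
proof -
  have "(real s powr (2/3))\<^sup>2 = real s powr (4/3)"
    by (simp add: power2_eq_square flip: powr_add)
  also have "\<dots> = real s * real s powr (1/3)"
    using assms powr_add[of "real s" 1 "1/3"] by simp
  finally have "(real s powr (2/3))\<^sup>2 / real s = real s powr (1/3)"
    using assms by simp
  moreover have "nu_const s \<kappa> \<delta> =
      48 * c_nu\<^sup>2 * ((real s powr (2/3))\<^sup>2 / real s / (\<kappa>\<^sup>2 * \<delta>\<^sup>2))"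
    by (simp add: nu_const_def mu_const_def power_divide power_mult_distrib mult_ac)
  ultimately show ?thesis by simp
qed

definition C1_const :: "real \<Rightarrow> real \<Rightarrow> real" where
  "C1_const \<gamma> \<nu> = \<gamma>\<^sup>2 / 9 + \<nu> + sqrt (1 + \<nu>) * sqrt ((1/3 + \<gamma>\<^sup>2 / 10)\<^sup>2 + 4 * \<nu>)"

definition C2_const :: "real \<Rightarrow> real \<Rightarrow> real \<Rightarrow> real" where
  "C2_const \<gamma> \<mu> \<nu> = 8/15 * \<gamma>\<^sup>2 + 6 * \<nu> + 2 * \<mu> / (1 - \<mu>) * C1_const \<gamma> \<nu>"

definition b_const :: "real \<Rightarrow> real" where
  "b_const \<gamma> = 1 - (SUP t\<in>{\<gamma>..}. (sin t / t)\<^sup>2)"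

definition A_const :: "real \<Rightarrow> real \<Rightarrow> real \<Rightarrow> real" where
  "A_const \<gamma> \<mu> \<nu> = (b_const \<gamma> - \<mu> - \<nu>) / (1 - \<mu>)"

end

theory Submission
  imports Defs
begin

text \<open>
  Write \<open>P\<close> for the projection onto \<open>U\<close>, \<open>Q = 1 - P\<close> and \<open>\<phi>\<^sub>z\<close> for the plane wave, so that
  \<open>q z = \<langle>\<phi>\<^sub>z, Q \<phi>\<^sub>z\<rangle>\<close> and the second derivative of \<open>q\<close> along \<open>v\<close> is
  \<open>2 Re (\<langle>\<partial>\<^sub>v\<partial>\<^sub>v\<phi>\<^sub>z, Q \<phi>\<^sub>z\<rangle> + \<langle>\<partial>\<^sub>v\<phi>\<^sub>z, Q \<partial>\<^sub>v\<phi>\<^sub>z\<rangle>)\<close>.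
  The norms \<open>\<kappa>/\<surd>3\<close> and \<open>\<kappa>\<^sup>2/\<surd>5\<close> of the derivatives of \<open>\<phi>\<^sub>z\<close> make this form Lipschitz in \<open>P\<close> with
  constant \<open>(2/\<surd>5 + 2/3) \<kappa>\<^sup>2\<close>, which reduces the Hessian bounds to the unperturbed signal space.
  There \<open>P\<close> is expressed through the Gram matrix of the plane waves, whose entries are
  \<open>sinc (\<kappa> |x - y|)\<close> by Archimedes' theorem (a coordinate of a uniform point on the sphere is
  uniform on \<open>[-1, 1]\<close>). A packing argument bounds the off-diagonal row sums by \<open>\<mu>\<close> and the
  contributions of the distant sources by \<open>\<nu>\<close>; the source next to \<open>z\<close> contributes the
  main term \<open>2/3 \<kappa>\<^sup>2\<close> up to \<open>8/15 \<gamma>\<^sup>2 \<kappa>\<^sup>2\<close>. Outside the balls the same sums bound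
  \<open>\<parallel>P \<phi>\<^sub>z\<parallel>\<close>, and the triangle inequality for angles between vectors and subspaces transfers the
  bound to \<open>U\<close>. With the Hessian pinched between \<open>C\<^sub>0\<^sup>- \<kappa>\<^sup>2\<close> and \<open>C\<^sub>0\<^sup>+ \<kappa>\<^sup>2\<close>, gradient steps are contractions of
  each closed ball, and their fixed points are the minimizers.
\<close>

section \<open>The distribution of a coordinate on the sphere\<close>

text \<open>Plane waves have norm 1 everywhere, so the parts of the Hessian form without P cancel
  (-1/3 against 1/3, in units of \<kappa>^2), and only the two terms with P remain; a single source
  located at z makes them 2/3. The Gram matrix is never inverted: its off-diagonal part is bounded
  as an operator by its row sums, which are sums of 1/r over the other sources and have order
  s^(2/3). The inner products of a wave and its derivatives with the sources are measured in l2
  instead, so the distant sources enter through sums of 1/r^2, of order s^(1/3). This is why there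
  are two constants \<mu> and \<nu>. Both bounds on \<epsilon> are solved conditions: the first
  guarantees \<epsilon> < (sqrt 3 / 2) \<gamma> \<open>Cm\<close>, although \<open>Cm\<close> itself
  contains \<epsilon>; the second says arcsin \<epsilon> < (1/2) arcsin (sqrt A), which is what
  separates \<tau>0 from \<tau>1.\<close>

lemma emeasure_orthogonal_vimage:
  fixes f :: "real^3 \<Rightarrow> real^3"
  assumes f: "orthogonal_transformation f" and S: "S \<in> sets borel" "bounded S"
  shows "emeasure lborel (f -` S) = emeasure lborel S"
proof -
  have inv: "orthogonal_transformation (inv f)"
    by (rule orthogonal_transformation_inv[OF f])
  have eq: "f -` S = inv f ` S"
    by (rule bij_vimage_eq_inv_image) (rule orthogonal_transformation_bij[OF f])
  have S': "S \<in> lmeasurable"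
    using S by (intro bounded_set_imp_lmeasurable) (auto intro: lborelD)
  have m: "inv f ` S \<in> lmeasurable" "measure lebesgue (inv f ` S) = measure lebesgue S"
    using measurable_orthogonal_image[OF inv S'] measure_orthogonal_image[OF inv S'] by auto
  have fb: "f \<in> borel_measurable borel"
    by (intro borel_measurable_continuous_onI linear_continuous_on)
       (use orthogonal_transformation_linear[OF f] in \<open>simp add: linear_conv_bounded_linear\<close>)
  have "f -` S \<in> sets borel"
    using measurable_sets[OF fb S(1)] by simp
  then have "emeasure lborel (f -` S) = emeasure lebesgue (inv f ` S)"
    unfolding eq by (simp add: emeasure_completion)
  also have "\<dots> = emeasure lebesgue S"
    using m S' by (simp add: emeasure_eq_measure2)
  also have "\<dots> = emeasure lborel S"
    using S by simp
  finally show ?thesis .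
qed

section \<open>Volume of a circular cone by slicing\<close>

definition triple :: "real \<times> (real \<times> real) \<Rightarrow> real^3" where
  "triple p = vector [fst p, fst (snd p), snd (snd p)]"

lemma triple_nth [simp]: "triple p $ 1 = fst p" "triple p $ 2 = fst (snd p)" "triple p $ 3 = snd (snd p)"
  by (simp_all add: triple_def)

lemma norm_triple [simp]: "norm (triple p) = norm p"
  by (cases p) (auto simp: norm_eq_sqrt_inner inner_vec_def sum_3 norm_Pair inner_prod_def)

lemma measurable_triple [measurable]: "triple \<in> borel_measurable borel"
proof -
  have "triple = (\<lambda>p. \<chi> i. if i = 1 then fst p else if i = 2 then fst (snd p) else snd (snd p))"
    by (auto simp: fun_eq_iff vec_eq_iff forall_3)
  moreover have "continuous_on UNIV \<dots>"
  proof (rule continuous_on_vec_lambda)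
      fix i :: 3
      show "continuous_on UNIV (\<lambda>p::real \<times> (real \<times> real). if i = 1 then fst p else if i = 2 then fst (snd p) else snd (snd p))"
        by (cases "i = 1"; cases "i = 2") (auto intro!: continuous_intros)
    qed
  ultimately show ?thesis by (metis borel_measurable_continuous_onI)
qed

text \<open>Transports \<open>real^3\<close> to iterated pairs, where \<open>lborel_prod\<close> and
  integration over slices apply. Agreement on open boxes identifies the two measures.\<close>

lemma lborel_eq_distr_triple: "lborel = distr lborel borel triple"
proof (rule lborel_eqI)
  fix l u :: "real^3" assume lu: "\<And>b. b \<in> Basis \<Longrightarrow> l \<bullet> b \<le> u \<bullet> b"
  then have le: "l $ i \<le> u $ i" for i
    using lu[of "axis i 1"] by (simp add: cart_eq_inner_axis)
  have "triple -` box l u = box (l$1) (u$1) \<times> (box (l$2) (u$2) \<times> box (l$3) (u$3))"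
    by (simp add: set_eq_iff interval_cart forall_3)
  then have "emeasure (distr lborel borel triple) (box l u) =
     emeasure (lborel \<Otimes>\<^sub>M lborel) ({l$1<..<u$1} \<times> ({l$2<..<u$2} \<times> {l$3<..<u$3}))"
    by (simp add: emeasure_distr lborel_prod)
  also have "\<dots> = emeasure lborel {l$1<..<u$1} * emeasure lborel ({l$2<..<u$2} \<times> {l$3<..<u$3})"
    by (rule lborel.emeasure_pair_measure_Times) (auto simp: open_Times)
  also have "emeasure lborel ({l$2<..<u$2} \<times> {l$3<..<u$3}) = emeasure (lborel \<Otimes>\<^sub>M lborel) ({l$2<..<u$2} \<times> {l$3<..<u$3})"
    by (simp only: lborel_prod)
  also have "\<dots> = emeasure lborel {l$2<..<u$2} * emeasure lborel {l$3<..<u$3}"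
    by (rule lborel.emeasure_pair_measure_Times) auto
  also have "emeasure lborel {l$1<..<u$1} * \<dots> = ennreal ((u$1 - l$1) * ((u$2 - l$2) * (u$3 - l$3)))"
  proof -
    have "ennreal x * (ennreal y * ennreal z) = ennreal (x * (y * z))" if "0 \<le> x" "0 \<le> y" "0 \<le> z" for x y z
      using that by (simp add: ennreal_mult)
    then show ?thesis
      unfolding emeasure_lborel_Ioo[OF le] using le by (metis diff_ge_0_iff_ge)
  qed
  also have "(u$1 - l$1) * ((u$2 - l$2) * (u$3 - l$3)) = (\<Prod>b\<in>Basis. (u - l) \<bullet> b)"
  proof -
    have "(\<Prod>b\<in>Basis. (u - l) \<bullet> b) = (\<Prod>i\<in>UNIV. (u - l) $ i)"
      by (simp add: Basis_vec_def prod.UNION_disjoint axis_eq_axis inner_axis)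
    moreover have "(\<Prod>i\<in>UNIV. f i) = f 1 * (f 2 * f 3)" for f :: "3 \<Rightarrow> real"
      unfolding UNIV_3 by simp
    ultimately show ?thesis by (simp only: vector_minus_component)
  qed
  finally show "emeasure (distr lborel borel triple) (box l u) = (\<Prod>b\<in>Basis. (u - l) \<bullet> b)" .
qed simp

lemma sqrt_less_iff: "sqrt X < t \<longleftrightarrow> 0 < t \<and> X < t\<^sup>2" if "X \<ge> 0"
proof (cases "t > 0")
  case True
  then show ?thesis using real_sqrt_less_iff[of X "t\<^sup>2"] by simp
next
  case False
  then show ?thesis using real_sqrt_ge_zero[OF that] by linarith
qed

lemma less_sqrt_iff: "n < sqrt R \<longleftrightarrow> n\<^sup>2 < R" if "n \<ge> 0"
  using real_sqrt_less_iff[of "n\<^sup>2" R] that by simp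

lemma emeasure_disc: "emeasure lborel (ball (0::real \<times> real) (sqrt R)) = ennreal (pi * R)" if "R \<ge> 0"
  using that by (simp add: emeasure_ball unit_ball_vol_2)

text \<open>The cone over a spherical cap is cut perpendicular to its axis: the slice at height t is
  a disc bounded by the cone for t < b and by the unit sphere for t > b. The cubic terms of the two
  integrals cancel; the linear dependence on b that is left is Archimedes' theorem.\<close>

lemma emeasure_axis_cone:
  assumes b: "0 < b" "b < 1"
  shows "emeasure lborel {x::real^3. norm x < 1 \<and> b * norm x < x $ 1} = ennreal (2 * pi / 3 * (1 - b))"
proof -
  \<comment> \<open>b is the cosine of the half-opening angle and c the square of its tangent, so
    the cone has squared radius c t^2 at height t.\<close>
  define c where "c = (1 - b\<^sup>2) / b\<^sup>2"
  have b2: "b\<^sup>2 < 1"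
    using b by (simp add: abs_square_less_1)
  have c: "c \<ge> 0" "c * b\<^sup>2 = 1 - b\<^sup>2"
    using b b2 by (simp_all add: c_def)
  have cb: "c * b ^ 3 = (1 - b\<^sup>2) * b"
    unfolding c(2)[symmetric] by (simp add: power2_eq_square power3_eq_cube)
  let ?T = "{p :: real \<times> (real \<times> real). norm p < 1 \<and> b * norm p < fst p}"
  let ?S = "{x::real^3. norm x < 1 \<and> b * norm x < x $ 1}"
  let ?f = "\<lambda>t. ennreal (pi * (c * t\<^sup>2)) * indicator {0..b} t + ennreal (pi * (1 - t\<^sup>2)) * indicator {b..1} t"
  have S: "?S \<in> sets borel"
    by (intro borel_open open_Collect_conj open_Collect_less continuous_intros)

  \<comment> \<open>At t = b both indicators in \<open>?f\<close> equal 1. This point is left out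
    here and is a null set in the integral below.\<close>
  have slice: "emeasure lborel (Pair t -` ?T) = ?f t"
    if tb: "t \<noteq> b" for t
  proof -
    have eq: "Pair t -` ?T =
      {y. t > 0 \<and> t\<^sup>2 + (norm y)\<^sup>2 < 1 \<and> b\<^sup>2 * (t\<^sup>2 + (norm y)\<^sup>2) < t\<^sup>2}" (is "?l = _")
    proof -
      have "b * sqrt (t\<^sup>2 + (norm y)\<^sup>2) < t \<longleftrightarrow> t > 0 \<and> b\<^sup>2 * (t\<^sup>2 + (norm y)\<^sup>2) < t\<^sup>2" for y :: "real \<times> real"
      proof -
        have r: "b * sqrt (t\<^sup>2 + (norm y)\<^sup>2) = sqrt (b\<^sup>2 * (t\<^sup>2 + (norm y)\<^sup>2))"
          using b by (simp add: real_sqrt_mult)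
        show ?thesis unfolding r by (rule sqrt_less_iff) simp
      qed
      moreover have "norm (t, y) = sqrt (t\<^sup>2 + (norm y)\<^sup>2)" for y :: "real \<times> real"
        by (simp add: norm_Pair)
      ultimately show ?thesis by (simp add: vimage_def del: split_paired_All) blast
    qed
    consider "t \<le> 0" | "0 < t" "t < b" | "b < t" "t < 1" | "t \<ge> 1"
      using tb by argo
    then show ?thesis
    proof cases
      case 1
      then have l: "?l = {}" unfolding eq by auto
      show ?thesis unfolding l using 1 b by (auto simp: indicator_def)
    next
      case 2
      have l: "?l = ball 0 (sqrt (c * t\<^sup>2))"
      proof -
        have *: "t\<^sup>2 + X < 1 \<and> b\<^sup>2 * (t\<^sup>2 + X) < t\<^sup>2 \<longleftrightarrow> X < c * t\<^sup>2" if "X \<ge> 0" for X :: real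
        proof -
          have "t\<^sup>2 < b\<^sup>2" using 2 by (simp add: power_strict_mono)
          then have "t\<^sup>2 + X < 1" if "b\<^sup>2 * (t\<^sup>2 + X) < t\<^sup>2"
          proof -
            have "b\<^sup>2 * (t\<^sup>2 + X) < b\<^sup>2 * 1" using that \<open>t\<^sup>2 < b\<^sup>2\<close> by linarith
            then show ?thesis using b by (subst (asm) mult_less_cancel_left_pos) auto
          qed
          moreover have "X < c * t\<^sup>2 \<longleftrightarrow> b\<^sup>2 * (t\<^sup>2 + X) < t\<^sup>2"
            using b by (simp add: c_def pos_less_divide_eq times_divide_eq_left algebra_simps)
          ultimately show ?thesis by blast
        qed
        have "norm y < sqrt (c * t\<^sup>2) \<longleftrightarrow> t\<^sup>2 + (norm y)\<^sup>2 < 1 \<and> b\<^sup>2 * (t\<^sup>2 + (norm y)\<^sup>2) < t\<^sup>2" for y :: "real \<times> real"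
          by (subst less_sqrt_iff) (use * in simp_all)
        then show ?thesis unfolding eq set_eq_iff mem_Collect_eq mem_ball_0 using 2 by simp
      qed
      have "0 \<le> c * t\<^sup>2" using c by simp
      from emeasure_disc[OF this] show ?thesis unfolding l using 2 by (simp add: indicator_def)
    next
      case 3
      have l: "?l = ball 0 (sqrt (1 - t\<^sup>2))"
      proof -
        have *: "t\<^sup>2 + X < 1 \<and> b\<^sup>2 * (t\<^sup>2 + X) < t\<^sup>2 \<longleftrightarrow> X < 1 - t\<^sup>2" if "X \<ge> 0" for X :: real
        proof -
          have "b\<^sup>2 < t\<^sup>2" using 3 b by (simp add: power_strict_mono)
          then have "b\<^sup>2 * (t\<^sup>2 + X) < t\<^sup>2" if "t\<^sup>2 + X < 1"
          proof -
            have "b\<^sup>2 * (t\<^sup>2 + X) \<le> b\<^sup>2 * 1" using that by (intro mult_left_mono) auto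
            then show ?thesis using \<open>b\<^sup>2 < t\<^sup>2\<close> by linarith
          qed
          then show ?thesis by auto
        qed
        have "norm y < sqrt (1 - t\<^sup>2) \<longleftrightarrow> t\<^sup>2 + (norm y)\<^sup>2 < 1 \<and> b\<^sup>2 * (t\<^sup>2 + (norm y)\<^sup>2) < t\<^sup>2" for y :: "real \<times> real"
          by (subst less_sqrt_iff) (use * in simp_all)
        moreover have "t > 0" using 3 b by simp
        ultimately show ?thesis unfolding eq set_eq_iff mem_Collect_eq mem_ball_0 by simp
      qed
      have "0 \<le> 1 - t\<^sup>2" using 3 b by (simp add: abs_square_le_1)
      from emeasure_disc[OF this] show ?thesis unfolding l using 3 b by (simp add: indicator_def)
    next
      case 4
      then have "t\<^sup>2 \<ge> 1" by (simp add: one_le_power)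
      then have "\<not> t\<^sup>2 + (norm y)\<^sup>2 < 1" for y :: "real \<times> real"
        using zero_le_power2[of "norm y"] by linarith
      then have l: "?l = {}" unfolding eq by blast
      show ?thesis unfolding l using 4 b by (auto simp: indicator_def)
    qed
  qed
  have "emeasure lborel ?S = emeasure (distr lborel borel triple) ?S"
    by (rule arg_cong2[where f = emeasure, OF lborel_eq_distr_triple refl])
  also have "\<dots> = emeasure lborel (triple -` ?S)"
    using emeasure_distr[of triple lborel borel ?S] S by (simp add: vimage_def del: Int_iff)
  also have "triple -` ?S = ?T"
    by (simp only: vimage_def mem_Collect_eq norm_triple triple_nth)
  also have "emeasure lborel ?T = emeasure (lborel \<Otimes>\<^sub>M lborel) ?T"
    by (simp only: lborel_prod)
  also have "\<dots> = (\<integral>\<^sup>+t. emeasure lborel (Pair t -` ?T) \<partial>lborel)"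
  proof (rule lborel.emeasure_pair_measure_alt)
    have "?T \<in> sets borel"
      by (intro borel_open open_Collect_conj open_Collect_less continuous_intros)
    then show "?T \<in> sets (lborel \<Otimes>\<^sub>M lborel)"
      by (simp only: lborel_prod sets_lborel)
  qed
  also have "\<dots> = (\<integral>\<^sup>+t. ?f t \<partial>lborel)"
    by (rule nn_integral_cong_AE) (rule eventually_mono[OF AE_lborel_singleton[of b]], rule slice)
  also have "\<dots> = (\<integral>\<^sup>+t. ennreal (pi * (c * t\<^sup>2)) * indicator {0..b} t \<partial>lborel) +
      (\<integral>\<^sup>+t. ennreal (pi * (1 - t\<^sup>2)) * indicator {b..1} t \<partial>lborel)"
    by (rule nn_integral_add) auto
  also have "(\<integral>\<^sup>+t. ennreal (pi * (c * t\<^sup>2)) * indicator {0..b} t \<partial>lborel) =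
      ennreal (pi * (c * b ^ 3 / 3) - pi * (c * 0 ^ 3 / 3))"
  proof (rule nn_integral_FTC_Icc[where F = "\<lambda>t. pi * (c * t ^ 3 / 3)"])
    show "((\<lambda>t. pi * (c * t ^ 3 / 3)) has_real_derivative pi * (c * x\<^sup>2)) (at x)" for x
      by (auto intro!: derivative_eq_intros)
  qed (use b c in auto)
  also have "(\<integral>\<^sup>+t. ennreal (pi * (1 - t\<^sup>2)) * indicator {b..1} t \<partial>lborel) =
      ennreal (pi * (1 - 1 ^ 3 / 3) - pi * (b - b ^ 3 / 3))"
  proof (rule nn_integral_FTC_Icc[where F = "\<lambda>t. pi * (t - t ^ 3 / 3)"])
    show "((\<lambda>t. pi * (t - t ^ 3 / 3)) has_real_derivative pi * (1 - x\<^sup>2)) (at x)" for x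
      by (auto intro!: derivative_eq_intros)
  qed (use b in \<open>auto simp: abs_square_le_1\<close>)
  also have "ennreal (pi * (c * b ^ 3 / 3) - pi * (c * 0 ^ 3 / 3)) + \<dots> =
     ennreal ((pi * (c * b ^ 3 / 3) - pi * (c * 0 ^ 3 / 3)) +
       (pi * (1 - 1 ^ 3 / 3) - pi * (b - b ^ 3 / 3)))"
  proof -
    have "0 \<le> c * b ^ 3" using b c by simp
    \<comment> \<open>The factorization of 2/3 - b + b^3/3, which has a double root at b = 1.
      Nonnegativity is what allows the two \<open>ennreal\<close> values to be added as
      reals.\<close>
    moreover have "0 \<le> (1 - b)\<^sup>2 * (2 + b) / 3" using b by simp
    then have "0 \<le> 1 - 1 ^ 3 / 3 - (b - b ^ 3 / 3)"
      by (simp add: power2_eq_square power3_eq_cube algebra_simps)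
    then have "0 \<le> pi * (1 - 1 ^ 3 / 3) - pi * (b - b ^ 3 / 3)"
      unfolding right_diff_distrib[symmetric] by (intro mult_nonneg_nonneg) auto
    ultimately show ?thesis by (intro ennreal_plus[symmetric]) auto
  qed
  also have "(pi * (c * b ^ 3 / 3) - pi * (c * 0 ^ 3 / 3)) +
       (pi * (1 - 1 ^ 3 / 3) - pi * (b - b ^ 3 / 3)) = 2 * pi / 3 * (1 - b)"
  proof -
    have "(1 - b\<^sup>2) * b / 3 + (1 - 1 / 3) - (b - b ^ 3 / 3) = 2 / 3 * (1 - b)"
      by (simp add: power2_eq_square power3_eq_cube field_simps)
    then have "pi * ((1 - b\<^sup>2) * b / 3 + (1 - 1 / 3) - (b - b ^ 3 / 3)) = pi * (2 / 3 * (1 - b))"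
      by (rule arg_cong)
    then show ?thesis unfolding cb by (simp add: distrib_left right_diff_distrib)
  qed
  finally show ?thesis .
qed

section \<open>Surface measure through cones: rotations, caps and the law of a coordinate\<close>

lemma borel_measurable_sgn: "(sgn :: real^3 \<Rightarrow> _) \<in> borel_measurable borel"
proof -
  have "(\<lambda>x::real^3. inverse (norm x) *\<^sub>R x) \<in> borel_measurable borel"
    by measurable
  then show ?thesis
    by (simp add: sgn_div_norm[abs_def])
qed

lemma measurable_sphere_measure: "f \<in> measurable borel N \<Longrightarrow> f \<in> measurable sphere_measure N"
  by (subst measurable_cong_sets[OF sets_sphere_measure refl]) (rule measurable_restrict_space1)

lemma sgn_cone_borel:
  assumes B: "B \<in> sets borel"
  shows "{x::real^3. norm x < 1 \<and> x \<noteq> 0 \<and> sgn x \<in> B} \<in> sets borel"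
proof -
  have "{x::real^3. norm x < 1 \<and> x \<noteq> 0 \<and> sgn x \<in> B} = (ball 0 1 - {0}) \<inter> (sgn -` B \<inter> space borel)"
    by auto
  also have "\<dots> \<in> sets borel"
    using measurable_sets[OF borel_measurable_sgn B] by (intro sets.Int) auto
  finally show ?thesis .
qed

text \<open>The factor 3/(4 pi) is the reciprocal of the volume of the unit ball: the probability of
  a set on the sphere is the fraction of the ball filled by its cone.\<close>

lemma emeasure_sphere_measure:
  assumes B: "B \<in> sets borel"
  shows "emeasure sphere_measure (B \<inter> sphere 0 1) =
    ennreal (3 / (4 * pi)) * emeasure lborel {x. norm x < 1 \<and> x \<noteq> 0 \<and> sgn x \<in> B}"
proof -
  let ?M = "restrict_space lborel (ball 0 1 - {0::real^3})"
  let ?S = "{x. norm x < 1 \<and> x \<noteq> 0 \<and> sgn x \<in> B}"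
  have sgn: "sgn \<in> measurable ?M (restrict_space borel (sphere 0 1))"
  proof (rule measurable_restrict_space2)
    show "sgn \<in> space ?M \<rightarrow> sphere 0 1"
      by (auto simp: space_restrict_space norm_sgn)
    show "sgn \<in> measurable ?M borel"
      using borel_measurable_sgn by (intro measurable_restrict_space1) simp
  qed
  have "B \<inter> sphere 0 1 \<in> sets (restrict_space borel (sphere 0 1))"
    using B by (auto simp: sets_restrict_space)
  then have "emeasure sphere_measure (B \<inter> sphere 0 1) =
      ennreal (1 / (4 * pi)) * (3 * emeasure ?M (sgn -` (B \<inter> sphere 0 1) \<inter> space ?M))"
    by (simp add: sphere_measure_def sphere_area_def emeasure_distr[OF sgn] mult.assoc)
  also have "sgn -` (B \<inter> sphere 0 1) \<inter> space ?M = ?S"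
    by (auto simp: space_restrict_space norm_sgn)
  also have "emeasure ?M ?S = emeasure lborel ?S"
    by (rule emeasure_restrict_space) auto
  also have "ennreal (1 / (4 * pi)) * (3 * emeasure lborel ?S) = ennreal (3 / (4 * pi)) * emeasure lborel ?S"
    by (simp add: mult.assoc[symmetric]) (simp add: ennreal_mult'[symmetric] flip: ennreal_numeral)
  finally show ?thesis .
qed

text \<open>\<open>sgn\<close> commutes with norm-preserving linear maps, so the cone over a
  preimage is the preimage of the cone, and invariance of volume carries over to the sphere.\<close>

lemma distr_sphere_measure_orthogonal:
  assumes f: "orthogonal_transformation f"
  shows "distr sphere_measure (restrict_space borel (sphere 0 1)) f = sphere_measure"
proof (rule measure_eqI)
  have bl: "bounded_linear f"
    using orthogonal_transformation_linear[OF f] by (simp add: linear_conv_bounded_linear)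
  have fb: "f \<in> borel_measurable borel"
    by (intro borel_measurable_continuous_onI linear_continuous_on bl)
  have fm: "f \<in> measurable sphere_measure (restrict_space borel (sphere 0 1))"
    using orthogonal_transformation_norm[OF f]
    by (intro measurable_restrict_space2 measurable_sphere_measure fb) auto
  show "sets (distr sphere_measure (restrict_space borel (sphere 0 1)) f) = sets sphere_measure"
    by (simp add: sets_sphere_measure)
  fix A assume "A \<in> sets (distr sphere_measure (restrict_space borel (sphere 0 1)) f)"
  then obtain B where B: "B \<in> sets borel" "A = B \<inter> sphere 0 1"
    by (auto simp: sets_restrict_space)
  have fB: "f -` B \<in> sets borel"
    using measurable_sets[OF fb B(1)] by simp
  have sg: "sgn (f x) = f (sgn x)" for x
    by (simp add: sgn_div_norm orthogonal_transformation_norm[OF f] linear_scale[OF orthogonal_transformation_linear[OF f]])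
  have f0: "f x = 0 \<longleftrightarrow> x = 0" for x
    using orthogonal_transformation_norm[OF f, of x] by (metis norm_eq_zero)
  have "f -` A \<inter> space sphere_measure = f -` B \<inter> sphere 0 1"
    using orthogonal_transformation_norm[OF f] B by auto
  then have "emeasure (distr sphere_measure (restrict_space borel (sphere 0 1)) f) A =
     emeasure sphere_measure (f -` B \<inter> sphere 0 1)"
    using B by (subst emeasure_distr[OF fm]) (auto simp: sets_restrict_space)
  also have "\<dots> = ennreal (3 / (4 * pi)) * emeasure lborel {x. norm x < 1 \<and> x \<noteq> 0 \<and> sgn x \<in> f -` B}"
    by (rule emeasure_sphere_measure[OF fB])
  also have "{x. norm x < 1 \<and> x \<noteq> 0 \<and> sgn x \<in> f -` B} = f -` {x. norm x < 1 \<and> x \<noteq> 0 \<and> sgn x \<in> B}"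
    by (auto simp: sg f0 orthogonal_transformation_norm[OF f])
  also have "emeasure lborel \<dots> = emeasure lborel {x. norm x < 1 \<and> x \<noteq> 0 \<and> sgn x \<in> B}"
    by (rule emeasure_orthogonal_vimage[OF f sgn_cone_borel[OF B(1)]])
      (rule bounded_subset[of "ball 0 1"], auto)
  also have "ennreal (3 / (4 * pi)) * \<dots> = emeasure sphere_measure A"
    unfolding B(2) by (rule emeasure_sphere_measure[OF B(1), symmetric])
  finally show "emeasure (distr sphere_measure (restrict_space borel (sphere 0 1)) f) A = emeasure sphere_measure A" .
qed

lemma distr_sphere_measure_uminus:
  "distr sphere_measure (restrict_space borel (sphere 0 1)) uminus = sphere_measure"
  by (rule distr_sphere_measure_orthogonal) (simp add: orthogonal_transformation_def linear_iff)

lemma measurable_uminus_sphere: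
  "uminus \<in> measurable sphere_measure (restrict_space borel (sphere 0 1))"
  by (intro measurable_restrict_space2 measurable_sphere_measure) auto

text \<open>A rotation f taking the first axis to u pulls the cone around u back to the axis cone,
  whose volume is known.\<close>

lemma measure_sphere_cap:
  assumes u: "norm u = 1" and a: "0 < a" "a < 1"
  shows "measure sphere_measure {\<omega> \<in> sphere 0 1. a < \<omega> \<bullet> u} = (1 - a) / 2"
proof -
  let ?B = "{\<omega>::real^3. a < \<omega> \<bullet> u}"
  have B: "?B \<in> sets borel"
    by (intro borel_open open_Collect_less continuous_intros)
  have "norm (axis 1 1 :: real^3) = norm u" using u by simp
  from orthogonal_transformation_exists[OF this]
  obtain f :: "real^3 \<Rightarrow> real^3" where f: "orthogonal_transformation f" "f (axis 1 1) = u"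
    by blast
  have "{\<omega> \<in> sphere 0 1. a < \<omega> \<bullet> u} = ?B \<inter> sphere 0 1" by auto
  then have "emeasure sphere_measure {\<omega> \<in> sphere 0 1. a < \<omega> \<bullet> u} =
     ennreal (3 / (4 * pi)) * emeasure lborel {x. norm x < 1 \<and> x \<noteq> 0 \<and> sgn x \<in> ?B}"
    using emeasure_sphere_measure[OF B] by simp
  also have "{x. norm x < 1 \<and> x \<noteq> 0 \<and> sgn x \<in> ?B} = {x. norm x < 1 \<and> a * norm x < x \<bullet> u}"
  proof -
    have "a < sgn x \<bullet> u \<longleftrightarrow> a * norm x < x \<bullet> u" if "x \<noteq> 0" for x
    proof -
      have "sgn x \<bullet> u = (x \<bullet> u) / norm x" by (simp add: sgn_div_norm divide_inverse mult.commute)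
      then show ?thesis using that by (simp add: pos_less_divide_eq)
    qed
    then have "(norm x < 1 \<and> x \<noteq> 0 \<and> sgn x \<in> ?B) \<longleftrightarrow> norm x < 1 \<and> a * norm x < x \<bullet> u" for x
      by (cases "x = 0") simp_all
    then show ?thesis by (rule Collect_cong)
  qed
  also have "emeasure lborel \<dots> = emeasure lborel (f -` {x. norm x < 1 \<and> a * norm x < x \<bullet> u})"
  proof (rule emeasure_orthogonal_vimage[OF f(1), symmetric])
    show "{x. norm x < 1 \<and> a * norm x < x \<bullet> u} \<in> sets borel"
      by (intro borel_open open_Collect_conj open_Collect_less continuous_intros)
    show "bounded {x. norm x < 1 \<and> a * norm x < x \<bullet> u}"
      by (rule bounded_subset[of "ball 0 1"]) auto
  qed
  also have "f -` {x. norm x < 1 \<and> a * norm x < x \<bullet> u} = {x. norm x < 1 \<and> a * norm x < x $ 1}"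
    using f by (auto simp: orthogonal_transformation_def orthogonal_transformation_norm[OF f(1)]
      f(2)[symmetric] cart_eq_inner_axis)
  also have "emeasure lborel \<dots> = ennreal (2 * pi / 3 * (1 - a))"
    by (rule emeasure_axis_cone[OF a])
  also have "ennreal (3 / (4 * pi)) * \<dots> = ennreal ((1 - a) / 2)"
    using a by (simp add: ennreal_mult'[symmetric] field_simps)
  finally show ?thesis
    using a by (simp add: measure_def)
qed

lemma borel_measurable_inner_sphere [measurable]: "(\<lambda>\<omega>. \<omega> \<bullet> u) \<in> borel_measurable sphere_measure"
  by (intro measurable_sphere_measure) simp

text \<open>Finite measures on the line are compared on the half-lines \<open>{a<..}\<close>. Caps
  give the values for 0 < a < 1; the antipodal map gives a < 0 by complement, and a = 0 follows by
  approximation from above together with symmetry.\<close>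

lemma distr_sphere_measure_inner:
  assumes u: "norm u = 1"
  shows "distr sphere_measure borel (\<lambda>\<omega>. \<omega> \<bullet> u) = density lborel (\<lambda>t. ennreal (indicator {-1..1} t / 2))"
proof -
  define M where "M = distr sphere_measure borel (\<lambda>\<omega>. \<omega> \<bullet> u)"
  interpret M: finite_measure M
    unfolding M_def by (rule sphere_measure.finite_measure_distr) simp
  have setsM [simp, measurable_cong]: "sets M = sets borel" and spaceM [simp]: "space M = UNIV"
    by (simp_all add: M_def)
  have M_eq: "measure M S = measure sphere_measure {\<omega> \<in> sphere 0 1. \<omega> \<bullet> u \<in> S}" if "S \<in> sets borel" for S
    using that by (simp add: M_def measure_distr vimage_def Int_def conj_commute)
  have neg: "measure M (uminus -` S) = measure M S" if S: "S \<in> sets borel" for S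
  proof -
    have nS: "uminus -` S \<in> sets borel"
      using measurable_sets[of uminus borel borel S] S by simp
    have A: "{\<omega> \<in> sphere 0 1. \<omega> \<bullet> u \<in> S} \<in> sets (restrict_space borel (sphere 0 (1::real) :: (real^3) set))"
      using measurable_sets[of "\<lambda>\<omega>. \<omega> \<bullet> u" sphere_measure borel S] S
      by (simp add: sets_sphere_measure vimage_def Int_def conj_commute)
    have "measure M S = measure (distr sphere_measure (restrict_space borel (sphere 0 1)) uminus) {\<omega> \<in> sphere 0 1. \<omega> \<bullet> u \<in> S}"
      by (simp add: M_eq[OF S] distr_sphere_measure_uminus)
    also have "\<dots> = measure sphere_measure (uminus -` {\<omega> \<in> sphere 0 1. \<omega> \<bullet> u \<in> S} \<inter> space sphere_measure)"
      by (rule measure_distr[OF measurable_uminus_sphere A])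
    also have "uminus -` {\<omega> \<in> sphere 0 1. \<omega> \<bullet> u \<in> S} \<inter> space sphere_measure = {\<omega> \<in> sphere 0 1. \<omega> \<bullet> u \<in> uminus -` S}"
      by auto
    finally show ?thesis by (simp add: M_eq[OF nS])
  qed
  have total: "measure M UNIV = 1"
  proof -
    have "{\<omega> :: real^3. norm \<omega> = 1} = sphere 0 1" by auto
    then show ?thesis using prob_sphere_measure by (simp add: M_eq[of UNIV]) (simp add: measure_def)
  qed
  have ge1: "measure M {a<..} = 0" if "a \<ge> 1" for a
  proof -
    have "\<omega> \<bullet> u \<le> a" if "norm \<omega> = 1" for \<omega>
      using norm_cauchy_schwarz[of \<omega> u] that u \<open>a \<ge> 1\<close> by simp
    then have e: "{\<omega> \<in> sphere 0 1. \<omega> \<bullet> u \<in> {a<..}} = {}"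
      by force
    show ?thesis by (subst M_eq) (simp, simp only: e measure_empty)
  qed
  have cap: "measure M {a<..} = (1 - a) / 2" if "0 < a" "a \<le> 1" for a
    using measure_sphere_cap[OF u, of a] that ge1[of a] by (cases "a = 1") (auto simp: M_eq)
  \<comment> \<open>Reflecting the complement of \<open>{a<..}\<close> produces the closed half-line
    \<open>{-a..}\<close>, so the cap formula is extended to closed half-lines by squeezing between
    open ones.\<close>
  have cap': "measure M {a..} = (1 - a) / 2" if "0 < a" "a \<le> 1" for a
  proof (rule antisym)
    have "(1 - a) / 2 \<le> measure M {a<..}" using cap[OF that] by simp
    also have "\<dots> \<le> measure M {a..}" by (rule M.finite_measure_mono) auto
    finally show "(1 - a) / 2 \<le> measure M {a..}" .
    have "measure M {a..} \<le> (1 - (a - e)) / 2" if "0 < e" "e < a" for e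
    proof -
      have "measure M {a..} \<le> measure M {a - e<..}"
        using that by (intro M.finite_measure_mono) auto
      also have "\<dots> = (1 - (a - e)) / 2"
        using that \<open>a \<le> 1\<close> by (intro cap) auto
      finally show ?thesis .
    qed
    then have "2 * measure M {a..} - 1 + a \<le> e" if "0 < e" "e < a" for e
      using that by fastforce
    then have "2 * measure M {a..} - 1 + a \<le> 0"
      by (rule dense_ge_bounded[OF \<open>0 < a\<close>])
    then show "measure M {a..} \<le> (1 - a) / 2" by simp
  qed
  have cap'': "measure M {a..} = 0" if "a \<ge> 1" for a
  proof (cases "a = 1")
    case True
    then show ?thesis using cap'[of 1] by simp
  next
    case False
    have "measure M {a..} \<le> measure M {1<..}"
      using that False by (intro M.finite_measure_mono) auto
    then show ?thesis using ge1[of 1] by (simp add: measure_le_0_iff)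
  qed
  have zero: "measure M {0<..} = 1 / 2"
  proof (rule antisym)
    have "measure M {0<..} + measure M {..<0} = measure M ({0<..} \<union> {..<0})"
      by (rule M.finite_measure_Union[symmetric]) auto
    also have "\<dots> \<le> measure M UNIV"
      by (rule M.finite_measure_mono) auto
    also have "measure M {..<0} = measure M {0<..}"
      using neg[of "{0<..}"] by (simp add: vimage_def lessThan_def)
    finally show "measure M {0<..} \<le> 1 / 2" using total by simp
    have "1 - 2 * measure M {0<..} \<le> e" if "0 < e" "e < 1" for e
    proof -
      have "(1 - e) / 2 = measure M {e<..}" using that by (intro cap[symmetric]) auto
      also have "\<dots> \<le> measure M {0<..}" using that by (intro M.finite_measure_mono) auto
      finally show ?thesis by simp
    qed
    then have "1 - 2 * measure M {0<..} \<le> 0"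
      by (rule dense_ge_bounded[OF zero_less_one])
    then show "1 / 2 \<le> measure M {0<..}" by simp
  qed
  have negcap: "measure M {a<..} = 1 - measure M {-a..}" for a
  proof -
    have "measure M {a<..} + measure M {..a} = measure M ({a<..} \<union> {..a})"
      by (rule M.finite_measure_Union[symmetric]) auto
    also have "{a<..} \<union> {..a} = UNIV" by auto
    also have "measure M {..a} = measure M {-a..}"
      using neg[of "{-a..}"] by (simp add: vimage_def atMost_def)
    finally show ?thesis using total by simp
  qed
  have M_val: "measure M {a<..} = (if a \<ge> 1 then 0 else if a \<le> -1 then 1 else (1 - a) / 2)" for a
  proof -
    consider "a \<ge> 1" | "0 < a" "a < 1" | "a = 0" | "-1 < a" "a < 0" | "a \<le> -1" by argo
    then show ?thesis
    proof cases
      case 4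
      then show ?thesis using negcap[of a] cap'[of "-a"] by (simp add: field_simps)
    next
      case 5
      then show ?thesis using negcap[of a] cap''[of "-a"] by simp
    qed (use ge1 cap zero in auto)
  qed
  let ?N = "density lborel (\<lambda>t::real. ennreal (indicator {-1..1} t / 2))"
  have N_val: "emeasure ?N {a<..} = ennreal (if a \<ge> 1 then 0 else if a \<le> -1 then 1 else (1 - a) / 2)" for a
  proof -
    have "emeasure ?N {a<..} = (\<integral>\<^sup>+t. ennreal (1 / 2) * indicator ({-1..1} \<inter> {a<..}) t \<partial>lborel)"
      by (subst emeasure_density) (auto intro!: nn_integral_cong simp: indicator_def)
    also have "\<dots> = ennreal (1 / 2) * emeasure lborel ({-1..1} \<inter> {a<..})"
      by (rule nn_integral_cmult_indicator) auto
    also have "\<dots> = ennreal (if a \<ge> 1 then 0 else if a \<le> -1 then 1 else (1 - a) / 2)"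
    proof -
      consider "a \<ge> 1" | "a \<le> -1" | "-1 < a" "a < 1" by argo
      then show ?thesis
      proof cases
        case 1
        then have e: "{-1..1} \<inter> {a<..} = {}" by auto
        show ?thesis unfolding e using 1 by simp
      next
        case 2
        have "emeasure lborel ({-1..1} \<inter> {a<..}) = ennreal 2"
        proof (cases "a = -1")
          case True
          then have "{-1..1} \<inter> {a<..} = {-1<..1}" by auto
          then show ?thesis by simp
        next
          case False
          then have "{-1..1} \<inter> {a<..} = {-1..1}" using 2 by auto
          then show ?thesis by simp
        qed
        then have "ennreal (1 / 2) * emeasure lborel ({-1..1} \<inter> {a<..}) = ennreal (1 / 2 * 2)"
          by (simp only: ennreal_mult'[symmetric])
        then show ?thesis using 2 by simp
      next
        case 3
        then have e: "{-1..1} \<inter> {a<..} = {a<..1}" by auto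
        have "ennreal (1 / 2) * emeasure lborel ({-1..1} \<inter> {a<..}) = ennreal (1 / 2 * (1 - a))"
          unfolding e using 3 by (subst ennreal_mult') auto
        then show ?thesis using 3 by simp
      qed
    qed
    finally show ?thesis .
  qed
  have "M = ?N"
    by (rule measure_eqI_lessThan) (auto simp: N_val M.emeasure_eq_measure M_val)
  then show ?thesis by (simp add: M_def)
qed

section \<open>Cosine integrals and even moments over the sphere\<close>

lemma integral_sphere_inner:
  assumes "norm u = 1" and [measurable]: "h \<in> borel_measurable borel"
  shows "(\<integral>\<omega>. h (\<omega> \<bullet> u) \<partial>sphere_measure) = (\<integral>t. (h t :: real) * indicator {-1..1} t \<partial>lborel) / 2"
proof -
  have "(\<integral>\<omega>. h (\<omega> \<bullet> u) \<partial>sphere_measure) = (\<integral>t. h t \<partial>distr sphere_measure borel (\<lambda>\<omega>. \<omega> \<bullet> u))"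
    by (rule integral_distr[symmetric]) auto
  also have "\<dots> = (\<integral>t. h t \<partial>density lborel (\<lambda>t. ennreal (indicator {-1..1} t / 2)))"
    by (simp only: distr_sphere_measure_inner[OF assms(1)])
  also have "\<dots> = (\<integral>t. (indicator {-1..1} t / 2) *\<^sub>R h t \<partial>lborel)"
    by (rule integral_density) auto
  also have "\<dots> = (\<integral>t. h t * indicator {-1..1} t / 2 \<partial>lborel)"
    by (rule Bochner_Integration.integral_cong) (auto simp: mult.commute)
  also have "\<dots> = (\<integral>t. h t * indicator {-1..1} t \<partial>lborel) / 2"
    by simp
  finally show ?thesis .
qed

lemma integral_sphere_cos:
  assumes "norm u = 1" "c \<noteq> 0"
  shows "(\<integral>\<omega>. cos (c * (\<omega> \<bullet> u)) \<partial>sphere_measure) = sin c / c"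
proof -
  have "(\<integral>t. cos (c * t) * indicator {-1..1} t \<partial>lborel) = sin (c * 1) / c - sin (c * (-1)) / c"
    by (rule integral_FTC_Icc_real) (use assms in \<open>auto intro!: derivative_eq_intros\<close>)
  then show ?thesis
    by (subst integral_sphere_inner[OF assms(1), where h = "\<lambda>t. cos (c * t)"]) auto
qed

lemma integral_sphere_power:
  assumes "norm u = 1" "even k"
  shows "(\<integral>\<omega>. (\<omega> \<bullet> u) ^ k \<partial>sphere_measure) = 1 / (real k + 1)"
proof -
  have "(\<integral>t. t ^ k * indicator {-1..1} t \<partial>lborel) = 1 ^ Suc k / real (Suc k) - (-1) ^ Suc k / real (Suc k)"
    using integral_power[of "-1" 1 k] by (simp add: add_divide_distrib)
  then show ?thesis
    using assms(2) by (subst integral_sphere_inner[OF assms(1), where h = "\<lambda>t. t ^ k"]) (auto simp: field_simps)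
qed

lemma integral_sphere_power':
  assumes "even k" "k > 0"
  shows "(\<integral>\<omega>. (\<omega> \<bullet> v) ^ k \<partial>sphere_measure) = norm v ^ k / (real k + 1)"
proof (cases "v = 0")
  case True
  then show ?thesis using assms by (simp add: power_0_left)
next
  case False
  have "(\<integral>\<omega>. (\<omega> \<bullet> v) ^ k \<partial>sphere_measure) = (\<integral>\<omega>. norm v ^ k * (\<omega> \<bullet> sgn v) ^ k \<partial>sphere_measure)"
    using False by (intro Bochner_Integration.integral_cong) (auto simp: sgn_div_norm mult.assoc[symmetric] simp flip: power_mult_distrib)
  also have "\<dots> = norm v ^ k / (real k + 1)"
    using False assms by (simp add: integral_sphere_power norm_sgn)
  finally show ?thesis .
qed

lemma integral_sphere_cos':
  "(\<integral>\<omega>. cos (\<omega> \<bullet> w) \<partial>sphere_measure) = (if w = 0 then 1 else sin (norm w) / norm w)"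
proof (cases "w = 0")
  case True
  then show ?thesis using prob_sphere_measure by (simp add: measure_def)
next
  case False
  have "(\<integral>\<omega>. cos (\<omega> \<bullet> w) \<partial>sphere_measure) = (\<integral>\<omega>. cos (norm w * (\<omega> \<bullet> sgn w)) \<partial>sphere_measure)"
    using False by (intro Bochner_Integration.integral_cong) (auto simp: sgn_div_norm mult.assoc[symmetric])
  also have "\<dots> = sin (norm w) / norm w"
    using False by (simp add: integral_sphere_cos norm_sgn)
  finally show ?thesis using False by simp
qed

lemma integral_sphere_odd:
  fixes h :: "real^3 \<Rightarrow> real"
  assumes h: "h \<in> borel_measurable borel" and odd: "\<And>\<omega>. h (- \<omega>) = - h \<omega>"
  shows "(\<integral>\<omega>. h \<omega> \<partial>sphere_measure) = 0"
proof -
  have "(\<integral>\<omega>. h \<omega> \<partial>sphere_measure) = (\<integral>\<omega>. h \<omega> \<partial>distr sphere_measure (restrict_space borel (sphere 0 1)) uminus)"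
    by (simp add: distr_sphere_measure_uminus)
  also have "\<dots> = (\<integral>\<omega>. h (- \<omega>) \<partial>sphere_measure)"
    by (rule integral_distr[OF measurable_uminus_sphere]) (rule measurable_restrict_space1[OF h])
  also have "\<dots> = - (\<integral>\<omega>. h \<omega> \<partial>sphere_measure)"
    by (simp add: odd)
  finally show ?thesis by simp
qed

section \<open>Orthogonal projections and angles\<close>

lemma cinner_add_right: "cinner x (y + z) = cinner x y + cinner x z"
proof -
  have "cnj (cinner (y + z) x) = cnj (cinner y x) + cnj (cinner z x)"
    by (simp add: cinner_add_left)
  then show ?thesis by (simp only: cinner_commute[symmetric])
qed

lemma cinner_scaleC_right: "cinner x (scaleC c y) = cnj c * cinner x y"
proof -
  have "cnj (cinner (scaleC c y) x) = cnj c * cnj (cinner y x)"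
    by (simp add: cinner_scaleC_left)
  then show ?thesis by (simp only: cinner_commute[symmetric])
qed

lemma cinner_minus_left: "cinner (- x) y = - cinner x y"
  unfolding uminus_L2_sphere_def cinner_scaleC_left by simp

lemma cinner_diff_left: "cinner (x - y) z = cinner x z - cinner y z"
  using cinner_add_left[of x "- y" z] by (simp add: cinner_minus_left)

lemma cinner_zero_left [simp]: "cinner 0 x = 0"
  using cinner_diff_left[of 0 0 x] by simp

lemma cinner_zero_right [simp]: "cinner x 0 = 0"
  using cinner_commute[of 0 x] by simp

lemma cinner_sum_left: "cinner (sum f A) x = (\<Sum>a\<in>A. cinner (f a) x)"
  by (induction A rule: infinite_finite_induct) (auto simp: cinner_add_left)

lemma cinner_eq_zero_iff: "cinner x x = 0 \<longleftrightarrow> x = 0"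
  using cinner_self[of x] by auto

lemma Re_cinner: "Re (cinner x y) = inner x y"
  by (simp add: inner_L2_sphere_def)

lemma scaleR_conv_scaleC: "r *\<^sub>R x = scaleC (complex_of_real r) x" for x :: L2_sphere
  by (simp add: scaleR_L2_sphere_def)

text \<open>One Gram-Schmidt step per generator: e is the part of the new generator b orthogonal to
  the previous span, and the projection of f gains its component along e. If e vanishes, the span
  does not grow.\<close>

lemma orthogonal_decomposition_span:
  assumes "finite B"
  shows "\<exists>v\<in>complex_L2.span B. \<forall>w\<in>complex_L2.span B. cinner (f - v) w = 0"
  using assms
proof (induction B arbitrary: f rule: finite_induct)
  case empty
  then show ?case by simp
next
  case (insert b B)
  obtain p where p: "p \<in> complex_L2.span B" "\<And>w. w \<in> complex_L2.span B \<Longrightarrow> cinner (b - p) w = 0"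
    using insert.IH by blast
  obtain v where v: "v \<in> complex_L2.span B" "\<And>w. w \<in> complex_L2.span B \<Longrightarrow> cinner (f - v) w = 0"
    using insert.IH by blast
  define e where "e = b - p"
  have sub: "complex_L2.span B \<subseteq> complex_L2.span (insert b B)"
    by (rule complex_L2.span_mono) auto
  show ?case
  proof (cases "e = 0")
    case True
    then have "b \<in> complex_L2.span B" using p by (simp add: e_def)
    then have "complex_L2.span (insert b B) = complex_L2.span B"
      by (rule complex_L2.span_redundant)
    then show ?thesis using v by auto
  next
    case False
    define c where "c = cinner (f - v) e / cinner e e"
    have e0: "cinner e e \<noteq> 0" using False by (simp add: cinner_eq_zero_iff)
    show ?thesis
    proof (intro bexI ballI)
      have "e \<in> complex_L2.span (insert b B)"
        unfolding e_def using p(1) sub complex_L2.span_base[of b "insert b B"] by (intro complex_L2.span_diff) auto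
      then show "v + scaleC c e \<in> complex_L2.span (insert b B)"
        using v sub by (intro complex_L2.span_add complex_L2.span_scale) auto
      fix w assume "w \<in> complex_L2.span (insert b B)"
      then obtain k where k: "w - scaleC k b \<in> complex_L2.span B"
        using complex_L2.span_breakdown_eq by blast
      define w1 where "w1 = (w - scaleC k b) + scaleC k p"
      have w1: "w1 \<in> complex_L2.span B"
        unfolding w1_def using k p by (intro complex_L2.span_add complex_L2.span_scale)
      have w: "w = scaleC k e + w1"
        by (simp add: w1_def e_def complex_L2.scale_right_diff_distrib)
      have "cinner (f - (v + scaleC c e)) w = cinner (f - v) w - c * cinner e w"
        by (simp add: cinner_diff_left cinner_add_left cinner_scaleC_left)
      also have "\<dots> = cnj k * (cinner (f - v) e - c * cinner e e)"
        using v(2)[OF w1] p(2)[OF w1]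
        by (simp add: w cinner_add_right cinner_scaleC_right e_def[symmetric] algebra_simps)
      also have "\<dots> = 0" using e0 by (simp add: c_def)
      finally show "cinner (f - (v + scaleC c e)) w = 0" .
    qed
  qed
qed

text \<open>\<open>orth_proj\<close> is a definite description. Finite generation is the setting in
  which existence of the projection is available from Gram-Schmidt.\<close>

locale finite_span =
  fixes V :: "L2_sphere set"
  assumes finite_span: "\<exists>B. finite B \<and> V = complex_L2.span B"
begin

abbreviation "P \<equiv> orth_proj V"

lemma subspace: "complex_L2.subspace V"
  using finite_span by auto

lemma orth_proj_eqI:
  assumes "v \<in> V" "\<And>w. w \<in> V \<Longrightarrow> cinner (f - v) w = 0"
  shows "P f = v"
  unfolding orth_proj_def
proof (rule the_equality)
  fix v' assume v': "v' \<in> V \<and> (\<forall>w\<in>V. cinner (f - v') w = 0)"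
  then have d: "v - v' \<in> V" using assms subspace by (intro complex_L2.subspace_diff) auto
  have "cinner (v - v') (v - v') = cinner (f - v') (v - v') - cinner (f - v) (v - v')"
    by (simp add: cinner_diff_left)
  then have "cinner (v - v') (v - v') = 0" using assms(2)[OF d] v' d by simp
  then show "v' = v" by (simp add: cinner_eq_zero_iff)
qed (use assms in auto)

lemma orth_proj_in: "P f \<in> V"
  and orth_proj_orthogonal: "w \<in> V \<Longrightarrow> cinner (f - P f) w = 0"
proof -
  obtain v where v: "v \<in> V" "\<And>w. w \<in> V \<Longrightarrow> cinner (f - v) w = 0"
    using orthogonal_decomposition_span finite_span by metis
  have "P f = v" by (rule orth_proj_eqI[OF v])
  then show "P f \<in> V" "w \<in> V \<Longrightarrow> cinner (f - P f) w = 0" using v by auto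
qed

lemma orth_proj_id: "v \<in> V \<Longrightarrow> P v = v"
  by (rule orth_proj_eqI) auto

lemma cinner_orth_proj: "w \<in> V \<Longrightarrow> cinner (P f) w = cinner f w"
  using orth_proj_orthogonal[of w f] by (simp add: cinner_diff_left)

lemma inner_orth_proj_right: "inner (P f) (P g) = inner f (P g)"
  by (simp add: Re_cinner[symmetric] cinner_orth_proj orth_proj_in)

lemma inner_orth_proj_commute: "inner (P f) g = inner f (P g)"
  using inner_orth_proj_right[of f g] inner_orth_proj_right[of g f] by (simp add: inner_commute)

lemma norm_orth_proj_sq: "(norm f)\<^sup>2 = (norm (P f))\<^sup>2 + (norm (f - P f))\<^sup>2"
  using inner_orth_proj_right[of f f]
  by (simp add: power2_norm_eq_inner inner_diff_left inner_diff_right inner_commute)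

lemma norm_orth_proj_le: "norm (P f) \<le> norm f"
  by (rule power2_le_imp_le) (use norm_orth_proj_sq[of f] in auto)

lemma norm_orth_proj_residual_le: "norm (f - P f) \<le> norm f"
  by (rule power2_le_imp_le) (use norm_orth_proj_sq[of f] in auto)

lemma bounded_linear_orth_proj: "bounded_linear P"
proof (rule bounded_linear_intro)
  show "P (x + y) = P x + P y" for x y
  proof (rule orth_proj_eqI)
    show "P x + P y \<in> V" using subspace orth_proj_in by (intro complex_L2.subspace_add)
    show "cinner (x + y - (P x + P y)) w = 0" if "w \<in> V" for w
      using cinner_orth_proj[OF that] by (simp add: cinner_diff_left cinner_add_left)
  qed
  show "P (r *\<^sub>R x) = r *\<^sub>R P x" for r x
  proof (rule orth_proj_eqI)
    show "r *\<^sub>R P x \<in> V" unfolding scaleR_conv_scaleC using subspace orth_proj_in by (intro complex_L2.subspace_scale)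
    show "cinner (r *\<^sub>R x - r *\<^sub>R P x) w = 0" if "w \<in> V" for w
      using cinner_orth_proj[OF that] by (simp add: cinner_diff_left scaleR_conv_scaleC cinner_scaleC_left)
  qed
  show "norm (P x) \<le> norm x * 1" for x using norm_orth_proj_le by simp
qed

end

lemma finite_span_signal_space: "finite X \<Longrightarrow> finite_span (signal_space \<kappa> X)"
  by (rule finite_span.intro) (auto simp: signal_space_def)

text \<open>\<open>dim\<close> is the cardinality of a basis and an infinite set has
  \<open>card\<close> 0, so positive dimension forces a finite basis.\<close>

lemma finite_span_if_dim_pos:
  assumes "complex_L2.subspace U" "complex_L2.dim U > 0"
  shows "finite_span U"
proof
  obtain B where B: "B \<subseteq> U" "U \<subseteq> complex_L2.span B" "card B = complex_L2.dim U"
    using complex_L2.basis_exists by metis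
  then have "finite B" using assms by (metis card.infinite less_irrefl)
  moreover have "U = complex_L2.span B"
    using B assms complex_L2.span_minimal by blast
  ultimately show "\<exists>B. finite B \<and> U = complex_L2.span B" by blast
qed

text \<open>Angles \<open>\<theta> = arcsin (norm (f - P f))\<close> between a unit vector and a subspace obey a
  triangle inequality; the middle vector is the normalized projection onto \<open>U\<close>.\<close>

lemma angle_triangle_subspaces:
  assumes U: "finite_span U" and V: "finite_span V" and f: "norm f = 1"
    and eps: "\<And>g. norm (orth_proj U g - orth_proj V g) \<le> e * norm g" and e: "0 \<le> e" "e \<le> 1"
  shows "arcsin (norm (f - orth_proj V f)) \<le> arcsin (norm (f - orth_proj U f)) + arcsin e"
proof -
  interpret U: finite_span U by fact
  interpret V: finite_span V by fact
  define a where "a = norm (f - U.P f)"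
  define b where "b = norm (f - V.P f)"
  have a: "0 \<le> a" "a \<le> 1" and b: "0 \<le> b" "b \<le> 1"
    using U.norm_orth_proj_residual_le[of f] V.norm_orth_proj_residual_le[of f] f by (auto simp: a_def b_def)
  show ?thesis
  proof (cases "U.P f = 0")
    case True
    then have "a = 1" by (simp add: a_def f)
    moreover have "arcsin b \<le> pi / 2" using arcsin_bounded[of b] b by simp
    moreover have "arcsin e \<ge> 0" using e by (simp add: arcsin_nonneg)
    ultimately show ?thesis by (simp add: a_def b_def)
  next
    case False
    define ca where "ca = norm (U.P f)"
    have ca: "ca > 0" "ca\<^sup>2 + a\<^sup>2 = 1"
      using False U.norm_orth_proj_sq[of f] f by (auto simp: ca_def a_def)
    define cb where "cb = norm (V.P f)"
    have cb: "cb \<ge> 0" "cb\<^sup>2 + b\<^sup>2 = 1"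
      using V.norm_orth_proj_sq[of f] f by (auto simp: cb_def b_def)
    define p where "p = (1 / ca) *\<^sub>R U.P f"
    have pf: "U.P f = ca *\<^sub>R p" using ca by (simp add: p_def)
    have np: "norm p = 1" using ca by (simp add: p_def ca_def)
    have Up: "U.P p = p"
      using U.orth_proj_id[OF U.orth_proj_in[of f]] by (simp add: p_def linear_simps[OF U.bounded_linear_orth_proj])
    define \<eta> where "\<eta> = norm (p - V.P p)"
    have eta: "0 \<le> \<eta>" "\<eta> \<le> e"
      using eps[of p] np Up by (auto simp: \<eta>_def)
    define k where "k = norm (V.P p)"
    have k: "k \<ge> 0" "k\<^sup>2 + \<eta>\<^sup>2 = 1"
      using V.norm_orth_proj_sq[of p] np by (auto simp: k_def \<eta>_def)
    have res: "inner (f - U.P f) p = 0"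
      using U.orth_proj_orthogonal[OF U.orth_proj_in[of p], of f] Up by (simp add: Re_cinner[symmetric])
    \<comment> \<open>Here \<open>ca\<close>, k and \<open>cb\<close> are the cosines belonging to
      the sines a, \<eta> and b, so by the addition formula this says cos (arcsin a + arcsin \<eta>)
      <= cos (arcsin b).\<close>
    have key: "ca * k - a * \<eta> \<le> cb"
    proof (cases "k = 0")
      case True
      moreover have "0 \<le> a * \<eta>" using a eta by simp
      ultimately show ?thesis using cb by simp
    next
      case False
      then have k0: "k > 0" using k by simp
      have Vp: "inner p (V.P p) = k\<^sup>2"
        using V.inner_orth_proj_right[of p p] by (simp add: k_def power2_norm_eq_inner)
      \<comment> \<open>k^2 p is the component of \<open>V.P p\<close> along p. Since the residual
        \<open>f - U.P f\<close> is orthogonal to p, it pairs only with the remainder, whose length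
        is k \<eta>; this gives a sharper bound than Cauchy-Schwarz with \<open>V.P p\<close>
        itself.\<close>
      have "norm (V.P p - k\<^sup>2 *\<^sub>R p) ^ 2 = (k * \<eta>)\<^sup>2"
      proof -
        have "norm (V.P p - k\<^sup>2 *\<^sub>R p) ^ 2 = (norm (V.P p))\<^sup>2 - 2 * k\<^sup>2 * inner p (V.P p) + k\<^sup>2 * k\<^sup>2 * (norm p)\<^sup>2"
          unfolding power2_norm_eq_inner by (simp add: inner_diff_left inner_diff_right inner_commute algebra_simps)
        also have "\<dots> = k\<^sup>2 * (1 - k\<^sup>2)"
          by (simp add: Vp np k_def[symmetric] algebra_simps)
        also have "1 - k\<^sup>2 = \<eta>\<^sup>2" using k by simp
        finally show ?thesis by (simp add: power_mult_distrib)
      qed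
      then have nrm: "norm (V.P p - k\<^sup>2 *\<^sub>R p) = k * \<eta>"
        using k eta by (simp add: power2_eq_iff_nonneg)
      have "inner (f - U.P f) (V.P p) = inner (f - U.P f) (V.P p - k\<^sup>2 *\<^sub>R p)"
        using res by (simp add: inner_diff_right)
      also have "\<dots> \<ge> - (a * (k * \<eta>))"
        using Cauchy_Schwarz_ineq2[of "f - U.P f" "V.P p - k\<^sup>2 *\<^sub>R p"] unfolding nrm a_def by linarith
      finally have "inner f (V.P p) \<ge> ca * k\<^sup>2 - a * (k * \<eta>)"
        using Vp by (simp add: inner_diff_left pf)
      moreover have "inner f (V.P p) = inner (V.P f) (V.P p)"
        by (simp add: V.inner_orth_proj_right)
      moreover have "inner (V.P f) (V.P p) \<le> cb * k"
        unfolding cb_def k_def by (rule norm_cauchy_schwarz)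
      ultimately have "(ca * k - a * \<eta>) * k \<le> cb * k"
        by (simp add: algebra_simps power2_eq_square)
      then show ?thesis using k0 by simp
    qed
    have eta1: "\<eta> \<le> 1" using eta e by simp
    have cosa: "cos (arcsin a) = ca" and coseta: "cos (arcsin \<eta>) = k" and cosb: "cos (arcsin b) = cb"
      using a b ca cb k eta eta1
      by (auto simp: cos_arcsin intro!: real_sqrt_unique)
    have "cos (arcsin a + arcsin \<eta>) \<le> cos (arcsin b)"
      using key a eta eta1 by (simp add: cos_add cosa cosb coseta)
    moreover have "0 \<le> arcsin b" "arcsin b \<le> pi" "0 \<le> arcsin a + arcsin \<eta>" "arcsin a + arcsin \<eta> \<le> pi"
      using arcsin_bounded[of b] arcsin_bounded[of a] arcsin_bounded[of \<eta>] a b eta eta1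
        arcsin_nonneg[of a] arcsin_nonneg[of b] arcsin_nonneg[of \<eta>] pi_gt_zero by auto
    ultimately have "arcsin b \<le> arcsin a + arcsin \<eta>"
      by (simp add: cos_mono_le_eq)
    also have "arcsin \<eta> \<le> arcsin e"
      using eta e eta1 by (intro arcsin_le_arcsin) auto
    finally show ?thesis by (simp add: a_def b_def)
  qed
qed

section \<open>Plane waves and their derivatives\<close>

text \<open>A total map into the quotient, with value 0 where the function has no class. The lemmas
  below apply it to continuous functions, which are square integrable on the sphere.\<close>

lift_definition to_L2 :: "(real^3 \<Rightarrow> complex) \<Rightarrow> L2_sphere" is
  "\<lambda>f. if sq_integrable f then f else (\<lambda>\<omega>. 0)"
  by (simp add: sq_integrable_0)

lemma integrable_sphere_continuous:
  fixes f :: "real^3 \<Rightarrow> 'a::{banach, second_countable_topology}"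
  assumes "continuous_on UNIV f"
  shows "integrable sphere_measure f"
proof -
  have "compact (f ` sphere 0 1)"
    by (intro compact_continuous_image continuous_on_subset[OF assms]) auto
  then obtain C where C: "\<And>x. x \<in> f ` sphere 0 1 \<Longrightarrow> norm x \<le> C"
    using compact_imp_bounded bounded_iff by metis
  show ?thesis
  proof (rule sphere_measure.integrable_const_bound)
    show "AE x in sphere_measure. norm (f x) \<le> C"
      by (rule AE_I2) (use C in auto)
    show "f \<in> borel_measurable sphere_measure"
      by (intro measurable_sphere_measure borel_measurable_continuous_onI assms)
  qed
qed

lemma sq_integrable_continuous:
  assumes "continuous_on UNIV f"
  shows "sq_integrable f"
  unfolding sq_integrable_def
proof
  show "f \<in> borel_measurable sphere_measure"
    by (intro measurable_sphere_measure borel_measurable_continuous_onI assms)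
  show "integrable sphere_measure (\<lambda>\<omega>. (cmod (f \<omega>))\<^sup>2)"
    by (intro integrable_sphere_continuous continuous_intros assms)
qed

lemma to_L2_add:
  assumes "continuous_on UNIV f" "continuous_on UNIV g"
  shows "to_L2 (\<lambda>\<omega>. f \<omega> + g \<omega>) = to_L2 f + to_L2 g"
proof -
  have "sq_integrable f" "sq_integrable g" "sq_integrable (\<lambda>\<omega>. f \<omega> + g \<omega>)"
    using assms by (auto intro!: sq_integrable_continuous continuous_intros)
  then show ?thesis by transfer simp
qed

lemma to_L2_scaleC:
  assumes "continuous_on UNIV f"
  shows "to_L2 (\<lambda>\<omega>. c * f \<omega>) = scaleC c (to_L2 f)"
proof -
  have "sq_integrable f" "sq_integrable (\<lambda>\<omega>. c * f \<omega>)"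
    using assms by (auto intro!: sq_integrable_continuous continuous_intros)
  then show ?thesis by transfer simp
qed

lemma to_L2_diff:
  assumes "continuous_on UNIV f" "continuous_on UNIV g"
  shows "to_L2 (\<lambda>\<omega>. f \<omega> - g \<omega>) = to_L2 f - to_L2 g"
proof -
  have "to_L2 (\<lambda>\<omega>. (f \<omega> - g \<omega>) + g \<omega>) = to_L2 (\<lambda>\<omega>. f \<omega> - g \<omega>) + to_L2 g"
    by (intro to_L2_add continuous_intros assms)
  then show ?thesis by simp
qed

lemma cinner_to_L2:
  assumes "continuous_on UNIV f" "continuous_on UNIV g"
  shows "cinner (to_L2 f) (to_L2 g) = (\<integral>\<omega>. f \<omega> * cnj (g \<omega>) \<partial>sphere_measure)"
proof -
  have "sq_integrable f" "sq_integrable g"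
    using assms by (auto intro!: sq_integrable_continuous)
  then show ?thesis by transfer simp
qed

lemma norm_to_L2_sq:
  assumes "continuous_on UNIV f"
  shows "(norm (to_L2 f))\<^sup>2 = (\<integral>\<omega>. (cmod (f \<omega>))\<^sup>2 \<partial>sphere_measure)"
proof -
  have "cinner (to_L2 f) (to_L2 f) = (\<integral>\<omega>. complex_of_real ((cmod (f \<omega>))\<^sup>2) \<partial>sphere_measure)"
    by (simp add: cinner_to_L2[OF assms assms] complex_norm_square[symmetric])
  also have "\<dots> = complex_of_real (\<integral>\<omega>. (cmod (f \<omega>))\<^sup>2 \<partial>sphere_measure)"
    by (rule integral_complex_of_real)
  finally show ?thesis
    by (simp add: power2_norm_eq_inner inner_L2_sphere_def)
qed

lemma measure_sphere_measure [simp]: "measure sphere_measure (sphere 0 1) = 1"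
  using prob_sphere_measure by (simp add: measure_def)

lemma norm_to_L2_le:
  assumes "continuous_on UNIV f" and C: "\<And>\<omega>. norm \<omega> = 1 \<Longrightarrow> cmod (f \<omega>) \<le> C"
  shows "norm (to_L2 f) \<le> C"
proof (rule power2_le_imp_le)
  have "norm (axis 1 1 :: real^3) = 1" by simp
  from C[OF this] show "0 \<le> C" by (meson norm_ge_zero order_trans)
  have "(norm (to_L2 f))\<^sup>2 = (\<integral>\<omega>. (cmod (f \<omega>))\<^sup>2 \<partial>sphere_measure)"
    by (rule norm_to_L2_sq[OF assms(1)])
  also have "\<dots> \<le> (\<integral>\<omega>. C\<^sup>2 \<partial>sphere_measure)"
    by (rule integral_mono) (auto intro!: integrable_sphere_continuous continuous_intros assms(1) power_mono C)
  also have "\<dots> = C\<^sup>2" by simp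
  finally show "(norm (to_L2 f))\<^sup>2 \<le> C\<^sup>2" .
qed

text \<open>A plane wave with an amplitude p. Differentiation only changes the amplitude, so one
  derivative lemma serves the plane wave and all its derivatives.\<close>

definition wave :: "real \<Rightarrow> (real^3 \<Rightarrow> complex) \<Rightarrow> real^3 \<Rightarrow> L2_sphere" where
  "wave \<kappa> p z = to_L2 (\<lambda>\<omega>. p \<omega> * exp (\<i> * complex_of_real (\<kappa> * (\<omega> \<bullet> z))))"

lemma continuous_on_wave [continuous_intros]:
  "continuous_on UNIV p \<Longrightarrow> continuous_on UNIV (\<lambda>\<omega>::real^3. p \<omega> * exp (\<i> * complex_of_real (\<kappa> * (\<omega> \<bullet> z))))"
  by (intro continuous_intros)

lemma plane_wave_eq_wave: "plane_wave \<kappa> = wave \<kappa> (\<lambda>\<omega>. 1)"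
proof
  fix z
  have "sq_integrable (\<lambda>\<omega>::real^3. exp (\<i> * complex_of_real (\<kappa> * (\<omega> \<bullet> z))))"
    by (intro sq_integrable_continuous continuous_intros)
  then show "plane_wave \<kappa> z = wave \<kappa> (\<lambda>\<omega>. 1) z"
    unfolding wave_def by transfer simp
qed

text \<open>The factor that differentiation of the exponential in direction v brings down.\<close>

definition dir :: "real \<Rightarrow> real^3 \<Rightarrow> real^3 \<Rightarrow> complex" where
  "dir \<kappa> v \<omega> = \<i> * complex_of_real (\<kappa> * (\<omega> \<bullet> v))"

lemma continuous_on_dir [continuous_intros]: "continuous_on S (dir \<kappa> v)"
  unfolding dir_def by (intro continuous_intros)

lemma cmod_dir: "cmod (dir \<kappa> v \<omega>) = \<bar>\<kappa> * (\<omega> \<bullet> v)\<bar>"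
  by (simp add: dir_def norm_mult abs_mult)

lemma one_minus_cos_le: "1 - cos x \<le> x\<^sup>2 / 2" for x :: real
proof -
  have "1 - cos x = 2 * (sin (x / 2))\<^sup>2"
    using cos_double_sin[of "x / 2"] by simp
  moreover have "(sin (x / 2))\<^sup>2 \<le> (x / 2)\<^sup>2"
    using abs_sin_x_le_abs_x[of "x / 2"] by (simp only: abs_le_square_iff)
  ultimately show ?thesis by (simp add: power_divide)
qed

text \<open>Real and imaginary parts contribute at most x^2/2 each. Only the quadratic order matters
  for differentiability of waves.\<close>

lemma cmod_exp_remainder: "cmod (exp (\<i> * complex_of_real x) - 1 - \<i> * complex_of_real x) \<le> x\<^sup>2"
proof -
  have "exp (\<i> * complex_of_real x) - 1 - \<i> * complex_of_real x = Complex (cos x - 1) (sin x - x)"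
    by (simp add: complex_eq_iff Re_exp Im_exp)
  also have "cmod \<dots> \<le> \<bar>cos x - 1\<bar> + \<bar>sin x - x\<bar>"
    using cmod_le[of "Complex (cos x - 1) (sin x - x)"] by simp
  also have "\<bar>sin x - x\<bar> \<le> x\<^sup>2 / 2"
    using Maclaurin_sin_bound[of x 2] by (simp add: numeral_2_eq_2 sin_coeff_def)
  also have "\<bar>cos x - 1\<bar> \<le> x\<^sup>2 / 2"
    using one_minus_cos_le[of x] cos_le_one[of x] by linarith
  finally show ?thesis by simp
qed

lemma bounded_linear_wave_dir:
  assumes p: "continuous_on UNIV p"
  shows "bounded_linear (\<lambda>h. wave \<kappa> (\<lambda>\<omega>. p \<omega> * dir \<kappa> h \<omega>) z)"
proof -
  let ?E = "\<lambda>\<omega>. exp (\<i> * complex_of_real (\<kappa> * (\<omega> \<bullet> z)))"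
  have "linear (\<lambda>h. wave \<kappa> (\<lambda>\<omega>. p \<omega> * dir \<kappa> h \<omega>) z)"
  proof (rule linearI)
    fix x y
    have "wave \<kappa> (\<lambda>\<omega>. p \<omega> * dir \<kappa> (x + y) \<omega>) z = to_L2 (\<lambda>\<omega>. p \<omega> * dir \<kappa> x \<omega> * ?E \<omega> + p \<omega> * dir \<kappa> y \<omega> * ?E \<omega>)"
      by (simp add: wave_def dir_def inner_add_right algebra_simps)
    also have "\<dots> = wave \<kappa> (\<lambda>\<omega>. p \<omega> * dir \<kappa> x \<omega>) z + wave \<kappa> (\<lambda>\<omega>. p \<omega> * dir \<kappa> y \<omega>) z"
      unfolding wave_def by (intro to_L2_add continuous_intros p)
    finally show "wave \<kappa> (\<lambda>\<omega>. p \<omega> * dir \<kappa> (x + y) \<omega>) z =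
       wave \<kappa> (\<lambda>\<omega>. p \<omega> * dir \<kappa> x \<omega>) z + wave \<kappa> (\<lambda>\<omega>. p \<omega> * dir \<kappa> y \<omega>) z" .
  next
    fix r x
    have "wave \<kappa> (\<lambda>\<omega>. p \<omega> * dir \<kappa> (r *\<^sub>R x) \<omega>) z = to_L2 (\<lambda>\<omega>. complex_of_real r * (p \<omega> * dir \<kappa> x \<omega> * ?E \<omega>))"
      by (simp add: wave_def dir_def algebra_simps)
    also have "\<dots> = r *\<^sub>R wave \<kappa> (\<lambda>\<omega>. p \<omega> * dir \<kappa> x \<omega>) z"
      unfolding wave_def scaleR_conv_scaleC by (intro to_L2_scaleC continuous_intros p)
    finally show "wave \<kappa> (\<lambda>\<omega>. p \<omega> * dir \<kappa> (r *\<^sub>R x) \<omega>) z = r *\<^sub>R wave \<kappa> (\<lambda>\<omega>. p \<omega> * dir \<kappa> x \<omega>) z" .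
  qed
  then show ?thesis by (simp add: linear_conv_bounded_linear)
qed

text \<open>The pointwise Taylor remainder is at most C \<kappa>^2 |y - z|^2 uniformly on the
  sphere, with C a bound for the amplitude. The sphere has total mass 1, so the same bound holds in
  the L2 norm, and the derivative is taken in L2 rather than pointwise.\<close>

lemma has_derivative_wave:
  assumes p: "continuous_on UNIV p"
  shows "(wave \<kappa> p has_derivative (\<lambda>h. wave \<kappa> (\<lambda>\<omega>. p \<omega> * dir \<kappa> h \<omega>) z)) (at z within S)"
proof -
  let ?E = "\<lambda>z \<omega>. exp (\<i> * complex_of_real (\<kappa> * (\<omega> \<bullet> z)))"
  have "compact (p ` sphere 0 1)"
    by (intro compact_continuous_image continuous_on_subset[OF p]) auto
  then obtain C where C: "\<And>\<omega>. norm \<omega> = 1 \<Longrightarrow> cmod (p \<omega>) \<le> C"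
    using compact_imp_bounded bounded_iff by (metis image_eqI mem_sphere_0)
  have est: "norm (wave \<kappa> p y - wave \<kappa> p z - wave \<kappa> (\<lambda>\<omega>. p \<omega> * dir \<kappa> (y - z) \<omega>) z) \<le> C * (\<kappa>\<^sup>2 * (norm (y - z))\<^sup>2)" for y
  proof -
    let ?r = "\<lambda>\<omega>. p \<omega> * ?E y \<omega> - p \<omega> * ?E z \<omega> - p \<omega> * dir \<kappa> (y - z) \<omega> * ?E z \<omega>"
    have r: "?r \<omega> = p \<omega> * ?E z \<omega> * (exp (\<i> * complex_of_real (\<kappa> * (\<omega> \<bullet> (y - z)))) - 1 - \<i> * complex_of_real (\<kappa> * (\<omega> \<bullet> (y - z))))" for \<omega>
    proof -
      have "?E y \<omega> = ?E z \<omega> * exp (\<i> * complex_of_real (\<kappa> * (\<omega> \<bullet> (y - z))))"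
        by (simp add: exp_add[symmetric] inner_diff_right algebra_simps)
      then show ?thesis by (simp add: dir_def algebra_simps)
    qed
    have "wave \<kappa> p y - wave \<kappa> p z - wave \<kappa> (\<lambda>\<omega>. p \<omega> * dir \<kappa> (y - z) \<omega>) z = to_L2 ?r"
      unfolding wave_def
      by (subst to_L2_diff, intro continuous_intros p, intro continuous_intros p,
          subst to_L2_diff, intro continuous_intros p, intro continuous_intros p) (rule refl)
    also have "norm \<dots> \<le> C * (\<kappa>\<^sup>2 * (norm (y - z))\<^sup>2)"
    proof (rule norm_to_L2_le)
      show "continuous_on UNIV ?r" by (intro continuous_intros p)
      fix \<omega> :: "real^3" assume w: "norm \<omega> = 1"
      have "cmod (?r \<omega>) = cmod (p \<omega>) * cmod (exp (\<i> * complex_of_real (\<kappa> * (\<omega> \<bullet> (y - z)))) - 1 - \<i> * complex_of_real (\<kappa> * (\<omega> \<bullet> (y - z))))"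
        unfolding r by (simp add: norm_mult norm_exp_i_times)
      also have "\<dots> \<le> C * (\<kappa> * (\<omega> \<bullet> (y - z)))\<^sup>2"
        by (intro mult_mono C[OF w] cmod_exp_remainder norm_ge_zero order_trans[OF norm_ge_zero C[OF w]])
      also have "(\<kappa> * (\<omega> \<bullet> (y - z)))\<^sup>2 \<le> \<kappa>\<^sup>2 * (norm (y - z))\<^sup>2"
      proof -
        have "\<bar>\<omega> \<bullet> (y - z)\<bar> \<le> norm (y - z)"
          using Cauchy_Schwarz_ineq2[of \<omega> "y - z"] w by simp
        then have "(\<omega> \<bullet> (y - z))\<^sup>2 \<le> (norm (y - z))\<^sup>2"
          by (metis abs_norm_cancel abs_le_square_iff)
        then show ?thesis by (simp add: power_mult_distrib mult_left_mono)
      qed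
      finally show "cmod (?r \<omega>) \<le> C * (\<kappa>\<^sup>2 * (norm (y - z))\<^sup>2)"
        using C[OF w] by (auto intro: order_trans[OF norm_ge_zero] mult_left_mono)
    qed
    finally show ?thesis .
  qed
  show ?thesis
  proof (rule has_derivativeI_sandwich[where e = 1 and H = "\<lambda>y. C * \<kappa>\<^sup>2 * norm (y - z)"])
    show "bounded_linear (\<lambda>h. wave \<kappa> (\<lambda>\<omega>. p \<omega> * dir \<kappa> h \<omega>) z)"
      by (rule bounded_linear_wave_dir[OF p])
    show "norm (wave \<kappa> p y - wave \<kappa> p z - wave \<kappa> (\<lambda>\<omega>. p \<omega> * dir \<kappa> (y - z) \<omega>) z) / norm (y - z) \<le> C * \<kappa>\<^sup>2 * norm (y - z)"
      if "y \<noteq> z" for y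
      using est[of y] that by (simp add: divide_le_eq power2_eq_square mult.assoc)
    have "((\<lambda>y. C * \<kappa>\<^sup>2 * norm (y - z)) \<longlongrightarrow> C * \<kappa>\<^sup>2 * norm (z - z)) (at z within S)"
      by (intro tendsto_intros)
    then show "((\<lambda>y. C * \<kappa>\<^sup>2 * norm (y - z)) \<longlongrightarrow> 0) (at z within S)"
      by simp
  qed simp
qed

lemma cinner_wave:
  assumes "continuous_on UNIV p" "continuous_on UNIV r"
  shows "cinner (wave \<kappa> p z) (wave \<kappa> r y) =
    (\<integral>\<omega>. p \<omega> * cnj (r \<omega>) * exp (\<i> * complex_of_real (\<omega> \<bullet> (\<kappa> *\<^sub>R (z - y)))) \<partial>sphere_measure)"
proof -
  have e: "exp (\<i> * complex_of_real (\<kappa> * (\<omega> \<bullet> z))) * cnj (exp (\<i> * complex_of_real (\<kappa> * (\<omega> \<bullet> y)))) =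
     exp (\<i> * complex_of_real (\<omega> \<bullet> (\<kappa> *\<^sub>R (z - y))))" for \<omega> :: "real^3"
  proof -
    have "cnj (exp (\<i> * complex_of_real (\<kappa> * (\<omega> \<bullet> y)))) = exp (- (\<i> * complex_of_real (\<kappa> * (\<omega> \<bullet> y))))"
      by (simp add: exp_cnj)
    then show ?thesis
      by (simp add: exp_add[symmetric] inner_diff_right algebra_simps)
  qed
  have eq: "p \<omega> * exp (\<i> * complex_of_real (\<kappa> * (\<omega> \<bullet> z))) * cnj (r \<omega> * exp (\<i> * complex_of_real (\<kappa> * (\<omega> \<bullet> y)))) =
      p \<omega> * cnj (r \<omega>) * exp (\<i> * complex_of_real (\<omega> \<bullet> (\<kappa> *\<^sub>R (z - y))))" for \<omega>
    unfolding e[symmetric] complex_cnj_mult by (simp only: mult_ac)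
  show ?thesis
    unfolding wave_def cinner_to_L2[OF continuous_on_wave[OF assms(1)] continuous_on_wave[OF assms(2)]] eq ..
qed

text \<open>Makes the inner products of the waves with plane waves real: their imaginary parts are
  odd in the point of the sphere and vanish by antipodal symmetry.\<close>

lemma integral_sphere_Complex:
  fixes f g :: "real^3 \<Rightarrow> real"
  assumes "continuous_on UNIV f" "continuous_on UNIV g" and odd: "\<And>\<omega>. g (- \<omega>) = - g \<omega>"
  shows "(\<integral>\<omega>. Complex (f \<omega>) (g \<omega>) \<partial>sphere_measure) = complex_of_real (\<integral>\<omega>. f \<omega> \<partial>sphere_measure)"
proof -
  have c: "continuous_on UNIV (\<lambda>\<omega>. Complex (f \<omega>) (g \<omega>))"
    unfolding Complex_eq by (intro continuous_intros assms)
  have i: "integrable sphere_measure (\<lambda>\<omega>. Complex (f \<omega>) (g \<omega>))"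
    by (rule integrable_sphere_continuous[OF c])
  have "Im (\<integral>\<omega>. Complex (f \<omega>) (g \<omega>) \<partial>sphere_measure) = (\<integral>\<omega>. g \<omega> \<partial>sphere_measure)"
    using integral_Im[OF i] by simp
  also have "\<dots> = 0"
    by (rule integral_sphere_odd[OF borel_measurable_continuous_onI[OF assms(2)] odd])
  finally have "Im (\<integral>\<omega>. Complex (f \<omega>) (g \<omega>) \<partial>sphere_measure) = 0" .
  moreover have "Re (\<integral>\<omega>. Complex (f \<omega>) (g \<omega>) \<partial>sphere_measure) = (\<integral>\<omega>. f \<omega> \<partial>sphere_measure)"
    using integral_Re[OF i] by simp
  ultimately show ?thesis by (simp add: complex_eq_iff)
qed

text \<open>By the lemmas \<open>cinner_plane_wave\<close>, \<open>cinner_dwave\<close> and \<open>cinner_ddwave\<close> below, these are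
  \<open>sinc |w|\<close> and its first two derivatives along \<open>v\<close>.\<close>

definition kern0 :: "real^3 \<Rightarrow> real" where
  "kern0 w = (\<integral>\<omega>. cos (\<omega> \<bullet> w) \<partial>sphere_measure)"

definition kern1 :: "real^3 \<Rightarrow> real^3 \<Rightarrow> real" where
  "kern1 v w = (\<integral>\<omega>. - ((\<omega> \<bullet> v) * sin (\<omega> \<bullet> w)) \<partial>sphere_measure)"

definition kern2 :: "real^3 \<Rightarrow> real^3 \<Rightarrow> real" where
  "kern2 v w = (\<integral>\<omega>. - ((\<omega> \<bullet> v)\<^sup>2 * cos (\<omega> \<bullet> w)) \<partial>sphere_measure)"

abbreviation "dwave \<kappa> v \<equiv> wave \<kappa> (dir \<kappa> v)"
abbreviation "ddwave \<kappa> v w \<equiv> wave \<kappa> (\<lambda>\<omega>. dir \<kappa> v \<omega> * dir \<kappa> w \<omega>)"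

lemma exp_i_real: "exp (\<i> * complex_of_real x) = Complex (cos x) (sin x)"
  by (simp add: complex_eq_iff Re_exp Im_exp)

lemma cinner_plane_wave: "cinner (plane_wave \<kappa> z) (plane_wave \<kappa> y) = complex_of_real (kern0 (\<kappa> *\<^sub>R (z - y)))"
proof -
  let ?w = "\<kappa> *\<^sub>R (z - y)"
  have "cinner (plane_wave \<kappa> z) (plane_wave \<kappa> y) = (\<integral>\<omega>. Complex (cos (\<omega> \<bullet> ?w)) (sin (\<omega> \<bullet> ?w)) \<partial>sphere_measure)"
    unfolding plane_wave_eq_wave
    by (simp only: cinner_wave continuous_on_const complex_cnj_one mult_1_right mult_1_left exp_i_real)
  also have "\<dots> = complex_of_real (\<integral>\<omega>. cos (\<omega> \<bullet> ?w) \<partial>sphere_measure)"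
    by (rule integral_sphere_Complex) (auto intro!: continuous_intros)
  finally show ?thesis by (simp only: kern0_def)
qed

lemma cinner_dwave: "cinner (dwave \<kappa> v z) (plane_wave \<kappa> y) = complex_of_real (\<kappa> * kern1 v (\<kappa> *\<^sub>R (z - y)))"
proof -
  let ?w = "\<kappa> *\<^sub>R (z - y)"
  have "dir \<kappa> v \<omega> * exp (\<i> * complex_of_real (\<omega> \<bullet> ?w)) =
     Complex (\<kappa> * - ((\<omega> \<bullet> v) * sin (\<omega> \<bullet> ?w))) (\<kappa> * ((\<omega> \<bullet> v) * cos (\<omega> \<bullet> ?w)))" for \<omega>
    unfolding exp_i_real dir_def by (simp add: complex_eq_iff)
  then have "cinner (dwave \<kappa> v z) (plane_wave \<kappa> y) =
      (\<integral>\<omega>. Complex (\<kappa> * - ((\<omega> \<bullet> v) * sin (\<omega> \<bullet> ?w))) (\<kappa> * ((\<omega> \<bullet> v) * cos (\<omega> \<bullet> ?w))) \<partial>sphere_measure)"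
    unfolding plane_wave_eq_wave by (simp only: cinner_wave continuous_on_dir continuous_on_const complex_cnj_one mult_1_right)
  also have "\<dots> = complex_of_real (\<integral>\<omega>. \<kappa> * - ((\<omega> \<bullet> v) * sin (\<omega> \<bullet> ?w)) \<partial>sphere_measure)"
    by (rule integral_sphere_Complex) (auto intro!: continuous_intros)
  also have "\<dots> = complex_of_real (\<kappa> * kern1 v ?w)"
    unfolding kern1_def by (subst integral_mult_right_zero) simp
  finally show ?thesis .
qed

lemma cinner_ddwave: "cinner (ddwave \<kappa> v v z) (plane_wave \<kappa> y) = complex_of_real (\<kappa>\<^sup>2 * kern2 v (\<kappa> *\<^sub>R (z - y)))"
proof -
  let ?w = "\<kappa> *\<^sub>R (z - y)"
  have "dir \<kappa> v \<omega> * dir \<kappa> v \<omega> * exp (\<i> * complex_of_real (\<omega> \<bullet> ?w)) =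
     Complex (\<kappa>\<^sup>2 * - ((\<omega> \<bullet> v)\<^sup>2 * cos (\<omega> \<bullet> ?w))) (- (\<kappa>\<^sup>2 * ((\<omega> \<bullet> v)\<^sup>2 * sin (\<omega> \<bullet> ?w))))" for \<omega>
    unfolding exp_i_real dir_def by (simp add: complex_eq_iff power2_eq_square)
  then have "cinner (ddwave \<kappa> v v z) (plane_wave \<kappa> y) =
      (\<integral>\<omega>. Complex (\<kappa>\<^sup>2 * - ((\<omega> \<bullet> v)\<^sup>2 * cos (\<omega> \<bullet> ?w))) (- (\<kappa>\<^sup>2 * ((\<omega> \<bullet> v)\<^sup>2 * sin (\<omega> \<bullet> ?w)))) \<partial>sphere_measure)"
    unfolding plane_wave_eq_wave by (simp only: cinner_wave continuous_on_dir continuous_on_mult continuous_on_const complex_cnj_one mult_1_right)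
  also have "\<dots> = complex_of_real (\<integral>\<omega>. \<kappa>\<^sup>2 * - ((\<omega> \<bullet> v)\<^sup>2 * cos (\<omega> \<bullet> ?w)) \<partial>sphere_measure)"
    by (rule integral_sphere_Complex) (auto intro!: continuous_intros)
  also have "\<dots> = complex_of_real (\<kappa>\<^sup>2 * kern2 v ?w)"
    unfolding kern2_def by (subst integral_mult_right_zero) simp
  finally show ?thesis .
qed

lemma norm_wave_sq:
  assumes "continuous_on UNIV p"
  shows "(norm (wave \<kappa> p z))\<^sup>2 = (\<integral>\<omega>. (cmod (p \<omega>))\<^sup>2 \<partial>sphere_measure)"
  unfolding wave_def by (subst norm_to_L2_sq) (auto intro!: continuous_intros assms simp: norm_mult norm_exp_i_times)

lemma norm_plane_wave [simp]: "norm (plane_wave \<kappa> z) = 1"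
proof -
  have "(norm (plane_wave \<kappa> z))\<^sup>2 = 1\<^sup>2"
    unfolding plane_wave_eq_wave by (subst norm_wave_sq) auto
  then show ?thesis by (rule power2_eq_imp_eq) auto
qed

lemma norm_dwave_sq: "(norm (dwave \<kappa> v z))\<^sup>2 = \<kappa>\<^sup>2 * (norm v)\<^sup>2 / 3"
  using integral_sphere_power'[of 2 v]
  by (simp add: norm_wave_sq continuous_on_dir cmod_dir power_mult_distrib)

lemma norm_ddwave_sq: "(norm (ddwave \<kappa> v v z))\<^sup>2 = \<kappa> ^ 4 * norm v ^ 4 / 5"
proof -
  have "(\<bar>a\<bar> * \<bar>a\<bar>)\<^sup>2 = a ^ 4" for a :: real
    by (simp add: eval_nat_numeral)
  then have "(cmod (dir \<kappa> v \<omega> * dir \<kappa> v \<omega>))\<^sup>2 = \<kappa> ^ 4 * (\<omega> \<bullet> v) ^ 4" for \<omega>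
    by (simp only: norm_mult cmod_dir power_mult_distrib[symmetric])
  then have "(norm (ddwave \<kappa> v v z))\<^sup>2 = (\<integral>\<omega>. \<kappa> ^ 4 * (\<omega> \<bullet> v) ^ 4 \<partial>sphere_measure)"
    by (subst norm_wave_sq) (auto intro!: continuous_intros)
  then show ?thesis using integral_sphere_power'[of 4 v] by simp
qed

lemma norm_dwave: "norm (dwave \<kappa> v z) = \<bar>\<kappa>\<bar> * norm v / sqrt 3"
  by (rule power2_eq_imp_eq) (auto simp: norm_dwave_sq power_mult_distrib power_divide)

lemma norm_ddwave: "norm (ddwave \<kappa> v v z) = \<kappa>\<^sup>2 * (norm v)\<^sup>2 / sqrt 5"
  by (rule power2_eq_imp_eq) (auto simp: norm_ddwave_sq power_mult_distrib power_divide simp flip: power_mult)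

lemma integrable_sphere_inner_power [simp]: "integrable sphere_measure (\<lambda>\<omega>. (\<omega> \<bullet> v) ^ k)"
  by (intro integrable_sphere_continuous continuous_intros)

lemma inner_ddwave_plane_wave: "inner (ddwave \<kappa> v v z) (plane_wave \<kappa> z) = - (\<kappa>\<^sup>2 * (norm v)\<^sup>2 / 3)"
  using cinner_ddwave[of \<kappa> v z z] integral_sphere_power'[of 2 v]
  by (simp add: Re_cinner[symmetric] kern2_def)

text \<open>Cauchy-Schwarz in the form 2ab <= a^2 + b^2. Normalizing v and w first makes the two
  second moments equal, so nothing is lost.\<close>

lemma integral_sphere_abs_inner_le:
  "(\<integral>\<omega>. \<bar>\<omega> \<bullet> v\<bar> * \<bar>\<omega> \<bullet> w\<bar> \<partial>sphere_measure) \<le> norm v * norm w / 3"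
proof (cases "v = 0 \<or> w = 0")
  case False
  define v' w' where "v' = sgn v" and "w' = sgn w"
  have v: "v = norm v *\<^sub>R v'" and w: "w = norm w *\<^sub>R w'" and n: "norm v' = 1" "norm w' = 1"
    using False by (auto simp: v'_def w'_def sgn_div_norm)
  have "(\<integral>\<omega>. \<bar>\<omega> \<bullet> v\<bar> * \<bar>\<omega> \<bullet> w\<bar> \<partial>sphere_measure) = norm v * norm w * (\<integral>\<omega>. \<bar>\<omega> \<bullet> v'\<bar> * \<bar>\<omega> \<bullet> w'\<bar> \<partial>sphere_measure)"
    by (subst v, subst w) (simp add: abs_mult mult_ac)
  also have "(\<integral>\<omega>. \<bar>\<omega> \<bullet> v'\<bar> * \<bar>\<omega> \<bullet> w'\<bar> \<partial>sphere_measure) \<le> (\<integral>\<omega>. (\<omega> \<bullet> v')\<^sup>2 / 2 + (\<omega> \<bullet> w')\<^sup>2 / 2 \<partial>sphere_measure)"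
  proof (rule integral_mono)
    show "\<bar>\<omega> \<bullet> v'\<bar> * \<bar>\<omega> \<bullet> w'\<bar> \<le> (\<omega> \<bullet> v')\<^sup>2 / 2 + (\<omega> \<bullet> w')\<^sup>2 / 2" for \<omega>
      using sum_squares_bound[of "\<bar>\<omega> \<bullet> v'\<bar>" "\<bar>\<omega> \<bullet> w'\<bar>"] by simp
  qed (auto intro!: integrable_sphere_continuous continuous_intros)
  also have "\<dots> = 1 / 3"
    using integral_sphere_power'[of 2 v'] integral_sphere_power'[of 2 w'] n by simp
  finally show ?thesis by (simp add: mult_left_mono)
qed auto

text \<open>The same argument with fourth moments, which are 1/5 for unit vectors.\<close>

lemma integral_sphere_sq_sq_le:
  "(\<integral>\<omega>. (\<omega> \<bullet> v)\<^sup>2 * (\<omega> \<bullet> w)\<^sup>2 \<partial>sphere_measure) \<le> (norm v)\<^sup>2 * (norm w)\<^sup>2 / 5"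
proof (cases "v = 0 \<or> w = 0")
  case False
  define v' w' where "v' = sgn v" and "w' = sgn w"
  have v: "v = norm v *\<^sub>R v'" and w: "w = norm w *\<^sub>R w'" and n: "norm v' = 1" "norm w' = 1"
    using False by (auto simp: v'_def w'_def sgn_div_norm)
  have "(\<integral>\<omega>. (\<omega> \<bullet> v)\<^sup>2 * (\<omega> \<bullet> w)\<^sup>2 \<partial>sphere_measure) = (norm v)\<^sup>2 * (norm w)\<^sup>2 * (\<integral>\<omega>. (\<omega> \<bullet> v')\<^sup>2 * (\<omega> \<bullet> w')\<^sup>2 \<partial>sphere_measure)"
    by (subst v, subst w) (simp add: power_mult_distrib mult_ac)
  also have "(\<integral>\<omega>. (\<omega> \<bullet> v')\<^sup>2 * (\<omega> \<bullet> w')\<^sup>2 \<partial>sphere_measure) \<le> (\<integral>\<omega>. (\<omega> \<bullet> v') ^ 4 / 2 + (\<omega> \<bullet> w') ^ 4 / 2 \<partial>sphere_measure)"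
  proof (rule integral_mono)
    show "(\<omega> \<bullet> v')\<^sup>2 * (\<omega> \<bullet> w')\<^sup>2 \<le> (\<omega> \<bullet> v') ^ 4 / 2 + (\<omega> \<bullet> w') ^ 4 / 2" for \<omega>
      using sum_squares_bound[of "(\<omega> \<bullet> v')\<^sup>2" "(\<omega> \<bullet> w')\<^sup>2"] by (simp flip: power_mult)
  qed (auto intro!: integrable_sphere_continuous continuous_intros)
  also have "\<dots> = 1 / 5"
    using integral_sphere_power'[of 4 v'] integral_sphere_power'[of 4 w'] n by simp
  finally show ?thesis by (simp add: mult_left_mono)
qed auto

section \<open>Kernels near the origin\<close>

lemma kern0_near: "\<bar>kern0 w - 1\<bar> \<le> (norm w)\<^sup>2 / 6"
proof -
  have i: "integrable sphere_measure (\<lambda>\<omega>. cos (\<omega> \<bullet> w))"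
    by (intro integrable_sphere_continuous continuous_intros)
  have "1 - kern0 w = (\<integral>\<omega>. 1 - cos (\<omega> \<bullet> w) \<partial>sphere_measure)"
    unfolding kern0_def by (subst Bochner_Integration.integral_diff) (auto intro!: i)
  moreover have "\<dots> \<le> (\<integral>\<omega>. (\<omega> \<bullet> w)\<^sup>2 / 2 \<partial>sphere_measure)"
  proof (rule integral_mono)
    show "1 - cos (\<omega> \<bullet> w) \<le> (\<omega> \<bullet> w)\<^sup>2 / 2" for \<omega>
      by (rule one_minus_cos_le)
  qed (auto intro!: i)
  moreover have "(\<integral>\<omega>. (\<omega> \<bullet> w)\<^sup>2 / 2 \<partial>sphere_measure) = (norm w)\<^sup>2 / 6"
    using integral_sphere_power'[of 2 w] by simp
  moreover have "0 \<le> (\<integral>\<omega>. 1 - cos (\<omega> \<bullet> w) \<partial>sphere_measure)"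
    by (rule integral_nonneg_AE) auto
  ultimately show ?thesis by linarith
qed

lemma kern1_near: "\<bar>kern1 v w\<bar> \<le> norm v * norm w / 3"
proof -
  have "\<bar>kern1 v w\<bar> \<le> (\<integral>\<omega>. \<bar>- ((\<omega> \<bullet> v) * sin (\<omega> \<bullet> w))\<bar> \<partial>sphere_measure)"
    unfolding kern1_def by (rule integral_abs_bound)
  also have "\<dots> \<le> (\<integral>\<omega>. \<bar>\<omega> \<bullet> v\<bar> * \<bar>\<omega> \<bullet> w\<bar> \<partial>sphere_measure)"
  proof (rule integral_mono)
    show "\<bar>- ((\<omega> \<bullet> v) * sin (\<omega> \<bullet> w))\<bar> \<le> \<bar>\<omega> \<bullet> v\<bar> * \<bar>\<omega> \<bullet> w\<bar>" for \<omega>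
      by (simp add: abs_mult mult_left_mono abs_sin_x_le_abs_x)
  qed (auto intro!: integrable_sphere_continuous continuous_intros)
  also have "\<dots> \<le> norm v * norm w / 3" by (rule integral_sphere_abs_inner_le)
  finally show ?thesis .
qed

lemma kern2_le: "\<bar>kern2 v w\<bar> \<le> (norm v)\<^sup>2 / 3"
proof -
  have "\<bar>kern2 v w\<bar> \<le> (\<integral>\<omega>. \<bar>- ((\<omega> \<bullet> v)\<^sup>2 * cos (\<omega> \<bullet> w))\<bar> \<partial>sphere_measure)"
    unfolding kern2_def by (rule integral_abs_bound)
  also have "\<dots> \<le> (\<integral>\<omega>. (\<omega> \<bullet> v)\<^sup>2 \<partial>sphere_measure)"
  proof (rule integral_mono)
    show "\<bar>- ((\<omega> \<bullet> v)\<^sup>2 * cos (\<omega> \<bullet> w))\<bar> \<le> (\<omega> \<bullet> v)\<^sup>2" for \<omega>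
      by (simp add: abs_mult mult_left_le)
  qed (auto intro!: integrable_sphere_continuous continuous_intros)
  also have "\<dots> = (norm v)\<^sup>2 / 3"
    using integral_sphere_power'[of 2 v] by simp
  finally show ?thesis .
qed

text \<open>Replacing the cosine by 1 costs at most half the mixed fourth moment, that is 1/2 times
  1/5; this is the origin of \<gamma>^2/10 in \<open>C1_const\<close>.\<close>

lemma kern2_near: "\<bar>kern2 v w + (norm v)\<^sup>2 / 3\<bar> \<le> (norm v)\<^sup>2 * (norm w)\<^sup>2 / 10"
proof -
  have i: "integrable sphere_measure (\<lambda>\<omega>. - ((\<omega> \<bullet> v)\<^sup>2 * cos (\<omega> \<bullet> w)))"
    "integrable sphere_measure (\<lambda>\<omega>. (\<omega> \<bullet> v)\<^sup>2 * (1 - cos (\<omega> \<bullet> w)))"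
    "integrable sphere_measure (\<lambda>\<omega>. (\<omega> \<bullet> v)\<^sup>2 * (\<omega> \<bullet> w)\<^sup>2)"
    by (intro integrable_sphere_continuous continuous_intros)+
  have "kern2 v w + (norm v)\<^sup>2 / 3 = (\<integral>\<omega>. - ((\<omega> \<bullet> v)\<^sup>2 * cos (\<omega> \<bullet> w)) \<partial>sphere_measure) + (\<integral>\<omega>. (\<omega> \<bullet> v)\<^sup>2 \<partial>sphere_measure)"
    using integral_sphere_power'[of 2 v] by (simp add: kern2_def)
  also have "\<dots> = (\<integral>\<omega>. - ((\<omega> \<bullet> v)\<^sup>2 * cos (\<omega> \<bullet> w)) + (\<omega> \<bullet> v)\<^sup>2 \<partial>sphere_measure)"
    by (rule Bochner_Integration.integral_add[symmetric]) (rule i, simp)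
  also have "\<dots> = (\<integral>\<omega>. (\<omega> \<bullet> v)\<^sup>2 * (1 - cos (\<omega> \<bullet> w)) \<partial>sphere_measure)"
    by (simp add: algebra_simps)
  finally have eq: "kern2 v w + (norm v)\<^sup>2 / 3 = (\<integral>\<omega>. (\<omega> \<bullet> v)\<^sup>2 * (1 - cos (\<omega> \<bullet> w)) \<partial>sphere_measure)" .
  have "0 \<le> (\<integral>\<omega>. (\<omega> \<bullet> v)\<^sup>2 * (1 - cos (\<omega> \<bullet> w)) \<partial>sphere_measure)"
    by (rule integral_nonneg_AE) auto
  moreover have "(\<integral>\<omega>. (\<omega> \<bullet> v)\<^sup>2 * (1 - cos (\<omega> \<bullet> w)) \<partial>sphere_measure) \<le> (\<integral>\<omega>. ((\<omega> \<bullet> v)\<^sup>2 * (\<omega> \<bullet> w)\<^sup>2) / 2 \<partial>sphere_measure)"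
  proof (rule integral_mono)
    show "(\<omega> \<bullet> v)\<^sup>2 * (1 - cos (\<omega> \<bullet> w)) \<le> ((\<omega> \<bullet> v)\<^sup>2 * (\<omega> \<bullet> w)\<^sup>2) / 2" for \<omega>
      using mult_left_mono[OF one_minus_cos_le[of "\<omega> \<bullet> w"], of "(\<omega> \<bullet> v)\<^sup>2"] by simp
  qed (use i in auto)
  moreover have "\<dots> = (\<integral>\<omega>. (\<omega> \<bullet> v)\<^sup>2 * (\<omega> \<bullet> w)\<^sup>2 \<partial>sphere_measure) / 2"
    by simp
  ultimately show ?thesis
    unfolding eq using integral_sphere_sq_sq_le[of v w] by linarith
qed

section \<open>Closed forms of the kernels and their decay\<close>

lemma kern0_eq: "w \<noteq> 0 \<Longrightarrow> kern0 w = sin (norm w) / norm w"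
  by (simp add: kern0_def integral_sphere_cos')

text \<open>The kernels are inner products of waves with \<open>plane_wave 1 0\<close>, so the L2
  derivative of waves replaces differentiation under the integral sign.\<close>

lemma has_derivative_wave_line:
  assumes "continuous_on UNIV p"
  shows "((\<lambda>s. inner (wave 1 p (w + s *\<^sub>R v)) f) has_real_derivative inner (wave 1 (\<lambda>\<omega>. p \<omega> * dir 1 v \<omega>) (w + s *\<^sub>R v)) f) (at s)"
proof -
  have "((\<lambda>s. w + s *\<^sub>R v) has_derivative (\<lambda>h. h *\<^sub>R v)) (at s)"
    by (auto intro!: derivative_eq_intros)
  from has_derivative_compose[OF this has_derivative_wave[OF assms, of 1]]
  have d: "((\<lambda>s. wave 1 p (w + s *\<^sub>R v)) has_derivative (\<lambda>h. wave 1 (\<lambda>\<omega>. p \<omega> * dir 1 (h *\<^sub>R v) \<omega>) (w + s *\<^sub>R v))) (at s)" .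
  then have "bounded_linear (\<lambda>h. wave 1 (\<lambda>\<omega>. p \<omega> * dir 1 (h *\<^sub>R v) \<omega>) (w + s *\<^sub>R v))"
    by (rule has_derivative_bounded_linear)
  then have "wave 1 (\<lambda>\<omega>. p \<omega> * dir 1 (h *\<^sub>R v) \<omega>) (w + s *\<^sub>R v) = h *\<^sub>R wave 1 (\<lambda>\<omega>. p \<omega> * dir 1 v \<omega>) (w + s *\<^sub>R v)" for h
    using linear_simps(5)[of _ h 1] by fastforce
  with d have "((\<lambda>s. inner (wave 1 p (w + s *\<^sub>R v)) f) has_derivative (\<lambda>h. inner (h *\<^sub>R wave 1 (\<lambda>\<omega>. p \<omega> * dir 1 v \<omega>) (w + s *\<^sub>R v)) f)) (at s)"
    by (intro has_derivative_inner_left) simp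
  then show ?thesis
    unfolding has_field_derivative_def by (rule has_derivative_eq_rhs) (auto simp: fun_eq_iff)
qed

lemma kern0_line_derivative:
  "((\<lambda>s. kern0 (w + s *\<^sub>R v)) has_real_derivative kern1 v (w + s *\<^sub>R v)) (at s)"
  using has_derivative_wave_line[of "\<lambda>\<omega>. 1" w v "plane_wave 1 0" s]
  by (simp add: plane_wave_eq_wave[symmetric] Re_cinner[symmetric] cinner_plane_wave cinner_dwave)

lemma kern1_line_derivative:
  "((\<lambda>s. kern1 v (w + s *\<^sub>R v)) has_real_derivative kern2 v (w + s *\<^sub>R v)) (at s)"
  using has_derivative_wave_line[of "dir 1 v" w v "plane_wave 1 0" s]
  by (simp add: continuous_on_dir Re_cinner[symmetric] cinner_dwave cinner_ddwave)

lemma norm_line_derivative: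
  assumes "w + s *\<^sub>R v \<noteq> (0::real^3)"
  shows "((\<lambda>s. norm (w + s *\<^sub>R v)) has_real_derivative ((w + s *\<^sub>R v) \<bullet> v) / norm (w + s *\<^sub>R v)) (at s)"
proof -
  have "((\<lambda>s. w + s *\<^sub>R v) has_derivative (\<lambda>h. h *\<^sub>R v)) (at s)"
    by (auto intro!: derivative_eq_intros)
  from has_derivative_compose[OF this has_derivative_norm[OF assms]]
  show ?thesis
    unfolding has_field_derivative_def
    by (rule has_derivative_eq_rhs) (auto simp: fun_eq_iff sgn_div_norm inner_commute divide_inverse)
qed

lemma eventually_line_nonzero:
  assumes "w \<noteq> (0::real^3)"
  shows "\<forall>\<^sub>F s in nhds (0::real). w + s *\<^sub>R v \<noteq> 0"
proof -
  have "((\<lambda>s. w + s *\<^sub>R v) \<longlongrightarrow> w + 0 *\<^sub>R v) (nhds 0)"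
    by (intro tendsto_intros filterlim_ident)
  then show ?thesis using assms by (intro tendsto_imp_eventually_ne) auto
qed

text \<open>\<open>kern1\<close> is the derivative of \<open>kern0\<close> along the line w + s v,
  and near s = 0 this line avoids the origin, where \<open>kern0\<close> is given by sinc.
  Uniqueness of the derivative yields the closed form; \<open>kern2_eq\<close> repeats the argument
  once more.\<close>

lemma kern1_eq:
  assumes "w \<noteq> 0"
  shows "kern1 v w = (norm w * cos (norm w) - sin (norm w)) * (w \<bullet> v) / norm w ^ 3"
proof -
  have n0: "w + 0 *\<^sub>R v \<noteq> 0" "norm w \<noteq> 0" using assms by auto
  from eventually_line_nonzero[OF assms, of v] have ev: "\<forall>\<^sub>F s in nhds 0. kern0 (w + s *\<^sub>R v) = sin (norm (w + s *\<^sub>R v)) / norm (w + s *\<^sub>R v)"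
    by eventually_elim (rule kern0_eq)
  have "((\<lambda>s. sin (norm (w + s *\<^sub>R v)) / norm (w + s *\<^sub>R v)) has_real_derivative
     (norm w * cos (norm w) - sin (norm w)) * (w \<bullet> v) / norm w ^ 3) (at 0)"
    using n0 by (auto intro!: derivative_eq_intros norm_line_derivative simp: field_simps power3_eq_cube)
  then have "((\<lambda>s. kern0 (w + s *\<^sub>R v)) has_real_derivative
     (norm w * cos (norm w) - sin (norm w)) * (w \<bullet> v) / norm w ^ 3) (at 0)"
    using DERIV_cong_ev[OF refl ev refl] by simp
  from DERIV_unique[OF kern0_line_derivative[of w v 0] this]
  show ?thesis by simp
qed

lemma kern2_eq:
  assumes "w \<noteq> 0"
  shows "kern2 v w = - (sin (norm w) * (w \<bullet> v)\<^sup>2 / norm w ^ 3) +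
    (norm w * cos (norm w) - sin (norm w)) * ((norm v)\<^sup>2 / norm w ^ 3 - 3 * (w \<bullet> v)\<^sup>2 / norm w ^ 5)"
    (is "_ = ?R")
proof -
  have n0: "w + 0 *\<^sub>R v \<noteq> 0" "norm w \<noteq> 0" using assms by auto
  from eventually_line_nonzero[OF assms, of v] have ev: "\<forall>\<^sub>F s in nhds 0. kern1 v (w + s *\<^sub>R v) =
     (norm (w + s *\<^sub>R v) * cos (norm (w + s *\<^sub>R v)) - sin (norm (w + s *\<^sub>R v))) * ((w + s *\<^sub>R v) \<bullet> v) / norm (w + s *\<^sub>R v) ^ 3"
    by eventually_elim (rule kern1_eq)
  have i: "((\<lambda>s. (w + s *\<^sub>R v) \<bullet> v) has_real_derivative (norm v)\<^sup>2) (at 0)"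
    by (auto intro!: derivative_eq_intros simp: inner_add_left power2_norm_eq_inner)
  have N: "((\<lambda>s. norm (w + s *\<^sub>R v)) has_real_derivative (w \<bullet> v) / norm w) (at 0)"
    using norm_line_derivative[OF n0(1)] by simp
  have "((\<lambda>s. (norm (w + s *\<^sub>R v) * cos (norm (w + s *\<^sub>R v)) - sin (norm (w + s *\<^sub>R v))) * ((w + s *\<^sub>R v) \<bullet> v) / norm (w + s *\<^sub>R v) ^ 3)
    has_real_derivative ?R) (at 0)"
    using n0
    by (auto intro!: derivative_eq_intros N i simp: field_simps eval_nat_numeral)
  then have "((\<lambda>s. kern1 v (w + s *\<^sub>R v)) has_real_derivative ?R) (at 0)"
    using DERIV_cong_ev[OF refl ev refl] by simp
  from DERIV_unique[OF kern1_line_derivative[of v w 0] this]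
  show ?thesis by simp
qed

text \<open>For c = 1 and c = -1, t^2/2 + c (t cos t - sin t) vanishes at 0 and has derivative t (1
  - c sin t) >= 0.\<close>

lemma tcos_sin_bound:
  fixes t :: real
  assumes "t \<ge> 0"
  shows "\<bar>t * cos t - sin t\<bar> \<le> t\<^sup>2 / 2"
proof -
  have d: "((\<lambda>t. t\<^sup>2 / 2 + c * (t * cos t - sin t)) has_real_derivative x * (1 - c * sin x)) (at x)" for c x :: real
    by (auto intro!: derivative_eq_intros simp: algebra_simps)
  have "0 \<le> t\<^sup>2 / 2 + c * (t * cos t - sin t)" if "\<bar>c\<bar> = 1" for c
  proof -
    have "(\<lambda>t. t\<^sup>2 / 2 + c * (t * cos t - sin t)) 0 \<le> (\<lambda>t. t\<^sup>2 / 2 + c * (t * cos t - sin t)) t"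
    proof (rule DERIV_nonneg_imp_nondecreasing[OF assms])
      fix x :: real assume x: "0 \<le> x" "x \<le> t"
      have "\<bar>c * sin x\<bar> \<le> 1" using that by (simp add: abs_mult)
      then have "0 \<le> x * (1 - c * sin x)" using x by (intro mult_nonneg_nonneg) auto
      then show "\<exists>y. ((\<lambda>t. t\<^sup>2 / 2 + c * (t * cos t - sin t)) has_real_derivative y) (at x) \<and> 0 \<le> y"
        using d by blast
    qed
    then show ?thesis by simp
  qed
  from this[of 1] this[of "-1"] show ?thesis unfolding abs_le_iff by simp
qed

lemma c_nu_bound:
  fixes t :: real
  assumes "t > 0"
  shows "\<bar>t * cos t - sin t\<bar> \<le> c_nu * t"
proof -
  \<comment> \<open>A real supremum is an upper bound only for a set known to be bounded above; the
    crude bound 2 serves for this.\<close>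
  have bdd: "bdd_above ((\<lambda>t::real. \<bar>t * cos t - sin t\<bar> / t) ` {0<..})"
  proof (rule bdd_aboveI2)
    fix t :: real assume t: "t \<in> {0<..}"
    have "\<bar>t * cos t\<bar> \<le> t * 1" using t by (simp add: abs_mult mult_left_le)
    moreover have "\<bar>sin t\<bar> \<le> t" using abs_sin_x_le_abs_x[of t] t by simp
    ultimately have "\<bar>t * cos t - sin t\<bar> \<le> 2 * t" by linarith
    then show "\<bar>t * cos t - sin t\<bar> / t \<le> 2" using t by (simp add: divide_le_eq)
  qed
  have "\<bar>t * cos t - sin t\<bar> / t \<le> c_nu"
    unfolding c_nu_def using assms by (intro cSUP_upper bdd) auto
  then show ?thesis using assms by (simp add: divide_le_eq)
qed

text \<open>Evaluated at t = pi. It lets the majorant c_nu^2/|w|^2 for \<open>kern1\<close> also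
  cover \<open>kern0\<close> and, up to a factor, \<open>kern2\<close>.\<close>

lemma c_nu_ge_1: "1 \<le> c_nu"
  using c_nu_bound[of pi] by simp

lemma kern0_far: "w \<noteq> 0 \<Longrightarrow> \<bar>kern0 w\<bar> \<le> 1 / norm w"
  by (simp add: kern0_eq divide_right_mono)

lemma kern1_far:
  assumes "w \<noteq> 0" "norm v = 1"
  shows "\<bar>kern1 v w\<bar> \<le> c_nu / norm w"
proof -
  have "\<bar>w \<bullet> v\<bar> \<le> norm w"
    using Cauchy_Schwarz_ineq2[of w v] assms by simp
  then have "\<bar>norm w * cos (norm w) - sin (norm w)\<bar> * \<bar>w \<bullet> v\<bar> \<le> (c_nu * norm w) * norm w"
    using c_nu_bound[of "norm w"] assms by (intro mult_mono) auto
  then have "\<bar>kern1 v w\<bar> \<le> (c_nu * norm w * norm w) / norm w ^ 3"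
    unfolding kern1_eq[OF assms(1)] by (simp add: abs_mult divide_right_mono)
  also have "\<dots> = c_nu / norm w"
    using assms by (simp add: power3_eq_cube)
  finally show ?thesis .
qed

text \<open>With N = |w|, c the cosine of the angle between w and v, and J the derivative of sinc at
  N, |w| times the kernel is -sin N c^2 + J (1 - 3 c^2). Both terms are at most 1 in absolute value,
  because |J| <= 1/2 and |1 - 3 c^2| <= 2.\<close>

lemma kern2_far:
  assumes "w \<noteq> 0" "norm v = 1"
  shows "\<bar>kern2 v w\<bar> \<le> 2 / norm w"
proof -
  define N where "N = norm w"
  define c where "c = (w \<bullet> v) / N"
  define J where "J = (N * cos N - sin N) / N\<^sup>2"
  have N: "N > 0" using assms by (simp add: N_def)
  have wv: "w \<bullet> v = c * N" using N by (simp add: c_def)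
  have "\<bar>w \<bullet> v\<bar> \<le> N"
    using Cauchy_Schwarz_ineq2[of w v] assms by (simp add: N_def)
  then have "\<bar>c\<bar> \<le> 1" using N by (simp add: c_def abs_divide divide_le_eq)
  then have c: "c\<^sup>2 \<le> 1" by (simp add: abs_square_le_1)
  have J: "\<bar>J\<bar> \<le> 1 / 2"
    using tcos_sin_bound[of N] N by (simp add: J_def abs_divide divide_le_eq)
  have JN: "N * cos N - sin N = J * N\<^sup>2" using N by (simp add: J_def)
  have "kern2 v w = (- (sin N * c\<^sup>2) + J * (1 - 3 * c\<^sup>2)) / N"
    unfolding kern2_eq[OF assms(1)] N_def[symmetric] wv JN using N assms(2)
    by (simp add: field_simps eval_nat_numeral)
  also have "\<bar>\<dots>\<bar> = \<bar>- (sin N * c\<^sup>2) + J * (1 - 3 * c\<^sup>2)\<bar> / N"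
    using N by simp
  also have "\<bar>- (sin N * c\<^sup>2) + J * (1 - 3 * c\<^sup>2)\<bar> \<le> 2"
  proof -
    have "\<bar>sin N * c\<^sup>2\<bar> \<le> 1 * 1"
      unfolding abs_mult using c by (intro mult_mono) auto
    moreover have "\<bar>J * (1 - 3 * c\<^sup>2)\<bar> \<le> (1 / 2) * 2"
    proof -
      have "\<bar>1 - 3 * c\<^sup>2\<bar> \<le> 2" using c zero_le_power2[of c] by linarith
      then show ?thesis unfolding abs_mult using J by (intro mult_mono) auto
    qed
    ultimately show ?thesis by linarith
  qed
  finally show ?thesis using N by (simp add: N_def divide_right_mono)
qed

section \<open>Packing bounds for separated points\<close>

text \<open>The balls of radius d/2 around the points are disjoint and lie in the ball of radius r +
  d/2 around z; their volumes are compared.\<close>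

lemma card_separated_le:
  fixes Y :: "(real^3) set"
  assumes Y: "finite Y" and d: "d > 0" and sep: "\<And>x y. x \<in> Y \<Longrightarrow> y \<in> Y \<Longrightarrow> x \<noteq> y \<Longrightarrow> d \<le> dist x y"
    and r: "\<And>y. y \<in> Y \<Longrightarrow> dist z y \<le> r" "r \<ge> 0"
  shows "real (card Y) \<le> (2 * r / d + 1) ^ 3"
proof -
  have disj: "disjoint_family_on (\<lambda>y. ball y (d / 2)) Y"
    unfolding disjoint_family_on_def
  proof (intro ballI impI equals0I)
    fix x y w assume xy: "x \<in> Y" "y \<in> Y" "x \<noteq> y" and w: "w \<in> ball x (d / 2) \<inter> ball y (d / 2)"
    have "dist x y \<le> dist x w + dist y w" by (rule dist_triangle2)
    then show False using sep[OF xy] w by simp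
  qed
  have vol: "measure lborel (ball c \<rho>) = 4 / 3 * pi * \<rho> ^ 3" if "\<rho> \<ge> 0" for c :: "real^3" and \<rho>
    using that by (simp add: content_ball unit_ball_vol_3)
  have "real (card Y) * (4 / 3 * pi * (d / 2) ^ 3) = (\<Sum>y\<in>Y. measure lborel (ball y (d / 2)))"
    using d by (simp add: vol)
  also have "\<dots> = measure lborel (\<Union>y\<in>Y. ball y (d / 2))"
    using Y disj by (intro measure_finite_Union[symmetric]) (auto simp: emeasure_ball d less_imp_le)
  also have "\<dots> \<le> measure lborel (ball z (r + d / 2))"
  proof (rule measure_mono_fmeasurable)
    show "(\<Union>y\<in>Y. ball y (d / 2)) \<subseteq> ball z (r + d / 2)"
    proof
      fix w assume "w \<in> (\<Union>y\<in>Y. ball y (d / 2))"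
      then obtain y where y: "y \<in> Y" "dist y w < d / 2" by auto
      have "dist z w \<le> dist z y + dist y w" by (rule dist_triangle)
      then show "w \<in> ball z (r + d / 2)" using r(1)[OF y(1)] y by simp
    qed
    show "(\<Union>y\<in>Y. ball y (d / 2)) \<in> sets lborel" using Y by auto
    show "ball z (r + d / 2) \<in> fmeasurable lborel"
      by (rule fmeasurableI) (use r d in \<open>auto simp: emeasure_ball\<close>)
  qed
  also have "\<dots> = 4 / 3 * pi * (r + d / 2) ^ 3"
    using r d by (simp add: vol)
  finally have "real (card Y) * (d / 2) ^ 3 \<le> (r + d / 2) ^ 3"
    by (simp add: mult_ac)
  then have "real (card Y) \<le> (r + d / 2) ^ 3 / (d / 2) ^ 3"
    using d by (simp add: pos_le_divide_eq)
  also have "\<dots> = (2 * r / d + 1) ^ 3"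
  proof -
    have "(r + d / 2) / (d / 2) = 2 * r / d + 1"
      using d by (simp add: field_simps)
    then show ?thesis by (simp only: power_divide[symmetric])
  qed
  finally show ?thesis .
qed

lemma powr_third_cube: "x > 0 \<Longrightarrow> (x powr (1/3)) ^ 3 = x" for x :: real
  by (simp add: powr_realpow[symmetric] powr_powr)

lemma powr_two_thirds: "x \<ge> 0 \<Longrightarrow> x powr (2/3) = (x powr (1/3))\<^sup>2" for x :: real
  by (cases "x = 0") (simp_all add: powr_realpow[symmetric] powr_powr)

text \<open>Induction by removing the farthest element m: the counting hypothesis at m sees all of
  Y, so 1/d m <= K (card Y)^(-1/3). What remains is the induction for the sums of n^(-1/3) and
  n^(-2/3) over n up to N, which are at most 3/2 N^(2/3) and 3 N^(1/3).\<close>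

lemma sum_inverse_le_of_counting:
  fixes d :: "'a \<Rightarrow> real"
  assumes "finite Y" and K: "K > 0" and "\<And>y. y \<in> Y \<Longrightarrow> d y > 0"
    and "\<And>y. y \<in> Y \<Longrightarrow> real (card {y'\<in>Y. d y' \<le> d y}) \<le> (K * d y) ^ 3"
  shows "(\<Sum>y\<in>Y. 1 / d y) \<le> 3 / 2 * K * real (card Y) powr (2/3)"
    and "(\<Sum>y\<in>Y. 1 / (d y)\<^sup>2) \<le> 3 * K\<^sup>2 * real (card Y) powr (1/3)"
proof -
  have "(\<Sum>y\<in>Y. 1 / d y) \<le> 3 / 2 * K * real (card Y) powr (2/3) \<and>
    (\<Sum>y\<in>Y. 1 / (d y)\<^sup>2) \<le> 3 * K\<^sup>2 * real (card Y) powr (1/3)"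
    using assms(1,3,4)
  proof (induction "card Y" arbitrary: Y)
    case 0
    then show ?case by simp
  next
    case (Suc n)
    then have Y: "finite Y" "Y \<noteq> {}" by auto
    then obtain m where m: "m \<in> Y" "\<And>y. y \<in> Y \<Longrightarrow> d y \<le> d m"
      using obtains_MAX[of Y d] by (metis Max_ge finite_imageI imageI)
    let ?Z = "Y - {m}"
    have cZ: "n = card ?Z" using Suc.hyps(2) Y m by simp
    have IH: "(\<Sum>y\<in>?Z. 1 / d y) \<le> 3 / 2 * K * real (card ?Z) powr (2/3) \<and>
      (\<Sum>y\<in>?Z. 1 / (d y)\<^sup>2) \<le> 3 * K\<^sup>2 * real (card ?Z) powr (1/3)"
    proof (rule Suc.hyps(1)[OF cZ])
      fix y assume y: "y \<in> ?Z"
      show "d y > 0" using Suc.prems y by auto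
      have "real (card {y'\<in>?Z. d y' \<le> d y}) \<le> real (card {y'\<in>Y. d y' \<le> d y})"
        using Y by (intro of_nat_mono card_mono) auto
      also have "\<dots> \<le> (K * d y) ^ 3" using Suc.prems y by auto
      finally show "real (card {y'\<in>?Z. d y' \<le> d y}) \<le> (K * d y) ^ 3" .
    qed (use Y in auto)
    define x where "x = real (Suc n) powr (1/3)"
    define y where "y = real n powr (1/3)"
    have x0: "x > 0" and y0: "y \<ge> 0" by (auto simp: x_def y_def)
    have x3: "x ^ 3 = real n + 1" unfolding x_def by (subst powr_third_cube) auto
    have y3: "y ^ 3 = real n" unfolding y_def by (cases "n = 0") (auto simp: powr_third_cube)
    have yx: "y \<le> x" unfolding x_def y_def by (intro powr_mono2) auto
    have dm: "d m > 0" using Suc.prems m by auto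
    have "x \<le> K * d m"
    proof -
      have "{y'\<in>Y. d y' \<le> d m} = Y" using m by auto
      then have "real (Suc n) \<le> (K * d m) ^ 3" using Suc.prems(3)[OF m(1)] Suc.hyps(2) by simp
      then have "x ^ 3 \<le> (K * d m) ^ 3" using x3 by simp
      then show ?thesis using K dm by (intro power_le_imp_le_base[of x 2]) (auto simp: numeral_3_eq_3 simp del: power_Suc)
    qed
    then have inv: "1 / d m \<le> K / x" using x0 dm K by (simp add: divide_le_eq field_simps)
    \<comment> \<open>With cube roots as variables, both estimates become polynomial inequalities
      under the constraint x^3 - y^3 = 1.\<close>
    have diff: "(x - y) * (x\<^sup>2 + x * y + y\<^sup>2) = 1"
      using x3 y3 by (simp add: algebra_simps eval_nat_numeral)
    \<comment> \<open>Concavity of t^(2/3): its increment from n to n + 1 is at least its derivative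
      2/(3x) at n + 1. As a polynomial inequality this is (x - y)^2 (x + 2y) >= 0.\<close>
    have s1: "1 / x \<le> 3 / 2 * (x\<^sup>2 - y\<^sup>2)"
    proof -
      have "0 \<le> (x - y) * ((x - y) * (x + 2 * y))" using x0 y0 yx by (intro mult_nonneg_nonneg) auto
      also have "\<dots> = 3 * (x\<^sup>2 - y\<^sup>2) * x - 2 * ((x - y) * (x\<^sup>2 + x * y + y\<^sup>2))"
        by (simp add: algebra_simps power2_eq_square)
      finally have "1 \<le> 3 / 2 * (x\<^sup>2 - y\<^sup>2) * x" unfolding diff by simp
      then show ?thesis using x0 by (simp add: divide_le_eq)
    qed
    \<comment> \<open>Likewise for t^(1/3), whose derivative at n + 1 is 1/(3 x^2).\<close>
    have s2: "1 / x\<^sup>2 \<le> 3 * (x - y)"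
    proof -
      have "x\<^sup>2 + x * y + y\<^sup>2 \<le> x\<^sup>2 + x * x + x\<^sup>2"
        using x0 y0 yx by (intro add_mono mult_mono power_mono) auto
      then have "(x - y) * (x\<^sup>2 + x * y + y\<^sup>2) \<le> (x - y) * (3 * x\<^sup>2)"
        using yx by (intro mult_left_mono) (auto simp: power2_eq_square)
      then have "1 \<le> 3 * (x - y) * x\<^sup>2" unfolding diff by (simp only: mult_ac)
      then show ?thesis using x0 by (simp add: divide_le_eq)
    qed
    have sum: "(\<Sum>y\<in>Y. f y) = f m + (\<Sum>y\<in>?Z. f y)" for f :: "'a \<Rightarrow> real"
      using Y m by (simp add: sum.remove)
    have cY: "real (card Y) powr (2/3) = x\<^sup>2" "real (card ?Z) powr (2/3) = y\<^sup>2"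
       "real (card Y) powr (1/3) = x" "real (card ?Z) powr (1/3) = y"
      using Suc.hyps(2) cZ by (simp_all add: x_def y_def powr_two_thirds)
    have "1 / d m \<le> 3 / 2 * K * (x\<^sup>2 - y\<^sup>2)"
    proof -
      have "1 / d m \<le> K * (1 / x)" using inv by simp
      also have "\<dots> \<le> K * (3 / 2 * (x\<^sup>2 - y\<^sup>2))" using s1 K by (intro mult_left_mono) auto
      finally show ?thesis by (simp only: mult_ac)
    qed
    moreover have "1 / (d m)\<^sup>2 \<le> 3 * K\<^sup>2 * (x - y)"
    proof -
      have "(1 / d m)\<^sup>2 \<le> (K / x)\<^sup>2" using inv dm by (intro power_mono) auto
      also have "\<dots> = K\<^sup>2 * (1 / x\<^sup>2)" by (simp add: power_divide)
      also have "\<dots> \<le> K\<^sup>2 * (3 * (x - y))" using s2 by (intro mult_left_mono) auto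
      finally show ?thesis by (simp only: power_divide power_one mult_ac)
    qed
    ultimately show ?case
      using IH unfolding cY sum[of "\<lambda>y. 1 / d y"] sum[of "\<lambda>y. 1 / (d y)\<^sup>2"]
      by (auto simp: algebra_simps)
  qed
  then show "(\<Sum>y\<in>Y. 1 / d y) \<le> 3 / 2 * K * real (card Y) powr (2/3)"
    "(\<Sum>y\<in>Y. 1 / (d y)\<^sup>2) \<le> 3 * K\<^sup>2 * real (card Y) powr (1/3)" by auto
qed

lemma finite_distances:
  "finite X \<Longrightarrow> finite {dist x y |x y. x \<in> X \<and> y \<in> X \<and> x \<noteq> y}"
  by (rule finite_subset[of _ "(\<lambda>(x, y). dist x y) ` (X \<times> X)"]) auto

lemma min_separation_le:
  assumes "finite X" "x \<in> X" "y \<in> X" "x \<noteq> y"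
  shows "min_separation X \<le> dist x y"
  unfolding min_separation_def using assms finite_distances[of X] by (intro Min_le) auto

lemma min_separation_pos:
  assumes "finite X" "card X \<ge> 2"
  shows "min_separation X > 0"
proof -
  let ?D = "{dist x y |x y. x \<in> X \<and> y \<in> X \<and> x \<noteq> y}"
  have "\<not> card X \<le> Suc 0" using assms by simp
  then obtain x y where "x \<in> X" "y \<in> X" "x \<noteq> y"
    using assms card_le_Suc0_iff_eq by metis
  then have "?D \<noteq> {}" by auto
  then have "Min ?D \<in> ?D" using finite_distances[OF assms(1)] by (intro Min_in)
  then show ?thesis unfolding min_separation_def by auto
qed

text \<open>The origin of 9/2 in \<mu>: for distances r >= d the packing count (2r/d + 1)^3 is at
  most (3r/d)^3, and 3/2 times 3 is 9/2.\<close>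

lemma sum_inverse_dist_le:
  fixes X :: "(real^3) set"
  assumes X: "finite X" "x \<in> X" and d: "d > 0"
    and sep: "\<And>x y. x \<in> X \<Longrightarrow> y \<in> X \<Longrightarrow> x \<noteq> y \<Longrightarrow> d \<le> dist x y"
  shows "(\<Sum>y\<in>X - {x}. 1 / dist x y) \<le> 9 / 2 * (real (card X) powr (2/3) / d)"
proof -
  have "(\<Sum>y\<in>X - {x}. 1 / dist x y) \<le> 3 / 2 * (3 / d) * real (card (X - {x})) powr (2/3)"
  proof (rule sum_inverse_le_of_counting(1))
    fix y assume y: "y \<in> X - {x}"
    then have dy: "d \<le> dist x y" using sep X by auto
    then show "0 < dist x y" using d by linarith
    have "real (card {y' \<in> X - {x}. dist x y' \<le> dist x y}) \<le> (2 * dist x y / d + 1) ^ 3"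
      using X d sep by (intro card_separated_le[where z = x]) auto
    also have "\<dots> \<le> (3 / d * dist x y) ^ 3"
      using dy d by (intro power_mono) (auto simp: field_simps)
    finally show "real (card {y' \<in> X - {x}. dist x y' \<le> dist x y}) \<le> (3 / d * dist x y) ^ 3" .
  qed (use X d in auto)
  also have "real (card (X - {x})) powr (2/3) \<le> real (card X) powr (2/3)"
    using X by (intro powr_mono2 of_nat_mono card_mono) auto
  finally show ?thesis using d by (simp add: mult_left_mono divide_right_mono)
qed

text \<open>The origin of 48 in \<nu>: z need not be a source, so distances are only known to be r
  >= d/2. Then 2r/d + 1 <= 4r/d, and 3 times 4^2 is 48.\<close>

lemma sum_inverse_dist_sq_le:
  fixes X :: "(real^3) set"
  assumes X: "finite X" and d: "d > 0"
    and sep: "\<And>x y. x \<in> X \<Longrightarrow> y \<in> X \<Longrightarrow> x \<noteq> y \<Longrightarrow> d \<le> dist x y"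
    and z: "\<And>y. y \<in> X - {x} \<Longrightarrow> d / 2 \<le> dist z y"
  shows "(\<Sum>y\<in>X - {x}. 1 / (dist z y)\<^sup>2) \<le> 48 * (real (card X) powr (1/3) / d\<^sup>2)"
proof -
  have "(\<Sum>y\<in>X - {x}. 1 / (dist z y)\<^sup>2) \<le> 3 * (4 / d)\<^sup>2 * real (card (X - {x})) powr (1/3)"
  proof (rule sum_inverse_le_of_counting(2))
    fix y assume y: "y \<in> X - {x}"
    then have dy: "d / 2 \<le> dist z y" using z by auto
    then show "0 < dist z y" using d by linarith
    have "real (card {y' \<in> X - {x}. dist z y' \<le> dist z y}) \<le> (2 * dist z y / d + 1) ^ 3"
      using X d sep by (intro card_separated_le[where z = z]) auto
    also have "\<dots> \<le> (4 / d * dist z y) ^ 3"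
      using dy d by (intro power_mono) (auto simp: field_simps)
    finally show "real (card {y' \<in> X - {x}. dist z y' \<le> dist z y}) \<le> (4 / d * dist z y) ^ 3" .
  qed (use X d in auto)
  also have "real (card (X - {x})) powr (1/3) \<le> real (card X) powr (1/3)"
    using X by (intro powr_mono2 of_nat_mono card_mono) auto
  finally show ?thesis using d by (simp add: mult_left_mono divide_right_mono power_divide)
qed

section \<open>Projections in nearly orthonormal coordinates\<close>

lemma sum_Re: "Re (sum f A) = (\<Sum>a\<in>A. Re (f a))"
  by (induction A rule: infinite_finite_induct) auto

text \<open>The Schur test: writing |E| as sqrt |E| times sqrt |E| in Cauchy-Schwarz gives one
  factor m per row; after exchanging the sums, symmetry turns column sums into row sums and gives
  the second.\<close>

lemma schur_row_sum_bound:
  fixes E :: "'a \<Rightarrow> 'a \<Rightarrow> real" and c :: "'a \<Rightarrow> complex"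
  assumes X: "finite X" and m: "m \<ge> 0" and sym: "\<And>x y. E x y = E y x"
    and row: "\<And>x. x \<in> X \<Longrightarrow> (\<Sum>y\<in>X. \<bar>E x y\<bar>) \<le> m"
  shows "L2_set (\<lambda>x. cmod (\<Sum>y\<in>X. complex_of_real (E x y) * c y)) X \<le> m * L2_set (\<lambda>x. cmod (c x)) X"
proof -
  have pt: "(cmod (\<Sum>y\<in>X. complex_of_real (E x y) * c y))\<^sup>2 \<le> m * (\<Sum>y\<in>X. \<bar>E x y\<bar> * (cmod (c y))\<^sup>2)" if x: "x \<in> X" for x
  proof -
    have "cmod (\<Sum>y\<in>X. complex_of_real (E x y) * c y) \<le> (\<Sum>y\<in>X. \<bar>E x y\<bar> * cmod (c y))"
      by (rule order_trans[OF norm_sum]) (simp add: norm_mult)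
    also have "\<dots> = (\<Sum>y\<in>X. \<bar>sqrt \<bar>E x y\<bar>\<bar> * \<bar>sqrt \<bar>E x y\<bar> * cmod (c y)\<bar>)"
      by (intro sum.cong) (auto simp: abs_mult mult.assoc[symmetric])
    also have "\<dots> \<le> L2_set (\<lambda>y. sqrt \<bar>E x y\<bar>) X * L2_set (\<lambda>y. sqrt \<bar>E x y\<bar> * cmod (c y)) X"
      by (rule L2_set_mult_ineq)
    finally have "(cmod (\<Sum>y\<in>X. complex_of_real (E x y) * c y))\<^sup>2 \<le>
        (L2_set (\<lambda>y. sqrt \<bar>E x y\<bar>) X * L2_set (\<lambda>y. sqrt \<bar>E x y\<bar> * cmod (c y)) X)\<^sup>2"
      by (intro power_mono) auto
    also have "\<dots> = (\<Sum>y\<in>X. \<bar>E x y\<bar>) * (\<Sum>y\<in>X. \<bar>E x y\<bar> * (cmod (c y))\<^sup>2)"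
      by (simp add: L2_set_def power_mult_distrib sum_nonneg)
    also have "\<dots> \<le> m * (\<Sum>y\<in>X. \<bar>E x y\<bar> * (cmod (c y))\<^sup>2)"
      using row[OF x] by (intro mult_right_mono sum_nonneg) auto
    finally show ?thesis .
  qed
  have "(\<Sum>x\<in>X. (cmod (\<Sum>y\<in>X. complex_of_real (E x y) * c y))\<^sup>2) \<le> (\<Sum>x\<in>X. m * (\<Sum>y\<in>X. \<bar>E x y\<bar> * (cmod (c y))\<^sup>2))"
    by (rule sum_mono) (rule pt)
  also have "\<dots> = m * (\<Sum>y\<in>X. \<Sum>x\<in>X. \<bar>E x y\<bar> * (cmod (c y))\<^sup>2)"
    by (subst sum.swap) (simp add: sum_distrib_left)
  also have "\<dots> = m * (\<Sum>y\<in>X. (\<Sum>x\<in>X. \<bar>E y x\<bar>) * (cmod (c y))\<^sup>2)"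
    by (simp add: sum_distrib_right sym[of y for y])
  also have "\<dots> \<le> m * (\<Sum>y\<in>X. m * (cmod (c y))\<^sup>2)"
    using row m by (intro mult_left_mono sum_mono mult_right_mono) auto
  also have "\<dots> = m\<^sup>2 * (\<Sum>y\<in>X. (cmod (c y))\<^sup>2)"
    by (simp add: sum_distrib_left power2_eq_square mult_ac)
  finally have "sqrt (\<Sum>x\<in>X. (cmod (\<Sum>y\<in>X. complex_of_real (E x y) * c y))\<^sup>2) \<le> sqrt (m\<^sup>2 * (\<Sum>y\<in>X. (cmod (c y))\<^sup>2))"
    by (rule real_sqrt_le_mono)
  then show ?thesis
    using m by (simp add: L2_set_def real_sqrt_mult)
qed

text \<open>Coordinates \<open>c\<close> of the projection solve \<open>(I + E) c = g\<close>, where \<open>E\<close> is the off-diagonal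
  part of the Gram matrix; the two estimates are the Neumann bounds for \<open>(I + E)\<^sup>-\<^sup>1\<close>.\<close>

lemma orth_proj_coordinates:
  fixes e :: "'a \<Rightarrow> L2_sphere" and E :: "'a \<Rightarrow> 'a \<Rightarrow> real"
  assumes X: "finite X" and V: "V = complex_L2.span (e ` X)"
    and m: "0 \<le> m" "m < 1" and sym: "\<And>x y. E x y = E y x"
    and row: "\<And>x. x \<in> X \<Longrightarrow> (\<Sum>y\<in>X. \<bar>E x y\<bar>) \<le> m"
    and gram: "\<And>x y. x \<in> X \<Longrightarrow> y \<in> X \<Longrightarrow> cinner (e y) (e x) = complex_of_real ((if x = y then 1 else 0) + E x y)"
  shows "\<bar>inner f (orth_proj V h) - (\<Sum>x\<in>X. Re (cinner h (e x) * cnj (cinner f (e x))))\<bar>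
      \<le> m / (1 - m) * (L2_set (\<lambda>x. cmod (cinner h (e x))) X * L2_set (\<lambda>x. cmod (cinner f (e x))) X)"
    and "\<bar>inner f (orth_proj V h)\<bar>
      \<le> 1 / (1 - m) * (L2_set (\<lambda>x. cmod (cinner h (e x))) X * L2_set (\<lambda>x. cmod (cinner f (e x))) X)"
proof -
  interpret finite_span V
    by standard (use X V in blast)
  \<comment> \<open>Equal vectors e x = e y would force 1 + E x x = E x y, against row sums below 1.
    Injectivity allows coefficients on the image of e to be indexed by X.\<close>
  have inj: "inj_on e X"
  proof (rule inj_onI, rule ccontr)
    fix x y assume xy: "x \<in> X" "y \<in> X" "e x = e y" "x \<noteq> y"
    have E1: "\<bar>E x z\<bar> \<le> m" if "z \<in> X" for z
      using member_le_sum[of z X "\<lambda>y. \<bar>E x y\<bar>"] row[OF xy(1)] that X by auto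
    have row2: "\<bar>E x x\<bar> + \<bar>E x y\<bar> \<le> m"
    proof -
      have "(\<Sum>z\<in>{x, y}. \<bar>E x z\<bar>) \<le> (\<Sum>z\<in>X. \<bar>E x z\<bar>)"
        using X xy by (intro sum_mono2) auto
      then show ?thesis using row[OF xy(1)] xy by simp
    qed
    have "cinner (e x) (e x) = cinner (e y) (e x)" using xy by simp
    then have "complex_of_real (1 + E x x) = complex_of_real (E x y)"
      using gram[OF xy(1) xy(1)] gram[OF xy(1) xy(2)] xy by simp
    then have "1 + E x x = E x y" by (simp only: of_real_eq_iff)
    then show False using row2 m by linarith
  qed
  have "orth_proj V h \<in> complex_L2.span (e ` X)" using orth_proj_in V by simp
  then obtain a where a: "orth_proj V h = (\<Sum>v\<in>e ` X. scaleC (a v) v)"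
    using X by (auto simp: complex_L2.span_finite)
  define c where "c x = a (e x)" for x
  have Ph: "orth_proj V h = (\<Sum>x\<in>X. scaleC (c x) (e x))"
    unfolding a c_def using inj by (simp add: sum.reindex)
  define g where "g x = cinner h (e x)" for x
  define k where "k x = cinner f (e x)" for x
  define Ec where "Ec x = (\<Sum>y\<in>X. complex_of_real (E x y) * c y)" for x
  have eV: "e x \<in> V" if "x \<in> X" for x
    using that V by (auto intro: complex_L2.span_base)
  have geq: "g x = c x + Ec x" if x: "x \<in> X" for x
  proof -
    have "g x = cinner (orth_proj V h) (e x)"
      unfolding g_def using cinner_orth_proj[OF eV[OF x]] by simp
    also have "\<dots> = (\<Sum>y\<in>X. c y * complex_of_real ((if x = y then 1 else 0) + E x y))"
      unfolding Ph cinner_sum_left cinner_scaleC_left using gram[OF x] by (intro sum.cong) auto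
    also have "\<dots> = (\<Sum>y\<in>X. (if x = y then c y else 0) + complex_of_real (E x y) * c y)"
      by (intro sum.cong) (auto simp: algebra_simps)
    also have "\<dots> = c x + Ec x"
      using x X by (simp add: sum.distrib Ec_def)
    finally show ?thesis .
  qed
  let ?c = "L2_set (\<lambda>x. cmod (c x)) X" and ?g = "L2_set (\<lambda>x. cmod (g x)) X" and ?k = "L2_set (\<lambda>x. cmod (k x)) X"
    and ?E = "L2_set (\<lambda>x. cmod (Ec x)) X"
  have E: "?E \<le> m * ?c"
    unfolding Ec_def by (rule schur_row_sum_bound[OF X m(1) sym row])
  \<comment> \<open>The coordinates bound themselves: |c| <= |g| + |E c| <= |g| + m |c|, and the
    last term is absorbed because m < 1.\<close>
  have "?c \<le> L2_set (\<lambda>x. cmod (g x) + cmod (Ec x)) X"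
  proof (rule L2_set_mono)
    show "cmod (c x) \<le> cmod (g x) + cmod (Ec x)" if "x \<in> X" for x
      using norm_triangle_ineq4[of "g x" "Ec x"] geq[OF that] by simp
  qed auto
  also have "\<dots> \<le> ?g + ?E" by (rule L2_set_triangle_ineq)
  finally have "(1 - m) * ?c \<le> ?g" using E by (simp add: algebra_simps)
  then have c: "?c \<le> ?g / (1 - m)" using m by (simp add: pos_le_divide_eq mult.commute)
  have val: "inner f (orth_proj V h) = (\<Sum>x\<in>X. Re (c x * cnj (k x)))"
  proof -
    have "inner f (orth_proj V h) = Re (cinner (orth_proj V h) f)"
      by (simp add: Re_cinner inner_commute)
    also have "cinner (orth_proj V h) f = (\<Sum>x\<in>X. c x * cnj (k x))"
      unfolding Ph cinner_sum_left cinner_scaleC_left k_def by (simp only: cinner_commute[symmetric])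
    finally show ?thesis by (simp add: sum_Re)
  qed
  have bd: "\<bar>\<Sum>x\<in>X. Re (u x * cnj (k x))\<bar> \<le> L2_set (\<lambda>x. cmod (u x)) X * ?k" for u
  proof -
    have "\<bar>\<Sum>x\<in>X. Re (u x * cnj (k x))\<bar> \<le> (\<Sum>x\<in>X. \<bar>Re (u x * cnj (k x))\<bar>)"
      by (rule sum_abs)
    also have "\<dots> \<le> (\<Sum>x\<in>X. \<bar>cmod (u x)\<bar> * \<bar>cmod (k x)\<bar>)"
    proof (rule sum_mono)
      fix x show "\<bar>Re (u x * cnj (k x))\<bar> \<le> \<bar>cmod (u x)\<bar> * \<bar>cmod (k x)\<bar>"
        using abs_Re_le_cmod[of "u x * cnj (k x)"] by (simp add: norm_mult)
    qed
    also have "\<dots> \<le> L2_set (\<lambda>x. cmod (u x)) X * ?k" by (rule L2_set_mult_ineq)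
    finally show ?thesis .
  qed
  have k0: "?k \<ge> 0" by simp
  have "inner f (orth_proj V h) - (\<Sum>x\<in>X. Re (g x * cnj (k x))) = - (\<Sum>x\<in>X. Re (Ec x * cnj (k x)))"
    unfolding val using geq by (simp add: sum_subtractf[symmetric] sum_negf[symmetric] algebra_simps cong: sum.cong)
  then have "\<bar>inner f (orth_proj V h) - (\<Sum>x\<in>X. Re (g x * cnj (k x)))\<bar> = \<bar>\<Sum>x\<in>X. Re (Ec x * cnj (k x))\<bar>"
    by simp
  also have "\<dots> \<le> ?E * ?k" by (rule bd)
  also have "\<dots> \<le> (m * ?c) * ?k" using E k0 by (rule mult_right_mono)
  also have "\<dots> \<le> (m * (?g / (1 - m))) * ?k" using c m k0 by (intro mult_right_mono mult_left_mono)
  finally show "\<bar>inner f (orth_proj V h) - (\<Sum>x\<in>X. Re (cinner h (e x) * cnj (cinner f (e x))))\<bar>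
      \<le> m / (1 - m) * (L2_set (\<lambda>x. cmod (cinner h (e x))) X * L2_set (\<lambda>x. cmod (cinner f (e x))) X)"
    by (simp add: g_def k_def)
  have "\<bar>inner f (orth_proj V h)\<bar> \<le> ?c * ?k" unfolding val by (rule bd)
  also have "\<dots> \<le> ?g / (1 - m) * ?k" using c k0 by (rule mult_right_mono)
  finally show "\<bar>inner f (orth_proj V h)\<bar>
      \<le> 1 / (1 - m) * (L2_set (\<lambda>x. cmod (cinner h (e x))) X * L2_set (\<lambda>x. cmod (cinner f (e x))) X)"
    by (simp add: g_def k_def)
qed

section \<open>Gradient steps under Hessian bounds\<close>

text \<open>Polarization expresses u . A v through the quadratic form at u + v and u - v. For u in
  the direction of A v with the length of v, the left side is |v| |A v|, and the parallelogram law
  evaluates the right side to r |v|^2.\<close>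

lemma symmetric_matrix_norm_le:
  fixes A :: "real^'n^'n"
  assumes sym: "transpose A = A" and r: "\<And>v. \<bar>v \<bullet> (A *v v)\<bar> \<le> r * (norm v)\<^sup>2"
  shows "norm (A *v v) \<le> r * norm v"
proof (cases "A *v v = 0 \<or> v = 0")
  case True
  have "0 \<le> r * (norm v)\<^sup>2" using r[of v] by (meson abs_ge_zero order_trans)
  then have "v = 0 \<or> 0 \<le> r" by (cases "v = 0") (simp_all add: zero_le_mult_iff)
  with True show ?thesis by auto
next
  case False
  define w where "w = A *v v"
  define u where "u = (norm v / norm w) *\<^sub>R w"
  have w0: "norm w > 0" and v0: "norm v > 0" using False by (auto simp: w_def)
  have nu: "norm u = norm v" using w0 by (simp add: u_def)
  have comm: "v \<bullet> (A *v u) = u \<bullet> (A *v v)"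
    using dot_lmul_matrix[of v A u] sym
    by (metis inner_commute transpose_matrix_vector)
  have "4 * (u \<bullet> (A *v v)) = (u + v) \<bullet> (A *v (u + v)) - (u - v) \<bullet> (A *v (u - v))"
    using comm by (simp add: matrix_vector_right_distrib matrix_vector_mult_diff_distrib inner_add_left inner_add_right inner_diff_left inner_diff_right)
  also have "\<dots> \<le> r * (norm (u + v))\<^sup>2 + r * (norm (u - v))\<^sup>2"
    using r[of "u + v"] r[of "u - v"] by linarith
  also have "\<dots> = r * (2 * (norm u)\<^sup>2 + 2 * (norm v)\<^sup>2)"
    by (simp add: power2_norm_eq_inner inner_add_left inner_add_right inner_diff_left inner_diff_right inner_commute algebra_simps)
  also have "\<dots> = 4 * (r * (norm v)\<^sup>2)" by (simp add: nu)
  finally have "u \<bullet> w \<le> r * (norm v)\<^sup>2" by (simp add: w_def)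
  moreover have "u \<bullet> w = norm v * norm w"
    using w0 by (simp add: u_def power2_norm_eq_inner[symmetric] power2_eq_square)
  ultimately have "norm v * norm w \<le> norm v * (r * norm v)"
    by (simp add: power2_eq_square mult_ac)
  then show ?thesis using v0 by (simp add: w_def)
qed

text \<open>The Hessian bounds are required on the closed ball only, so iterates must be kept
  inside. This is what \<open>grad\<close> is for: a minimizer is at most |g x|/m away from the
  center, and that is less than \<rho>.\<close>

locale strongly_convex_ball =
  fixes f :: "real^'n \<Rightarrow> real" and g :: "real^'n \<Rightarrow> real^'n" and H :: "real^'n \<Rightarrow> real^'n^'n"
    and x :: "real^'n" and \<rho> m M :: real
  assumes f: "\<And>z. (f has_derivative (\<lambda>v. g z \<bullet> v)) (at z)"
    and g: "\<And>z. (g has_derivative (\<lambda>v. H z *v v)) (at z)"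
    and sym: "\<And>z. transpose (H z) = H z"
    and lower: "\<And>z v. z \<in> cball x \<rho> \<Longrightarrow> m * (norm v)\<^sup>2 \<le> v \<bullet> (H z *v v)"
    and upper: "\<And>z v. z \<in> cball x \<rho> \<Longrightarrow> v \<bullet> (H z *v v) \<le> M * (norm v)\<^sup>2"
    and m: "0 < m" "m \<le> M" and \<rho>: "0 < \<rho>" and grad: "norm (g x) < m * \<rho>"
begin

definition step :: "real \<Rightarrow> real^'n \<Rightarrow> real^'n" where
  "step h z = z - h *\<^sub>R g z"

lemma rate:
  assumes "0 < h" "h * (m + M) \<le> 2"
  shows "0 \<le> 1 - h * m" "1 - h * m < 1"
proof -
  have "h * m \<le> h * M" using assms m by (intro mult_left_mono) auto
  then show "0 \<le> 1 - h * m" using assms unfolding distrib_left by linarith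
  show "1 - h * m < 1" using assms m by simp
qed

text \<open>The derivative I - h H of a step has its quadratic form between 1 - h M and 1 - h m. The
  condition h (m + M) <= 2 says 1 - h M >= -(1 - h m), so 1 - h m bounds it in absolute value;
  convexity of the ball turns this into a Lipschitz bound.\<close>

lemma step_contraction:
  assumes h: "0 < h" "h * (m + M) \<le> 2" and yz: "y \<in> cball x \<rho>" "z \<in> cball x \<rho>"
  shows "norm (step h y - step h z) \<le> (1 - h * m) * norm (y - z)"
proof (rule differentiable_bound[where S = "cball x \<rho>" and f' = "\<lambda>z v. v - h *\<^sub>R (H z *v v)"])
  fix z assume z: "z \<in> cball x \<rho>"
  show "(step h has_derivative (\<lambda>v. v - h *\<^sub>R (H z *v v))) (at z within cball x \<rho>)"
    unfolding step_def[abs_def]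
    by (intro derivative_intros has_derivative_at_withinI[OF g])
  define A where "A = mat 1 - h *\<^sub>R H z"
  have Av: "A *v v = v - h *\<^sub>R (H z *v v)" for v
    by (simp add: A_def matrix_vector_mult_diff_rdistrib scaleR_matrix_vector_assoc[symmetric])
  have "transpose A = A"
    using sym[of z] by (auto simp: A_def transpose_def vec_eq_iff mat_def)
  moreover have "\<bar>v \<bullet> (A *v v)\<bar> \<le> (1 - h * m) * (norm v)\<^sup>2" for v
  proof -
    have eq: "v \<bullet> (A *v v) = (norm v)\<^sup>2 - h * (v \<bullet> (H z *v v))"
      by (simp add: Av inner_diff_right power2_norm_eq_inner)
    have "h * (m * (norm v)\<^sup>2) \<le> h * (v \<bullet> (H z *v v))" "h * (v \<bullet> (H z *v v)) \<le> h * (M * (norm v)\<^sup>2)"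
      using lower[OF z] upper[OF z] h by (auto intro!: mult_left_mono)
    moreover have "(h * (m + M)) * (norm v)\<^sup>2 \<le> 2 * (norm v)\<^sup>2"
      using h by (intro mult_right_mono) auto
    ultimately show ?thesis unfolding eq abs_le_iff by (simp add: algebra_simps)
  qed
  ultimately have "norm (A *v v) \<le> (1 - h * m) * norm v" for v
    by (rule symmetric_matrix_norm_le)
  then show "onorm (\<lambda>v. v - h *\<^sub>R (H z *v v)) \<le> 1 - h * m"
    using rate[OF h] by (intro onorm_bound) (simp_all add: Av)
qed (use yz in auto)

text \<open>The center drifts by h |g x| < h m \<rho>, and the contraction shortens the distance to
  the image of the center by a margin of exactly h m \<rho> at radius \<rho>.\<close>

lemma step_cball:
  assumes h: "0 < h" "h * (m + M) \<le> 2" and z: "z \<in> cball x \<rho>"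
  shows "step h z \<in> ball x \<rho>"
proof -
  have xx: "x \<in> cball x \<rho>" using \<rho> by simp
  have "norm (step h z - x) \<le> norm (step h z - step h x) + norm (step h x - x)"
    using norm_triangle_ineq[of "step h z - step h x" "step h x - x"] by simp
  also have "norm (step h z - step h x) \<le> (1 - h * m) * norm (z - x)"
    by (rule step_contraction[OF h z xx])
  also have "(1 - h * m) * norm (z - x) \<le> (1 - h * m) * \<rho>"
    using z rate[OF h] by (intro mult_left_mono) (auto simp: dist_norm norm_minus_commute)
  also have "norm (step h x - x) = h * norm (g x)"
    using h by (simp add: step_def)
  also have "h * norm (g x) < h * (m * \<rho>)" using grad h by simp
  finally have "norm (step h z - x) < \<rho>" by (simp add: algebra_simps)
  then show ?thesis by (simp add: dist_norm norm_minus_commute)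
qed

text \<open>Read off from the contraction: pairing the difference of two steps with y - z and
  applying Cauchy-Schwarz bounds |y - z|^2 - h (g y - g z) . (y - z) by (1 - h m) |y - z|^2.\<close>

lemma gradient_strongly_monotone:
  assumes yz: "y \<in> cball x \<rho>" "z \<in> cball x \<rho>"
  shows "m * (norm (y - z))\<^sup>2 \<le> (g y - g z) \<bullet> (y - z)"
proof -
  define h where "h = 2 / (m + M)"
  have "m + M > 0" using m by linarith
  then have h: "0 < h" "h * (m + M) \<le> 2" by (simp_all add: h_def del: distrib_left_numeral)
  have "(step h y - step h z) \<bullet> (y - z) \<le> norm (step h y - step h z) * norm (y - z)"
    by (rule norm_cauchy_schwarz)
  also have "\<dots> \<le> (1 - h * m) * norm (y - z) * norm (y - z)"
    using step_contraction[OF h yz] by (intro mult_right_mono) auto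
  finally have "(step h y - step h z) \<bullet> (y - z) \<le> (1 - h * m) * (norm (y - z))\<^sup>2"
    by (simp add: power2_eq_square mult.assoc)
  moreover have "(step h y - step h z) \<bullet> (y - z) = (norm (y - z))\<^sup>2 - h * ((g y - g z) \<bullet> (y - z))"
    unfolding power2_norm_eq_inner by (simp add: step_def inner_diff_left algebra_simps)
  ultimately have "h * (m * (norm (y - z))\<^sup>2) \<le> h * ((g y - g z) \<bullet> (y - z))"
    by (simp add: algebra_simps)
  then show ?thesis using h by simp
qed

text \<open>Zeros of g are the fixed points of a step with h > 0, so Banach's theorem on the
  complete closed ball provides one; \<open>step_cball\<close> moves it to the open ball.\<close>

lemma critical_point_exists:
  obtains z where "z \<in> ball x \<rho>" "g z = 0"
proof -
  define h where "h = 2 / (m + M)"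
  have "m + M > 0" using m by linarith
  then have h: "0 < h" "h * (m + M) \<le> 2" by (simp_all add: h_def del: distrib_left_numeral)
  have "\<exists>!z\<in>cball x \<rho>. step h z = z"
  proof (rule Banach_fix[where c = "1 - h * m"])
    show "complete (cball x \<rho>)" by (simp add: complete_eq_closed)
    show "step h ` cball x \<rho> \<subseteq> cball x \<rho>"
      using step_cball[OF h] ball_subset_cball by blast
    show "dist (step h y) (step h z) \<le> (1 - h * m) * dist y z" if "y \<in> cball x \<rho>" "z \<in> cball x \<rho>" for y z
      using step_contraction[OF h that] by (simp add: dist_norm)
  qed (use \<rho> rate[OF h] in auto)
  then obtain z where z: "z \<in> cball x \<rho>" "step h z = z" by blast
  then have "z \<in> ball x \<rho>" using step_cball[OF h, of z] by simp
  moreover have "g z = 0" using z(2) h by (simp add: step_def)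
  ultimately show ?thesis by (rule that)
qed

lemma critical_point_unique:
  assumes "y \<in> cball x \<rho>" "z \<in> cball x \<rho>" "g y = 0" "g z = 0"
  shows "y = z"
  using gradient_strongly_monotone[OF assms(1,2)] assms(3,4) m by (simp add: mult_le_0_iff)

lemma critical_point_dist:
  assumes "z \<in> cball x \<rho>" "g z = 0"
  shows "norm (z - x) \<le> norm (g x) / m"
proof (cases "z = x")
  case False
  have "m * (norm (x - z))\<^sup>2 \<le> (g x - g z) \<bullet> (x - z)"
    using assms \<rho> by (intro gradient_strongly_monotone) auto
  also have "\<dots> \<le> norm (g x) * norm (x - z)" using assms norm_cauchy_schwarz by simp
  finally have "m * norm (x - z) \<le> norm (g x)" using False by (simp add: power2_eq_square)
  then show ?thesis using m by (simp add: pos_le_divide_eq mult.commute norm_minus_commute)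
qed (use m in simp)

text \<open>By the mean value theorem on the segment from z to y, the difference of values is a
  directional derivative at an interior point, which strong monotonicity against the zero of g at z
  makes positive.\<close>

lemma critical_point_less:
  assumes z: "z \<in> cball x \<rho>" "g z = 0" and y: "y \<in> cball x \<rho>" "y \<noteq> z"
  shows "f z < f y"
proof -
  define p where "p t = z + t *\<^sub>R (y - z)" for t :: real
  have pin: "p t \<in> cball x \<rho>" if "0 \<le> t" "t \<le> 1" for t
  proof -
    have "(1 - t) *\<^sub>R z + t *\<^sub>R y \<in> cball x \<rho>"
      by (rule convexD[OF convex_cball z(1) y(1)]) (use that in auto)
    moreover have "(1 - t) *\<^sub>R z + t *\<^sub>R y = p t" by (simp add: p_def algebra_simps)
    ultimately show ?thesis by simp
  qed
  have d: "((\<lambda>t. f (p t)) has_real_derivative g (p t) \<bullet> (y - z)) (at t)" for t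
  proof -
    have "(p has_derivative (\<lambda>s. s *\<^sub>R (y - z))) (at t)"
      unfolding p_def[abs_def] by (auto intro!: derivative_eq_intros)
    from has_derivative_compose[OF this f]
    show ?thesis unfolding has_field_derivative_def
      by (rule has_derivative_eq_rhs) (auto simp: fun_eq_iff)
  qed
  obtain t where t: "0 < t" "t < 1" "f (p 1) - f (p 0) = (1 - 0) * (g (p t) \<bullet> (y - z))"
    using MVT2[of 0 1 "\<lambda>t. f (p t)" "\<lambda>t. g (p t) \<bullet> (y - z)"] d by auto
  have "m * (norm (p t - z))\<^sup>2 \<le> (g (p t) - g z) \<bullet> (p t - z)"
    using t pin z by (intro gradient_strongly_monotone) auto
  moreover have "p t - z = t *\<^sub>R (y - z)" by (simp add: p_def)
  moreover have "0 < m * (norm (t *\<^sub>R (y - z)))\<^sup>2" using m t y by simp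
  ultimately have "0 < t * (g (p t) \<bullet> (y - z))" using z by simp
  then have "0 < g (p t) \<bullet> (y - z)" using t by (simp add: zero_less_mult_iff)
  then show ?thesis using t by (simp add: p_def)
qed

lemma step_iterates:
  assumes h: "0 < h" "h * (m + M) \<le> 2" and z: "z \<in> cball x \<rho>" "g z = 0" and y: "y \<in> cball x \<rho>"
  shows "norm ((step h ^^ n) y - z) \<le> (1 - h * m) ^ n * norm (y - z)"
proof -
  have fixed: "step h z = z" using z by (simp add: step_def)
  have "(step h ^^ n) y \<in> cball x \<rho> \<and> norm ((step h ^^ n) y - z) \<le> (1 - h * m) ^ n * norm (y - z)"
  proof (induction n)
    case 0
    then show ?case using y by simp
  next
    case (Suc n)
    let ?y = "(step h ^^ n) y"
    have "norm (step h ?y - step h z) \<le> (1 - h * m) * norm (?y - z)"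
      using Suc z by (intro step_contraction[OF h]) auto
    also have "\<dots> \<le> (1 - h * m) * ((1 - h * m) ^ n * norm (y - z))"
      using Suc rate[OF h] by (intro mult_left_mono) auto
    finally show ?case using step_cball[OF h, of ?y] Suc fixed by (simp add: mult.assoc less_imp_le)
  qed
  then show ?thesis ..
qed

end

section \<open>Derivatives of the MUSIC function\<close>

lemma linear_expand:
  fixes D :: "real^'n \<Rightarrow> real"
  assumes "linear D"
  shows "D v = (\<Sum>i\<in>UNIV. v $ i * D (axis i 1))"
proof -
  have "D v = D (\<Sum>i\<in>UNIV. v $ i *\<^sub>R axis i 1)"
    by (simp add: basis_expansion flip: scalar_mult_eq_scaleR)
  then show ?thesis using assms by (simp add: linear_sum linear_scale)
qed

context finite_span
begin

abbreviation Q :: "L2_sphere \<Rightarrow> L2_sphere" where "Q f \<equiv> f - P f"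

lemma bounded_linear_Q: "bounded_linear Q"
  by (intro bounded_linear_sub bounded_linear_ident bounded_linear_orth_proj)

lemma inner_Q_commute: "inner (Q f) h = inner f (Q h)"
  by (simp add: inner_diff_left inner_diff_right inner_orth_proj_commute)

lemma music_eq: "music V \<kappa> z = inner (plane_wave \<kappa> z) (Q (plane_wave \<kappa> z))"
proof -
  let ?f = "plane_wave \<kappa> z"
  have "inner (Q ?f) (P ?f) = 0"
    using orth_proj_orthogonal[OF orth_proj_in, of ?f ?f] by (simp add: Re_cinner[symmetric])
  then show ?thesis
    unfolding music_def power2_norm_eq_inner by (simp add: inner_diff_right inner_commute)
qed

lemma music_eq': "music V \<kappa> z = 1 - inner (plane_wave \<kappa> z) (P (plane_wave \<kappa> z))"
  unfolding music_eq by (simp add: inner_diff_right power2_norm_eq_inner[symmetric])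

text \<open>Q is self-adjoint, so the two terms of the product rule coincide; hence the factor
  2.\<close>

definition music_deriv :: "real \<Rightarrow> real^3 \<Rightarrow> real^3 \<Rightarrow> real" where
  "music_deriv \<kappa> z v = 2 * inner (dwave \<kappa> v z) (Q (plane_wave \<kappa> z))"

text \<open>The second derivative polarized in v and w: axis vectors give the entries of the
  Hessian, and v = w gives its quadratic form.\<close>

definition music_form :: "real \<Rightarrow> real^3 \<Rightarrow> real^3 \<Rightarrow> real^3 \<Rightarrow> real" where
  "music_form \<kappa> z v w = 2 * (inner (ddwave \<kappa> v w z) (Q (plane_wave \<kappa> z)) + inner (dwave \<kappa> v z) (Q (dwave \<kappa> w z)))"

lemma has_derivative_plane_wave: "(plane_wave \<kappa> has_derivative (\<lambda>h. dwave \<kappa> h z)) (at z)"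
  using has_derivative_wave[of "\<lambda>\<omega>. 1" \<kappa> z UNIV] unfolding plane_wave_eq_wave by simp

lemma ddwave_commute: "ddwave \<kappa> v w z = ddwave \<kappa> w v z"
  by (simp add: mult.commute)

lemma has_derivative_Q_comp:
  assumes "(F has_derivative F') (at z)"
  shows "((\<lambda>z. Q (F z)) has_derivative (\<lambda>h. Q (F' h))) (at z)"
  by (rule bounded_linear.has_derivative[OF bounded_linear_Q assms])

lemma music_has_derivative: "(music V \<kappa> has_derivative music_deriv \<kappa> z) (at z)"
proof -
  have "((\<lambda>z. inner (plane_wave \<kappa> z) (Q (plane_wave \<kappa> z))) has_derivative
     (\<lambda>h. inner (plane_wave \<kappa> z) (Q (dwave \<kappa> h z)) + inner (dwave \<kappa> h z) (Q (plane_wave \<kappa> z)))) (at z)"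
    by (intro has_derivative_inner has_derivative_plane_wave has_derivative_Q_comp)
  then show ?thesis
    unfolding music_eq[abs_def]
  proof (rule has_derivative_eq_rhs)
    have "inner (plane_wave \<kappa> z) (Q (dwave \<kappa> h z)) = inner (dwave \<kappa> h z) (Q (plane_wave \<kappa> z))" for h
      using inner_Q_commute[of "plane_wave \<kappa> z" "dwave \<kappa> h z"] by (simp only: inner_commute)
    then show "(\<lambda>h. inner (plane_wave \<kappa> z) (Q (dwave \<kappa> h z)) + inner (dwave \<kappa> h z) (Q (plane_wave \<kappa> z))) = music_deriv \<kappa> z"
      by (simp only: fun_eq_iff music_deriv_def) simp
  qed
qed

lemma music_deriv_has_derivative:
  "((\<lambda>z. music_deriv \<kappa> z v) has_derivative music_form \<kappa> z v) (at z)"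
proof -
  have "((\<lambda>z. inner (dwave \<kappa> v z) (Q (plane_wave \<kappa> z))) has_derivative
     (\<lambda>h. inner (dwave \<kappa> v z) (Q (dwave \<kappa> h z)) + inner (ddwave \<kappa> v h z) (Q (plane_wave \<kappa> z)))) (at z)"
    by (intro has_derivative_inner has_derivative_plane_wave has_derivative_Q_comp has_derivative_wave continuous_on_dir)
  then have "((\<lambda>z. 2 * inner (dwave \<kappa> v z) (Q (plane_wave \<kappa> z))) has_derivative
     (\<lambda>h. 2 * (inner (dwave \<kappa> v z) (Q (dwave \<kappa> h z)) + inner (ddwave \<kappa> v h z) (Q (plane_wave \<kappa> z))))) (at z)"
    by (rule has_derivative_mult_right)
  then show ?thesis
    unfolding music_deriv_def music_form_def by (simp add: add.commute)
qed

lemma music_form_commute: "music_form \<kappa> z v w = music_form \<kappa> z w v"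
proof -
  have "inner (dwave \<kappa> v z) (Q (dwave \<kappa> w z)) = inner (dwave \<kappa> w z) (Q (dwave \<kappa> v z))"
    using inner_Q_commute[of "dwave \<kappa> v z" "dwave \<kappa> w z"] by (simp only: inner_commute)
  then show ?thesis by (simp only: music_form_def ddwave_commute[of \<kappa> v w])
qed

lemma linear_music_deriv: "linear (music_deriv \<kappa> z)"
  using has_derivative_bounded_linear[OF music_has_derivative] by (rule bounded_linear.linear)

lemma linear_music_form: "linear (music_form \<kappa> z v)"
  using has_derivative_bounded_linear[OF music_deriv_has_derivative] by (rule bounded_linear.linear)

lemma gradient_music_nth: "gradient (music V \<kappa>) z $ i = music_deriv \<kappa> z (axis i 1)"
  by (simp add: gradient_def frechet_derivative_at[OF music_has_derivative, symmetric])

lemma gradient_music_inner: "gradient (music V \<kappa>) z \<bullet> v = music_deriv \<kappa> z v"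
  by (subst linear_expand[OF linear_music_deriv]) (simp add: inner_vec_def gradient_music_nth mult.commute)

lemma music_has_gradient: "(music V \<kappa> has_derivative (\<lambda>v. gradient (music V \<kappa>) z \<bullet> v)) (at z)"
  unfolding gradient_music_inner using music_has_derivative by simp

lemma gradient_music_has_derivative:
  "(gradient (music V \<kappa>) has_derivative (\<lambda>h. \<chi> i. music_form \<kappa> z (axis i 1) h)) (at z)"
proof -
  have "\<forall>b\<in>Basis. ((\<lambda>z. gradient (music V \<kappa>) z \<bullet> b) has_derivative (\<lambda>h. (\<chi> i. music_form \<kappa> z (axis i 1) h) \<bullet> b)) (at z)"
  proof
    fix b :: "real^3" assume "b \<in> Basis"
    then obtain i where b: "b = axis i 1" by (auto simp: Basis_vec_def)
    show "((\<lambda>z. gradient (music V \<kappa>) z \<bullet> b) has_derivative (\<lambda>h. (\<chi> i. music_form \<kappa> z (axis i 1) h) \<bullet> b)) (at z)"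
      using music_deriv_has_derivative[of \<kappa> "axis i 1" z] unfolding gradient_music_inner by (simp add: b inner_axis)
  qed
  then show ?thesis
    using has_derivative_componentwise_within[of "gradient (music V \<kappa>)" _ z UNIV] by simp
qed

lemma hessian_music: "hessian (music V \<kappa>) z = (\<chi> i j. music_form \<kappa> z (axis i 1) (axis j 1))"
  by (simp add: hessian_def frechet_derivative_at[OF gradient_music_has_derivative, symmetric] matrix_def)

lemma hessian_music_mult: "hessian (music V \<kappa>) z *v v = (\<chi> i. music_form \<kappa> z (axis i 1) v)"
  by (simp add: hessian_music matrix_vector_mult_def vec_eq_iff)
     (simp add: linear_expand[OF linear_music_form, of _ _ _ v] mult.commute)

lemma gradient_music_has_hessian:
  "(gradient (music V \<kappa>) has_derivative (\<lambda>v. hessian (music V \<kappa>) z *v v)) (at z)"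
  unfolding hessian_music_mult by (rule gradient_music_has_derivative)

lemma transpose_hessian_music: "transpose (hessian (music V \<kappa>) z) = hessian (music V \<kappa>) z"
  unfolding hessian_music transpose_def by (simp add: vec_eq_iff music_form_commute)

lemma hessian_music_form: "v \<bullet> (hessian (music V \<kappa>) z *v v) = music_form \<kappa> z v v"
proof -
  have "v \<bullet> (hessian (music V \<kappa>) z *v v) = (\<Sum>i\<in>UNIV. v $ i * music_form \<kappa> z v (axis i 1))"
    by (simp add: hessian_music_mult inner_vec_def music_form_commute[of \<kappa> z v])
  then show ?thesis by (simp add: linear_expand[OF linear_music_form, of _ _ v v])
qed

lemma twice_differentiable_music: "twice_differentiable_at (music V \<kappa>) z"
  unfolding twice_differentiable_at_def
proof
  show "\<forall>\<^sub>F y in nhds z. music V \<kappa> differentiable at y"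
    by (rule always_eventually) (blast intro: differentiableI music_has_derivative)
  show "gradient (music V \<kappa>) differentiable at z"
    by (rule differentiableI) (rule gradient_music_has_derivative)
qed

lemma critical_point_music: "critical_point (music V \<kappa>) z \<longleftrightarrow> gradient (music V \<kappa>) z = 0"
  unfolding critical_point_def using differentiableI[OF music_has_derivative] by blast

lemma music_form_scale: "music_form \<kappa> z (r *\<^sub>R v) (r *\<^sub>R v) = r\<^sup>2 * music_form \<kappa> z v v"
  using linear_scale[OF linear_music_form, of \<kappa> z "r *\<^sub>R v" r v] linear_scale[OF linear_music_form, of \<kappa> z v r v]
  by (simp add: music_form_commute[of \<kappa> z "r *\<^sub>R v" v] power2_eq_square)

text \<open>The gradient is paired with itself: its squared norm is the derivative in its own
  direction, and \<open>norm_dwave\<close> supplies \<kappa>/sqrt 3. Keeping the residual as a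
  factor makes the gradient of order \<epsilon> at the sources.\<close>

lemma norm_gradient_music_le:
  assumes "\<kappa> > 0"
  shows "norm (gradient (music V \<kappa>) z) \<le> 2 * \<kappa> / sqrt 3 * norm (Q (plane_wave \<kappa> z))"
proof -
  let ?g = "gradient (music V \<kappa>) z"
  have "norm ?g * norm ?g = music_deriv \<kappa> z ?g"
    by (simp add: gradient_music_inner[symmetric] power2_norm_eq_inner[symmetric] power2_eq_square)
  also have "\<dots> \<le> 2 * (norm (dwave \<kappa> ?g z) * norm (Q (plane_wave \<kappa> z)))"
    unfolding music_deriv_def by (intro mult_left_mono norm_cauchy_schwarz) auto
  also have "\<dots> = norm ?g * (2 * \<kappa> / sqrt 3 * norm (Q (plane_wave \<kappa> z)))"
    using assms by (simp add: norm_dwave)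
  finally have le: "norm ?g * norm ?g \<le> norm ?g * (2 * \<kappa> / sqrt 3 * norm (Q (plane_wave \<kappa> z)))" .
  show ?thesis
  proof (cases "?g = 0")
    case False
    then show ?thesis using le by (subst (asm) mult_le_cancel_left_pos) auto
  qed (use assms in simp)
qed

text \<open>The residual of a unit vector is at most 1, so the gradient bound is global. Its
  reciprocal is the factor sqrt 3/(2 \<kappa>) in the mesh condition.\<close>

lemma music_lipschitz:
  assumes "\<kappa> > 0"
  shows "\<bar>music V \<kappa> y - music V \<kappa> z\<bar> \<le> 2 * \<kappa> / sqrt 3 * norm (y - z)"
proof -
  have "norm (music V \<kappa> y - music V \<kappa> z) \<le> 2 * \<kappa> / sqrt 3 * norm (y - z)"
  proof (rule differentiable_bound[where S = UNIV and f' = "\<lambda>z v. gradient (music V \<kappa>) z \<bullet> v"])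
    fix z
    have "norm (gradient (music V \<kappa>) z) \<le> 2 * \<kappa> / sqrt 3 * 1"
      using norm_orth_proj_residual_le[of "plane_wave \<kappa> z"] assms
      by (intro order_trans[OF norm_gradient_music_le[OF assms]] mult_left_mono) auto
    then have "\<bar>gradient (music V \<kappa>) z \<bullet> v\<bar> \<le> 2 * \<kappa> / sqrt 3 * norm v" for v
      by (intro order_trans[OF Cauchy_Schwarz_ineq2] mult_right_mono) auto
    then show "onorm (\<lambda>v. gradient (music V \<kappa>) z \<bullet> v) \<le> 2 * \<kappa> / sqrt 3"
      using assms by (intro onorm_bound) auto
  qed (auto intro: music_has_gradient)
  then show ?thesis by simp
qed

end

section \<open>The signal space\<close>

lemma L2_set_le_sqrt: "(\<Sum>x\<in>X. (f x)\<^sup>2) \<le> B \<Longrightarrow> L2_set f X \<le> sqrt B"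
  unfolding L2_set_def by (rule real_sqrt_le_mono)

lemma L2_set_abs: "L2_set (\<lambda>x. \<bar>f x\<bar>) X = L2_set f X"
  by (simp add: L2_set_def)

locale source_configuration =
  fixes \<kappa> \<rho> :: real and X :: "(real^3) set"
  assumes kappa: "\<kappa> > 0" and rho: "\<rho> > 0" and X: "finite X" "card X \<ge> 2"
    and rho_le: "\<rho> \<le> min_separation X / 2"
    and mu_less_1: "mu_const (card X) \<kappa> (min_separation X) < 1"
begin

abbreviation "\<delta> \<equiv> min_separation X"
abbreviation "\<mu> \<equiv> mu_const (card X) \<kappa> \<delta>"
abbreviation "\<nu> \<equiv> nu_const (card X) \<kappa> \<delta>"
abbreviation "\<gamma> \<equiv> \<rho> * \<kappa>"

sublocale signal: finite_span "signal_space \<kappa> X"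
  by (rule finite_span_signal_space[OF X(1)])

lemma delta_pos: "\<delta> > 0"
  by (rule min_separation_pos[OF X])

lemma delta_le: "x \<in> X \<Longrightarrow> y \<in> X \<Longrightarrow> x \<noteq> y \<Longrightarrow> \<delta> \<le> dist x y"
  by (rule min_separation_le[OF X(1)])

lemma mu_nonneg: "0 \<le> \<mu>"
  using kappa delta_pos by (simp add: mu_const_def)

lemma nu_nonneg: "0 \<le> \<nu>"
  by (simp add: nu_const_def)

lemma norm_scaled_diff: "norm (\<kappa> *\<^sub>R (z - y)) = \<kappa> * dist z y"
  using kappa by (simp add: dist_norm)

lemma gram_row_sum:
  assumes x: "x \<in> X"
  shows "(\<Sum>y\<in>X - {x}. \<bar>kern0 (\<kappa> *\<^sub>R (x - y))\<bar>) \<le> \<mu>"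
proof -
  have "(\<Sum>y\<in>X - {x}. \<bar>kern0 (\<kappa> *\<^sub>R (x - y))\<bar>) \<le> (\<Sum>y\<in>X - {x}. 1 / \<kappa> * (1 / dist x y))"
  proof (rule sum_mono)
    fix y assume "y \<in> X - {x}"
    then have "\<kappa> *\<^sub>R (x - y) \<noteq> 0" using kappa by auto
    from kern0_far[OF this] show "\<bar>kern0 (\<kappa> *\<^sub>R (x - y))\<bar> \<le> 1 / \<kappa> * (1 / dist x y)"
      unfolding norm_scaled_diff by simp
  qed
  also have "\<dots> = 1 / \<kappa> * (\<Sum>y\<in>X - {x}. 1 / dist x y)"
    by (simp only: sum_distrib_left)
  also have "\<dots> \<le> 1 / \<kappa> * (9 / 2 * (real (card X) powr (2/3) / \<delta>))"
    using kappa x delta_pos delta_le X by (intro mult_left_mono sum_inverse_dist_le) auto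
  also have "\<dots> = \<mu>" by (simp add: mu_const_def)
  finally show ?thesis .
qed

lemma far_sum:
  assumes z: "\<And>y. y \<in> X - {x} \<Longrightarrow> \<delta> / 2 \<le> dist z y"
  shows "c_nu\<^sup>2 * (\<Sum>y\<in>X - {x}. 1 / (norm (\<kappa> *\<^sub>R (z - y)))\<^sup>2) \<le> \<nu>"
proof -
  have "(\<Sum>y\<in>X - {x}. 1 / (norm (\<kappa> *\<^sub>R (z - y)))\<^sup>2) = 1 / \<kappa>\<^sup>2 * (\<Sum>y\<in>X - {x}. 1 / (dist z y)\<^sup>2)"
    unfolding norm_scaled_diff by (simp add: sum_distrib_left power_mult_distrib)
  also have "\<dots> \<le> 1 / \<kappa>\<^sup>2 * (48 * (real (card X) powr (1/3) / \<delta>\<^sup>2))"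
    using delta_pos delta_le X z by (intro mult_left_mono sum_inverse_dist_sq_le) auto
  finally have "c_nu\<^sup>2 * (\<Sum>y\<in>X - {x}. 1 / (norm (\<kappa> *\<^sub>R (z - y)))\<^sup>2) \<le>
     c_nu\<^sup>2 * (1 / \<kappa>\<^sup>2 * (48 * (real (card X) powr (1/3) / \<delta>\<^sup>2)))"
    by (rule mult_left_mono) simp
  also have "\<dots> = \<nu>"
    using X by (subst nu_const_eq) auto
  finally show ?thesis .
qed

text \<open>All kernels are dominated by multiples of one majorant, c_nu^2/|w|^2 for squares and
  products: the decay constants are 1, \<open>c_nu\<close> and 2, and \<open>c_nu\<close> is at
  least 1.\<close>

lemma far_kern_sums:
  assumes z: "\<And>y. y \<in> X - {x} \<Longrightarrow> \<delta> / 2 \<le> dist z y" and v: "norm v = 1"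
  defines "w \<equiv> \<lambda>y. \<kappa> *\<^sub>R (z - y)"
  shows "(\<Sum>y\<in>X - {x}. (kern0 (w y))\<^sup>2) \<le> \<nu>" "(\<Sum>y\<in>X - {x}. (kern1 v (w y))\<^sup>2) \<le> \<nu>"
    "(\<Sum>y\<in>X - {x}. (kern2 v (w y))\<^sup>2) \<le> 4 * \<nu>" "(\<Sum>y\<in>X - {x}. \<bar>kern0 (w y) * kern2 v (w y)\<bar>) \<le> 2 * \<nu>"
proof -
  have w0: "w y \<noteq> 0" if "y \<in> X - {x}" for y
    using z[OF that] delta_pos kappa by (auto simp: w_def)
  have c1: "1 \<le> c_nu\<^sup>2" using c_nu_ge_1 by (simp add: one_le_power)
  have S: "(\<Sum>y\<in>X - {x}. c_nu\<^sup>2 * (1 / (norm (w y))\<^sup>2)) \<le> \<nu>"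
    using far_sum[of x z, OF z] by (simp only: w_def sum_distrib_left)
  have le: "1 / (norm (w y))\<^sup>2 \<le> c_nu\<^sup>2 * (1 / (norm (w y))\<^sup>2)" for y
    using mult_right_mono[OF c1, of "1 / (norm (w y))\<^sup>2"] by simp
  have sq: "a\<^sup>2 \<le> b\<^sup>2" if "\<bar>a\<bar> \<le> b" for a b :: real
    using that by (simp add: abs_le_square_iff[symmetric])
  have b0: "(kern0 (w y))\<^sup>2 \<le> c_nu\<^sup>2 * (1 / (norm (w y))\<^sup>2)" if "y \<in> X - {x}" for y
    using sq[OF kern0_far[OF w0[OF that]]] le[of y] by (simp add: power_divide)
  have b1: "(kern1 v (w y))\<^sup>2 \<le> c_nu\<^sup>2 * (1 / (norm (w y))\<^sup>2)" if "y \<in> X - {x}" for y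
    using sq[OF kern1_far[OF w0[OF that] v]] by (simp add: power_divide)
  have b2: "(kern2 v (w y))\<^sup>2 \<le> 4 * (c_nu\<^sup>2 * (1 / (norm (w y))\<^sup>2))" if "y \<in> X - {x}" for y
    using sq[OF kern2_far[OF w0[OF that] v]] le[of y] by (simp add: power_divide)
  have b3: "\<bar>kern0 (w y) * kern2 v (w y)\<bar> \<le> 2 * (c_nu\<^sup>2 * (1 / (norm (w y))\<^sup>2))" if "y \<in> X - {x}" for y
  proof -
    have "\<bar>kern0 (w y) * kern2 v (w y)\<bar> \<le> 1 / norm (w y) * (2 / norm (w y))"
      unfolding abs_mult by (intro mult_mono kern0_far kern2_far w0 that v) auto
    also have "\<dots> = 2 * (1 / (norm (w y))\<^sup>2)" by (simp add: power2_eq_square)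
    finally show ?thesis using le[of y] by linarith
  qed
  show "(\<Sum>y\<in>X - {x}. (kern0 (w y))\<^sup>2) \<le> \<nu>"
    by (rule order_trans[OF sum_mono[OF b0] S])
  show "(\<Sum>y\<in>X - {x}. (kern1 v (w y))\<^sup>2) \<le> \<nu>"
    by (rule order_trans[OF sum_mono[OF b1] S])
  have "(\<Sum>y\<in>X - {x}. (kern2 v (w y))\<^sup>2) \<le> (\<Sum>y\<in>X - {x}. 4 * (c_nu\<^sup>2 * (1 / (norm (w y))\<^sup>2)))"
    by (rule sum_mono[OF b2])
  then show "(\<Sum>y\<in>X - {x}. (kern2 v (w y))\<^sup>2) \<le> 4 * \<nu>"
    using S unfolding sum_distrib_left[symmetric] by linarith
  have "(\<Sum>y\<in>X - {x}. \<bar>kern0 (w y) * kern2 v (w y)\<bar>) \<le> (\<Sum>y\<in>X - {x}. 2 * (c_nu\<^sup>2 * (1 / (norm (w y))\<^sup>2)))"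
    by (rule sum_mono[OF b3])
  then show "(\<Sum>y\<in>X - {x}. \<bar>kern0 (w y) * kern2 v (w y)\<bar>) \<le> 2 * \<nu>"
    using S unfolding sum_distrib_left[symmetric] by linarith
qed

definition gram_off :: "real^3 \<Rightarrow> real^3 \<Rightarrow> real" where
  "gram_off x y = (if x = y then 0 else kern0 (\<kappa> *\<^sub>R (x - y)))"

lemma kern0_minus: "kern0 (- w) = kern0 w"
  by (simp add: kern0_def)

lemma signal_coordinates:
  shows "\<bar>inner f (signal.P h) - (\<Sum>x\<in>X. Re (cinner h (plane_wave \<kappa> x) * cnj (cinner f (plane_wave \<kappa> x))))\<bar>
      \<le> \<mu> / (1 - \<mu>) * (L2_set (\<lambda>x. cmod (cinner h (plane_wave \<kappa> x))) X * L2_set (\<lambda>x. cmod (cinner f (plane_wave \<kappa> x))) X)"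
    and "\<bar>inner f (signal.P h)\<bar>
      \<le> 1 / (1 - \<mu>) * (L2_set (\<lambda>x. cmod (cinner h (plane_wave \<kappa> x))) X * L2_set (\<lambda>x. cmod (cinner f (plane_wave \<kappa> x))) X)"
proof -
  have V: "signal_space \<kappa> X = complex_L2.span (plane_wave \<kappa> ` X)"
    by (rule signal_space_def)
  have sym: "gram_off x y = gram_off y x" for x y
    using kern0_minus[of "\<kappa> *\<^sub>R (x - y)"] by (simp add: gram_off_def flip: scaleR_minus_right)
  have row: "(\<Sum>y\<in>X. \<bar>gram_off x y\<bar>) \<le> \<mu>" if "x \<in> X" for x
  proof -
    have "(\<Sum>y\<in>X. \<bar>gram_off x y\<bar>) = \<bar>gram_off x x\<bar> + (\<Sum>y\<in>X - {x}. \<bar>gram_off x y\<bar>)"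
      by (rule sum.remove[OF X(1) that])
    also have "(\<Sum>y\<in>X - {x}. \<bar>gram_off x y\<bar>) = (\<Sum>y\<in>X - {x}. \<bar>kern0 (\<kappa> *\<^sub>R (x - y))\<bar>)"
      by (rule sum.cong) (auto simp: gram_off_def)
    finally show ?thesis using gram_row_sum[OF that] by (simp add: gram_off_def)
  qed
  have gram: "cinner (plane_wave \<kappa> y) (plane_wave \<kappa> x) = complex_of_real ((if x = y then 1 else 0) + gram_off x y)" for x y
    using sym[of x y] by (auto simp: cinner_plane_wave gram_off_def kern0_def)
  note * = orth_proj_coordinates[where E = gram_off and e = "plane_wave \<kappa>", OF X(1) V mu_nonneg mu_less_1 sym row gram]
  show "\<bar>inner f (signal.P h) - (\<Sum>x\<in>X. Re (cinner h (plane_wave \<kappa> x) * cnj (cinner f (plane_wave \<kappa> x))))\<bar>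
      \<le> \<mu> / (1 - \<mu>) * (L2_set (\<lambda>x. cmod (cinner h (plane_wave \<kappa> x))) X * L2_set (\<lambda>x. cmod (cinner f (plane_wave \<kappa> x))) X)"
    by (rule *(1))
  show "\<bar>inner f (signal.P h)\<bar>
      \<le> 1 / (1 - \<mu>) * (L2_set (\<lambda>x. cmod (cinner h (plane_wave \<kappa> x))) X * L2_set (\<lambda>x. cmod (cinner f (plane_wave \<kappa> x))) X)"
    by (rule *(2))
qed

lemma half_separation_le:
  assumes "x \<in> X" "z \<in> cball x \<rho>" "y \<in> X - {x}"
  shows "\<delta> / 2 \<le> dist z y"
proof -
  have "\<delta> \<le> dist x y" using assms by (intro delta_le) auto
  also have "\<dots> \<le> dist x z + dist z y" by (rule dist_triangle)
  finally show ?thesis using assms rho_le by simp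
qed

lemma signal_form_bound:
  assumes x: "x \<in> X" and z: "z \<in> cball x \<rho>" and v: "norm v = 1"
  shows "\<bar>signal.music_form \<kappa> z v v - 2 / 3 * \<kappa>\<^sup>2\<bar> \<le> C2_const \<gamma> \<mu> \<nu> * \<kappa>\<^sup>2"
proof -
  define w where "w y = \<kappa> *\<^sub>R (z - y)" for y
  define t where "t = norm (w x)"
  let ?\<phi> = "plane_wave \<kappa> z" and ?d = "dwave \<kappa> v z" and ?D = "ddwave \<kappa> v v z"
  have t: "0 \<le> t" "t \<le> \<gamma>"
    using z kappa by (auto simp: t_def w_def dist_norm norm_minus_commute mult.commute)
  have t2: "t\<^sup>2 \<le> \<gamma>\<^sup>2" using t by (intro power_mono)
  note far = far_kern_sums[of x z v, OF half_separation_le[OF x z] v, folded w_def]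
  note split = sum.remove[OF X(1) x]
  let ?k0 = "\<lambda>y. kern0 (w y)" and ?k1 = "\<lambda>y. kern1 v (w y)" and ?k2 = "\<lambda>y. kern2 v (w y)"
  have n0: "\<bar>?k0 x - 1\<bar> \<le> t\<^sup>2 / 6" using kern0_near[of "w x"] by (simp add: t_def)
  \<comment> \<open>|sinc| <= 1, obtained as Cauchy-Schwarz for two unit plane waves.\<close>
  have n0': "\<bar>?k0 x\<bar> \<le> 1"
  proof -
    have "\<bar>kern0 (w x)\<bar> = cmod (cinner ?\<phi> (plane_wave \<kappa> x))" by (simp add: cinner_plane_wave w_def)
    also have "\<dots> = \<bar>inner ?\<phi> (plane_wave \<kappa> x)\<bar>"
      by (simp add: Re_cinner[symmetric] cinner_plane_wave)
    also have "\<dots> \<le> norm ?\<phi> * norm (plane_wave \<kappa> x)" by (rule Cauchy_Schwarz_ineq2)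
    finally show ?thesis by simp
  qed
  have n1: "\<bar>?k1 x\<bar> \<le> t / 3" using kern1_near[of v "w x"] v by (simp add: t_def)
  have n1': "(?k1 x)\<^sup>2 \<le> t\<^sup>2 / 9"
    using power_mono[OF n1, of 2] by (simp add: power_divide)
  have n2: "\<bar>?k2 x + 1 / 3\<bar> \<le> t\<^sup>2 / 10" using kern2_near[of v "w x"] v by (simp add: t_def)
  have n2': "\<bar>?k2 x\<bar> \<le> 1 / 3" using kern2_le[of v "w x"] v by simp
  \<comment> \<open>The product is expanded around its value -1/3 at the source: t^2/18 is the
    \<open>kern0\<close> error t^2/6 times |\<open>kern2\<close>| <= 1/3, and t^2/10 is the
    \<open>kern2\<close> error.\<close>
  have near: "\<bar>?k0 x * ?k2 x + 1 / 3\<bar> \<le> t\<^sup>2 / 18 + t\<^sup>2 / 10"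
  proof -
    have "\<bar>(?k0 x - 1) * ?k2 x\<bar> \<le> t\<^sup>2 / 6 * (1 / 3)"
      unfolding abs_mult using n0 n2' by (intro mult_mono) auto
    moreover have "?k0 x * ?k2 x + 1 / 3 = (?k0 x - 1) * ?k2 x + (?k2 x + 1 / 3)"
      by (simp add: algebra_simps)
    ultimately show ?thesis using n2 by linarith
  qed
  define S0 where "S0 = L2_set ?k0 X"
  define S1 where "S1 = L2_set ?k1 X"
  define S2 where "S2 = L2_set ?k2 X"
  have S0: "S0 \<le> sqrt (1 + \<nu>)"
  proof -
    have "(?k0 x)\<^sup>2 \<le> 1" using n0' by (simp add: abs_square_le_1)
    then show ?thesis unfolding S0_def using far(1) by (intro L2_set_le_sqrt) (simp add: split)
  qed
  have S1: "S1\<^sup>2 \<le> \<gamma>\<^sup>2 / 9 + \<nu>"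
    unfolding S1_def L2_set_def using far(2) n1' t2 by (simp add: sum_nonneg split)
  have S2: "S2 \<le> sqrt ((1 / 3 + \<gamma>\<^sup>2 / 10)\<^sup>2 + 4 * \<nu>)"
  proof -
    have "(?k2 x)\<^sup>2 \<le> (1 / 3 + \<gamma>\<^sup>2 / 10)\<^sup>2"
    proof -
      have "\<bar>?k2 x\<bar> \<le> 1 / 3 + \<gamma>\<^sup>2 / 10" using n2' zero_le_power2[of \<gamma>] by linarith
      from power_mono[OF this, of 2] show ?thesis by simp
    qed
    then show ?thesis unfolding S2_def using far(3) by (intro L2_set_le_sqrt) (simp add: split)
  qed
  have pos: "0 \<le> S0" "0 \<le> S1" "0 \<le> S2" by (auto simp: S0_def S1_def S2_def)
  \<comment> \<open>The off-diagonal Gram terms cost \<mu>/(1 - \<mu>) times a product of l2 norms: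
    S0 S2 for the term with the second derivative, S1^2 for the one with first derivatives.
    \<open>C1_const\<close> is the bound for their sum.\<close>
  have C1: "S0 * S2 + S1\<^sup>2 \<le> C1_const \<gamma> \<nu>"
  proof -
    have "S0 * S2 \<le> sqrt (1 + \<nu>) * sqrt ((1 / 3 + \<gamma>\<^sup>2 / 10)\<^sup>2 + 4 * \<nu>)"
      using S0 S2 pos nu_nonneg by (intro mult_mono) auto
    then show ?thesis using S1 by (simp add: C1_const_def)
  qed
  have L0: "L2_set (\<lambda>x. cmod (cinner ?\<phi> (plane_wave \<kappa> x))) X = S0"
    by (simp add: cinner_plane_wave S0_def w_def L2_set_abs)
  have L1: "L2_set (\<lambda>x. cmod (cinner ?d (plane_wave \<kappa> x))) X = \<kappa> * S1"
    unfolding S1_def w_def cinner_dwave norm_of_real L2_set_abs using kappa by (simp add: L2_set_right_distrib)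
  have L2: "L2_set (\<lambda>x. cmod (cinner ?D (plane_wave \<kappa> x))) X = \<kappa>\<^sup>2 * S2"
    unfolding S2_def w_def cinner_ddwave norm_of_real L2_set_abs by (simp add: L2_set_right_distrib)
  have A1: "\<bar>inner ?D (signal.P ?\<phi>) - \<kappa>\<^sup>2 * (\<Sum>y\<in>X. ?k0 y * ?k2 y)\<bar> \<le> \<mu> / (1 - \<mu>) * (\<kappa>\<^sup>2 * (S0 * S2))"
  proof -
    have "(\<Sum>x\<in>X. Re (cinner ?\<phi> (plane_wave \<kappa> x) * cnj (cinner ?D (plane_wave \<kappa> x)))) = \<kappa>\<^sup>2 * (\<Sum>y\<in>X. ?k0 y * ?k2 y)"
      unfolding cinner_plane_wave cinner_ddwave sum_distrib_left by (rule sum.cong) (auto simp: w_def)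
    then show ?thesis using signal_coordinates(1)[of ?D ?\<phi>] unfolding L0 L2 by (simp only: mult_ac)
  qed
  have A2: "\<bar>inner ?d (signal.P ?d) - \<kappa>\<^sup>2 * (\<Sum>y\<in>X. (?k1 y)\<^sup>2)\<bar> \<le> \<mu> / (1 - \<mu>) * (\<kappa>\<^sup>2 * S1\<^sup>2)"
  proof -
    have "(\<Sum>x\<in>X. Re (cinner ?d (plane_wave \<kappa> x) * cnj (cinner ?d (plane_wave \<kappa> x)))) = \<kappa>\<^sup>2 * (\<Sum>y\<in>X. (?k1 y)\<^sup>2)"
      unfolding cinner_dwave sum_distrib_left by (rule sum.cong) (auto simp: w_def power2_eq_square)
    then show ?thesis using signal_coordinates(1)[of ?d ?d] unfolding L1 by (simp only: power2_eq_square mult_ac)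
  qed
  define R where "R = (\<Sum>y\<in>X. ?k0 y * ?k2 y) + (\<Sum>y\<in>X. (?k1 y)\<^sup>2)"
  \<comment> \<open>4/15 is 1/18 + 1/10 + 1/9, the last summand coming from \<open>kern1\<close> at
    the near source; 3 \<nu> is 2 \<nu> from the products and \<nu> from the squares. Doubling gives
    8/15 and 6 \<nu> in \<open>C2_const\<close>.\<close>
  have R: "\<bar>R + 1 / 3\<bar> \<le> 4 / 15 * \<gamma>\<^sup>2 + 3 * \<nu>"
  proof -
    have s: "\<bar>\<Sum>y\<in>X - {x}. ?k0 y * ?k2 y\<bar> \<le> 2 * \<nu>"
      by (rule order_trans[OF sum_abs far(4)])
    have s1: "0 \<le> (\<Sum>y\<in>X - {x}. (?k1 y)\<^sup>2)" by (rule sum_nonneg) simp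
    have "R + 1 / 3 = (?k0 x * ?k2 x + 1 / 3) + (?k1 x)\<^sup>2 + (\<Sum>y\<in>X - {x}. ?k0 y * ?k2 y) + (\<Sum>y\<in>X - {x}. (?k1 y)\<^sup>2)"
      unfolding R_def split by simp
    then show ?thesis
      using near n1' t2 s s1 far(2) zero_le_power2[of "?k1 x"] by linarith
  qed
  \<comment> \<open>The terms without P are -\<kappa>^2/3 and \<kappa>^2/3 and cancel. The 2/3
    subtracted on the left becomes the shift of R by 1/3, and the other two summands are the Gram
    errors.\<close>
  have form: "signal.music_form \<kappa> z v v - 2 / 3 * \<kappa>\<^sup>2 =
     - 2 * (\<kappa>\<^sup>2 * (R + 1 / 3))
     - 2 * (inner ?D (signal.P ?\<phi>) - \<kappa>\<^sup>2 * (\<Sum>y\<in>X. ?k0 y * ?k2 y))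
     - 2 * (inner ?d (signal.P ?d) - \<kappa>\<^sup>2 * (\<Sum>y\<in>X. (?k1 y)\<^sup>2))"
  proof -
    have "inner ?d ?d = \<kappa>\<^sup>2 / 3"
      using norm_dwave_sq[of \<kappa> v z] v by (simp add: power2_norm_eq_inner)
    then show ?thesis
      using inner_ddwave_plane_wave[of \<kappa> v z] v
      by (simp add: signal.music_form_def inner_diff_right R_def algebra_simps)
  qed
  have "\<bar>\<kappa>\<^sup>2 * (R + 1 / 3)\<bar> \<le> \<kappa>\<^sup>2 * (4 / 15 * \<gamma>\<^sup>2 + 3 * \<nu>)"
    unfolding abs_mult using R by (intro mult_mono) auto
  moreover have "\<mu> / (1 - \<mu>) * (\<kappa>\<^sup>2 * (S0 * S2)) + \<mu> / (1 - \<mu>) * (\<kappa>\<^sup>2 * S1\<^sup>2) \<le> \<mu> / (1 - \<mu>) * (\<kappa>\<^sup>2 * C1_const \<gamma> \<nu>)"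
    unfolding distrib_left[symmetric] using C1 mu_nonneg mu_less_1 by (intro mult_left_mono) auto
  moreover have "C2_const \<gamma> \<mu> \<nu> * \<kappa>\<^sup>2 = 2 * (\<kappa>\<^sup>2 * (4 / 15 * \<gamma>\<^sup>2 + 3 * \<nu>)) + 2 * (\<mu> / (1 - \<mu>) * (\<kappa>\<^sup>2 * C1_const \<gamma> \<nu>))"
    by (simp add: C2_const_def algebra_simps)
  \<comment> \<open>Stated with fresh variables so that linear arithmetic works on atoms instead of
    the sums and projections.\<close>
  moreover have "\<bar>- 2 * A - 2 * B - 2 * C\<bar> \<le> T"
    if "\<bar>A\<bar> \<le> a" "b + c \<le> d" "T = 2 * a + 2 * d" "\<bar>B\<bar> \<le> b" "\<bar>C\<bar> \<le> c" for A B C a b c d T :: real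
    using that by linarith
  ultimately show ?thesis
    unfolding form using A1 A2 by blast
qed

lemma bdd_above_sinc: "bdd_above ((\<lambda>t. (sin t / t)\<^sup>2) ` {\<gamma>..})"
proof (rule bdd_aboveI2)
  fix t assume "t \<in> {\<gamma>..}"
  have "\<bar>sin t / t\<bar> \<le> 1"
    using abs_sin_x_le_abs_x[of t] by (cases "t = 0") (auto simp: abs_divide divide_le_eq)
  then show "(sin t / t)\<^sup>2 \<le> 1" by (simp add: abs_square_le_1)
qed

lemma gamma_pos: "\<gamma> > 0"
  using rho kappa by simp

lemma b_const_le_1: "b_const \<gamma> \<le> 1"
proof -
  have "0 \<le> (sin \<gamma> / \<gamma>)\<^sup>2" by simp
  also have "\<dots> \<le> (SUP t\<in>{\<gamma>..}. (sin t / t)\<^sup>2)" by (intro cSUP_upper bdd_above_sinc) simp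
  finally show ?thesis by (simp add: b_const_def)
qed

lemma A_const_le_1: "A_const \<gamma> \<mu> \<nu> \<le> 1"
  using b_const_le_1 nu_nonneg mu_less_1 by (simp add: A_const_def divide_le_eq)

text \<open>The sources are split at one nearest to z. It is at distance at least \<rho> and
  contributes at most the supremum 1 - b; every other source is at distance at least \<delta>/2 by
  the triangle inequality, so together they contribute \<nu>. The factor 1/(1 - \<mu>) passes from
  these inner products to the squared norm of the projection.\<close>

lemma music_signal_ge:
  assumes z: "\<And>x. x \<in> X \<Longrightarrow> \<rho> \<le> dist x z"
  shows "A_const \<gamma> \<mu> \<nu> \<le> music (signal_space \<kappa> X) \<kappa> z"
proof -
  have "X \<noteq> {}" using X by auto
  then obtain x where x: "x \<in> X" "\<And>y. y \<in> X \<Longrightarrow> dist z x \<le> dist z y"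
    using X(1) ex_is_arg_min_if_finite[of X "dist z"] by (auto simp: is_arg_min_linorder)
  have far: "\<delta> / 2 \<le> dist z y" if "y \<in> X - {x}" for y
  proof -
    have "\<delta> \<le> dist x y" using that x by (intro delta_le) auto
    also have "\<dots> \<le> dist x z + dist z y" by (rule dist_triangle)
    also have "dist x z \<le> dist z y" using x(2)[of y] that by (simp add: dist_commute)
    finally show ?thesis by simp
  qed
  define w where "w y = \<kappa> *\<^sub>R (z - y)" for y
  have t: "\<gamma> \<le> norm (w x)"
    using z[OF x(1)] kappa unfolding w_def norm_scaled_diff by (simp add: dist_commute mult.commute)
  then have wx: "w x \<noteq> 0" using gamma_pos by auto
  have near: "(kern0 (w x))\<^sup>2 \<le> (SUP t\<in>{\<gamma>..}. (sin t / t)\<^sup>2)"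
    unfolding kern0_eq[OF wx] using t by (intro cSUP_upper bdd_above_sinc) simp
  \<comment> \<open>An arbitrary unit vector to serve as the direction in
    \<open>far_kern_sums\<close>.\<close>
  have "norm (axis 1 1 :: real^3) = 1" by simp
  from far_kern_sums(1)[of x z, OF far this] have far2: "(\<Sum>y\<in>X - {x}. (kern0 (w y))\<^sup>2) \<le> \<nu>"
    by (simp add: w_def)
  let ?\<phi> = "plane_wave \<kappa> z"
  have L0: "L2_set (\<lambda>x. cmod (cinner ?\<phi> (plane_wave \<kappa> x))) X = L2_set (\<lambda>y. kern0 (w y)) X"
    by (simp add: cinner_plane_wave w_def L2_set_abs)
  have "inner ?\<phi> (signal.P ?\<phi>) \<le> 1 / (1 - \<mu>) * (L2_set (\<lambda>y. kern0 (w y)) X * L2_set (\<lambda>y. kern0 (w y)) X)"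
    using signal_coordinates(2)[of ?\<phi> ?\<phi>] unfolding L0 by linarith
  also have "L2_set (\<lambda>y. kern0 (w y)) X * L2_set (\<lambda>y. kern0 (w y)) X = (\<Sum>y\<in>X. (kern0 (w y))\<^sup>2)"
    by (simp add: L2_set_def sum_nonneg)
  also have "1 / (1 - \<mu>) * \<dots> \<le> 1 / (1 - \<mu>) * (1 - b_const \<gamma> + \<nu>)"
    using near far2 mu_less_1 by (intro mult_left_mono) (auto simp: sum.remove[OF X(1) x(1)] b_const_def)
  finally have "inner ?\<phi> (signal.P ?\<phi>) \<le> (1 - b_const \<gamma> + \<nu>) / (1 - \<mu>)" by simp
  moreover have "A_const \<gamma> \<mu> \<nu> = 1 - (1 - b_const \<gamma> + \<nu>) / (1 - \<mu>)"
    using mu_less_1 by (simp add: A_const_def field_simps)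
  ultimately show ?thesis by (simp add: signal.music_eq')
qed

lemma plane_wave_in_signal_space: "x \<in> X \<Longrightarrow> signal.P (plane_wave \<kappa> x) = plane_wave \<kappa> x"
  by (rule signal.orth_proj_id) (auto simp: signal_space_def intro: complex_L2.span_base)

end

section \<open>The perturbed subspace\<close>

lemma abs_inner_le_of_norm_le: "\<bar>inner f h\<bar> \<le> e * norm f" if "norm h \<le> e"
  for f h :: "'a::real_inner"
proof -
  have "\<bar>inner f h\<bar> \<le> norm f * norm h" by (rule Cauchy_Schwarz_ineq2)
  also have "\<dots> \<le> norm f * e" using that by (intro mult_left_mono) auto
  finally show ?thesis by (simp add: mult.commute)
qed

lemma loewner_le_mat_iff:
  fixes A :: "real^'n^'n"
  assumes "transpose A = A"
  shows "loewner_le (mat c) A \<longleftrightarrow> (\<forall>v. c * (norm v)\<^sup>2 \<le> v \<bullet> (A *v v))"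
    and "loewner_le A (mat c) \<longleftrightarrow> (\<forall>v. v \<bullet> (A *v v) \<le> c * (norm v)\<^sup>2)"
proof -
  have "mat c *v v = c *\<^sub>R v" for v :: "real^'n"
    by (simp add: vec_eq_iff matrix_vector_mult_def mat_def if_distrib if_distribR cong: if_cong)
  then have "v \<bullet> (mat c *v v) = c * (norm v)\<^sup>2" for v :: "real^'n"
    by (simp add: power2_norm_eq_inner)
  moreover have "transpose (mat c :: real^'n^'n) = mat c"
    by (rule transpose_mat)
  ultimately show "loewner_le (mat c) A \<longleftrightarrow> (\<forall>v. c * (norm v)\<^sup>2 \<le> v \<bullet> (A *v v))"
    "loewner_le A (mat c) \<longleftrightarrow> (\<forall>v. v \<bullet> (A *v v) \<le> c * (norm v)\<^sup>2)"
    using assms by (simp_all add: loewner_le_def)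
qed

text \<open>\<epsilon> is any constant with this pointwise bound; the theorem instantiates it with
  the operator norm.\<close>

locale perturbed_configuration = source_configuration + noise: finite_span U for U +
  fixes \<epsilon> :: real
  assumes eps_bound: "norm (noise.P f - signal.P f) \<le> \<epsilon> * norm f"
begin

abbreviation "q \<equiv> music U \<kappa>"
abbreviation "L \<equiv> 2 / sqrt 5 + 2 / 3"
abbreviation "C2 \<equiv> C2_const \<gamma> \<mu> \<nu>"
abbreviation "Cm \<equiv> 2 / 3 - C2 - L * \<epsilon>"
abbreviation "Cp \<equiv> 2 / 3 + C2 + L * \<epsilon>"

lemma eps_nonneg: "0 \<le> \<epsilon>"
  using order_trans[OF norm_ge_zero eps_bound[of "plane_wave \<kappa> 0"]] by simp

lemma C2_nonneg: "0 \<le> C2"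
proof -
  have "0 \<le> C1_const \<gamma> \<nu>" using nu_nonneg by (simp add: C1_const_def)
  then show ?thesis using nu_nonneg mu_nonneg mu_less_1 by (simp add: C2_const_def)
qed

lemma form_perturbation:
  assumes v: "norm v = 1"
  shows "\<bar>noise.music_form \<kappa> z v v - signal.music_form \<kappa> z v v\<bar> \<le> L * \<epsilon> * \<kappa>\<^sup>2"
proof -
  let ?\<phi> = "plane_wave \<kappa> z" and ?d = "dwave \<kappa> v z" and ?D = "ddwave \<kappa> v v z"
  have nd: "norm ?d = \<kappa> / sqrt 3" and nD: "norm ?D = \<kappa>\<^sup>2 / sqrt 5"
    using v kappa by (simp_all add: norm_dwave norm_ddwave)
  have "noise.music_form \<kappa> z v v - signal.music_form \<kappa> z v v =
     - 2 * inner ?D (noise.P ?\<phi> - signal.P ?\<phi>) - 2 * inner ?d (noise.P ?d - signal.P ?d)"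
    by (simp add: noise.music_form_def signal.music_form_def inner_diff_right)
  moreover have "\<bar>inner ?D (noise.P ?\<phi> - signal.P ?\<phi>)\<bar> \<le> \<epsilon> * (\<kappa>\<^sup>2 / sqrt 5)"
    using abs_inner_le_of_norm_le[OF eps_bound[of ?\<phi>], of ?D] nD by simp
  moreover have "\<bar>inner ?d (noise.P ?d - signal.P ?d)\<bar> \<le> \<epsilon> * (\<kappa>\<^sup>2 / 3)"
  proof -
    have "\<bar>inner ?d (noise.P ?d - signal.P ?d)\<bar> \<le> (\<epsilon> * norm ?d) * norm ?d"
      by (rule abs_inner_le_of_norm_le[OF eps_bound])
    also have "\<dots> = \<epsilon> * (\<kappa>\<^sup>2 / 3)"
      unfolding nd by (simp add: power2_eq_square)
    finally show ?thesis .
  qed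
  moreover have "L * \<epsilon> * \<kappa>\<^sup>2 = 2 * (\<epsilon> * (\<kappa>\<^sup>2 / sqrt 5)) + 2 * (\<epsilon> * (\<kappa>\<^sup>2 / 3))"
    by (simp add: algebra_simps)
  ultimately show ?thesis by linarith
qed

lemma form_bounds:
  assumes "x \<in> X" "z \<in> cball x \<rho>"
  shows "Cm * \<kappa>\<^sup>2 * (norm v)\<^sup>2 \<le> noise.music_form \<kappa> z v v"
    and "noise.music_form \<kappa> z v v \<le> Cp * \<kappa>\<^sup>2 * (norm v)\<^sup>2"
proof -
  have "Cm * \<kappa>\<^sup>2 * (norm v)\<^sup>2 \<le> noise.music_form \<kappa> z v v \<and> noise.music_form \<kappa> z v v \<le> Cp * \<kappa>\<^sup>2 * (norm v)\<^sup>2"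
  proof (cases "v = 0")
    case True
    have "noise.music_form \<kappa> z (0 *\<^sub>R 0) (0 *\<^sub>R 0) = 0"
      unfolding noise.music_form_scale by simp
    then show ?thesis using True by simp
  next
    case False
    define u where "u = sgn v"
    have u: "norm u = 1" "v = norm v *\<^sub>R u" using False by (auto simp: u_def norm_sgn sgn_div_norm)
    have b: "Cm * \<kappa>\<^sup>2 \<le> noise.music_form \<kappa> z u u" "noise.music_form \<kappa> z u u \<le> Cp * \<kappa>\<^sup>2"
      using signal_form_bound[OF assms u(1)] form_perturbation[OF u(1), of z]
      unfolding abs_le_iff by (simp_all only: left_diff_distrib distrib_right) linarith+
    have "noise.music_form \<kappa> z v v = (norm v)\<^sup>2 * noise.music_form \<kappa> z u u"
      using noise.music_form_scale[of \<kappa> z "norm v" u] u(2) by simp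
    then show ?thesis
      using mult_left_mono[OF b(1), of "(norm v)\<^sup>2"] mult_left_mono[OF b(2), of "(norm v)\<^sup>2"]
      by (simp add: mult_ac)
  qed
  then show "Cm * \<kappa>\<^sup>2 * (norm v)\<^sup>2 \<le> noise.music_form \<kappa> z v v"
    "noise.music_form \<kappa> z v v \<le> Cp * \<kappa>\<^sup>2 * (norm v)\<^sup>2" by auto
qed

text \<open>The wave of a source lies in the signal space, so its residual is the difference of the
  two projections applied to it. Squared, this gives \<tau>0.\<close>

lemma residual_at_source: "x \<in> X \<Longrightarrow> norm (noise.Q (plane_wave \<kappa> x)) \<le> \<epsilon>"
  using eps_bound[of "plane_wave \<kappa> x"] plane_wave_in_signal_space[of x] by (simp add: norm_minus_commute)

lemma hessian_bounds:
  assumes "x \<in> X" "z \<in> cball x \<rho>"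
  shows "loewner_le (mat (Cm * \<kappa>\<^sup>2)) (hessian q z)" "loewner_le (hessian q z) (mat (Cp * \<kappa>\<^sup>2))"
  using form_bounds[OF assms]
  by (simp_all add: loewner_le_mat_iff noise.transpose_hessian_music noise.hessian_music_form)

lemma gradient_at_source: "x \<in> X \<Longrightarrow> norm (gradient q x) \<le> 2 * \<kappa> / sqrt 3 * \<epsilon>"
  using residual_at_source[of x] kappa
  by (intro order_trans[OF noise.norm_gradient_music_le[OF kappa]] mult_left_mono) auto

text \<open>The gradient at the source is at most 2 \<kappa> \<epsilon>/sqrt 3, and
  \<open>small\<close> multiplied by \<open>Cm\<close> \<kappa>^2 says exactly that this is below m
  \<rho> with m = \<open>Cm\<close> \<kappa>^2.\<close>

lemma convex_near_source:
  assumes x: "x \<in> X" and Cm: "0 < Cm" and small: "2 * \<epsilon> / (sqrt 3 * Cm * \<kappa>) < \<rho>"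
  shows "strongly_convex_ball q (gradient q) (hessian q) x \<rho> (Cm * \<kappa>\<^sup>2) (Cp * \<kappa>\<^sup>2)"
proof
  fix z v
  show "(q has_derivative (\<lambda>v. gradient q z \<bullet> v)) (at z)"
    by (rule noise.music_has_gradient)
  show "(gradient q has_derivative (\<lambda>v. hessian q z *v v)) (at z)"
    by (rule noise.gradient_music_has_hessian)
  show "transpose (hessian q z) = hessian q z"
    by (rule noise.transpose_hessian_music)
  show "Cm * \<kappa>\<^sup>2 * (norm v)\<^sup>2 \<le> v \<bullet> (hessian q z *v v)" "v \<bullet> (hessian q z *v v) \<le> Cp * \<kappa>\<^sup>2 * (norm v)\<^sup>2"
    if "z \<in> cball x \<rho>"
    using form_bounds[OF x that] by (simp_all add: noise.hessian_music_form)
  show "0 < Cm * \<kappa>\<^sup>2" using Cm kappa by simp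
  have "0 \<le> L * \<epsilon>" using eps_nonneg by simp
  then have "Cm \<le> Cp" using C2_nonneg by linarith
  then show "Cm * \<kappa>\<^sup>2 \<le> Cp * \<kappa>\<^sup>2" by (intro mult_right_mono) auto
  show "0 < \<rho>" by (rule rho)
  have "norm (gradient q x) \<le> 2 * \<kappa> / sqrt 3 * \<epsilon>"
    by (rule gradient_at_source[OF x])
  also have "2 * \<kappa> / sqrt 3 * \<epsilon> < Cm * \<kappa>\<^sup>2 * \<rho>"
  proof -
    have "2 * \<epsilon> / (sqrt 3 * Cm * \<kappa>) * (Cm * \<kappa>\<^sup>2) < \<rho> * (Cm * \<kappa>\<^sup>2)"
      using small Cm kappa by (intro mult_strict_right_mono) auto
    moreover have "2 * \<epsilon> / (sqrt 3 * c * \<kappa>) * (c * \<kappa>\<^sup>2) = 2 * \<kappa> / sqrt 3 * \<epsilon>" if "c > 0" for c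
      using that kappa by (simp add: power2_eq_square)
    ultimately show ?thesis using Cm by (metis mult.commute)
  qed
  finally show "norm (gradient q x) < Cm * \<kappa>\<^sup>2 * \<rho>" .
qed

lemma music_at_source: "x \<in> X \<Longrightarrow> q x \<le> \<epsilon>\<^sup>2"
  using residual_at_source[of x] by (simp add: music_def power_mono)

lemma critical_points:
  assumes Cm: "0 < Cm" and small: "2 * \<epsilon> / (sqrt 3 * Cm * \<kappa>) < \<rho>"
  obtains xt where
    "\<And>x. x \<in> X \<Longrightarrow> xt x \<in> ball x \<rho>"
    "\<And>x. x \<in> X \<Longrightarrow> gradient q (xt x) = 0"
    "\<And>x z. x \<in> X \<Longrightarrow> z \<in> ball x \<rho> \<and> critical_point q z \<longleftrightarrow> z = xt x"
    "\<And>x z. x \<in> X \<Longrightarrow> is_arg_min q (\<lambda>y. y \<in> ball x \<rho>) z \<longleftrightarrow> z = xt x"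
    "\<And>x. x \<in> X \<Longrightarrow> norm (xt x - x) \<le> 2 * \<epsilon> / (sqrt 3 * Cm * \<kappa>)"
    "\<And>x. x \<in> X \<Longrightarrow> q (xt x) \<le> \<epsilon>\<^sup>2"
proof -
  have "\<exists>z. z \<in> ball x \<rho> \<and> gradient q z = 0" if "x \<in> X" for x
  proof -
    interpret strongly_convex_ball q "gradient q" "hessian q" x \<rho> "Cm * \<kappa>\<^sup>2" "Cp * \<kappa>\<^sup>2"
      by (rule convex_near_source[OF that Cm small])
    show ?thesis using critical_point_exists by metis
  qed
  then obtain xt where xt: "\<And>x. x \<in> X \<Longrightarrow> xt x \<in> ball x \<rho> \<and> gradient q (xt x) = 0"
    by metis
  show ?thesis
  proof (rule that[of xt])
    fix x assume x: "x \<in> X"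
    interpret C: strongly_convex_ball q "gradient q" "hessian q" x \<rho> "Cm * \<kappa>\<^sup>2" "Cp * \<kappa>\<^sup>2"
      by (rule convex_near_source[OF x Cm small])
    show b: "xt x \<in> ball x \<rho>" "gradient q (xt x) = 0" using xt[OF x] by auto
    then have cb: "xt x \<in> cball x \<rho>" by auto
    have less: "q (xt x) < q y" if "y \<in> ball x \<rho>" "y \<noteq> xt x" for y
      using C.critical_point_less[OF cb b(2), of y] that by auto
    show "z \<in> ball x \<rho> \<and> critical_point q z \<longleftrightarrow> z = xt x" for z
      using C.critical_point_unique[of z "xt x"] cb b unfolding noise.critical_point_music by auto
    show "is_arg_min q (\<lambda>y. y \<in> ball x \<rho>) z \<longleftrightarrow> z = xt x" for z
      unfolding is_arg_min_def using less b(1) by (metis less_asym)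
    have "norm (xt x - x) \<le> norm (gradient q x) / (Cm * \<kappa>\<^sup>2)"
      by (rule C.critical_point_dist[OF cb b(2)])
    also have "\<dots> \<le> (2 * \<kappa> / sqrt 3 * \<epsilon>) / (Cm * \<kappa>\<^sup>2)"
      using gradient_at_source[OF x] Cm by (intro divide_right_mono) auto
    also have "\<dots> = 2 * \<epsilon> / (sqrt 3 * Cm * \<kappa>)"
      using kappa by (simp add: power2_eq_square)
    finally show "norm (xt x - x) \<le> 2 * \<epsilon> / (sqrt 3 * Cm * \<kappa>)" .
    have "q (xt x) \<le> q x" using less[of x] rho by (cases "x = xt x") auto
    then show "q (xt x) \<le> \<epsilon>\<^sup>2" using music_at_source[OF x] by linarith
  qed
qed

lemma gradient_descent:
  assumes Cm: "0 < Cm" and small: "2 * \<epsilon> / (sqrt 3 * Cm * \<kappa>) < \<rho>"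
    and h: "0 < h" "h \<le> 2 / ((Cm + Cp) * \<kappa>\<^sup>2)" and x: "x \<in> X"
  shows "1 - h * Cm * \<kappa>\<^sup>2 < 1"
    "grad_step q h ` cball x \<rho> \<subseteq> ball x \<rho>"
    "(1 - h * Cm * \<kappa>\<^sup>2)-lipschitz_on (cball x \<rho>) (grad_step q h)"
    "g \<in> ball x \<rho> \<Longrightarrow> z \<in> ball x \<rho> \<Longrightarrow> gradient q z = 0 \<Longrightarrow>
      norm ((grad_step q h ^^ n) g - z) \<le> (1 - h * Cm * \<kappa>\<^sup>2) ^ n * norm (g - z)"
proof -
  interpret C: strongly_convex_ball q "gradient q" "hessian q" x \<rho> "Cm * \<kappa>\<^sup>2" "Cp * \<kappa>\<^sup>2"
    by (rule convex_near_source[OF x Cm small])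
  have step: "C.step = grad_step q"
    by (simp add: fun_eq_iff C.step_def grad_step_def)
  have rate: "1 - h * (Cm * \<kappa>\<^sup>2) = 1 - h * Cm * \<kappa>\<^sup>2" by (simp only: mult.assoc)
  have "0 < (Cm + Cp) * \<kappa>\<^sup>2" using kappa by simp
  then have h': "h * (Cm * \<kappa>\<^sup>2 + Cp * \<kappa>\<^sup>2) \<le> 2"
    using h(2) by (simp only: pos_le_divide_eq distrib_right)
  show "1 - h * Cm * \<kappa>\<^sup>2 < 1" using C.rate[OF h(1) h'] unfolding rate by simp
  show "grad_step q h ` cball x \<rho> \<subseteq> ball x \<rho>"
    using C.step_cball[OF h(1) h'] unfolding step by blast
  show "(1 - h * Cm * \<kappa>\<^sup>2)-lipschitz_on (cball x \<rho>) (grad_step q h)"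
    using C.step_contraction[OF h(1) h'] C.rate[OF h(1) h'] unfolding step rate
    by (intro lipschitz_onI) (auto simp: dist_norm)
  show "norm ((grad_step q h ^^ n) g - z) \<le> (1 - h * Cm * \<kappa>\<^sup>2) ^ n * norm (g - z)"
    if "g \<in> ball x \<rho>" "z \<in> ball x \<rho>" "gradient q z = 0"
    using C.step_iterates[OF h(1) h', of z g n] that unfolding step rate by auto
qed

text \<open>In terms of the angles \<alpha> and \<beta> with sines sqrt A and \<epsilon>, the
  assumption is \<beta> < \<alpha>/2, equivalently \<beta> < \<alpha> - \<beta>, which separates the
  two levels. Outside the balls the angle to the signal space is at least \<alpha>; changing the
  subspace lowers it by at most \<beta>, and sin is increasing on the range involved.\<close>

lemma music_outside:
  assumes A: "0 < A_const \<gamma> \<mu> \<nu>" and eps: "\<epsilon> < sin (1 / 2 * arcsin (sqrt (A_const \<gamma> \<mu> \<nu>)))"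
  defines "s \<equiv> sin (arcsin (sqrt (A_const \<gamma> \<mu> \<nu>)) - arcsin \<epsilon>)"
  shows "\<epsilon>\<^sup>2 < s\<^sup>2" and "(\<And>x. x \<in> X \<Longrightarrow> \<rho> \<le> dist x z) \<Longrightarrow> s\<^sup>2 \<le> q z"
proof -
  define \<alpha> where "\<alpha> = arcsin (sqrt (A_const \<gamma> \<mu> \<nu>))"
  define \<beta> where "\<beta> = arcsin \<epsilon>"
  have A1: "sqrt (A_const \<gamma> \<mu> \<nu>) \<le> 1" using A_const_le_1 by simp
  have A0: "-1 \<le> sqrt (A_const \<gamma> \<mu> \<nu>)" "0 \<le> sqrt (A_const \<gamma> \<mu> \<nu>)"
    using A real_sqrt_ge_zero[of "A_const \<gamma> \<mu> \<nu>"] by linarith+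
  have a: "0 \<le> \<alpha>" "\<alpha> \<le> pi / 2"
    unfolding \<alpha>_def using A0 A1 arcsin_ubound[OF A0(1) A1] by (auto intro!: arcsin_nonneg)
  have e1: "\<epsilon> < 1" using eps sin_le_one[of "1 / 2 * \<alpha>"] unfolding \<alpha>_def by linarith
  have "\<beta> < arcsin (sin (\<alpha> / 2))"
    unfolding \<beta>_def using eps eps_nonneg by (intro arcsin_less_arcsin) (auto simp: \<alpha>_def)
  also have "arcsin (sin (\<alpha> / 2)) = \<alpha> / 2" using a by (intro arcsin_sin) auto
  finally have ba: "\<beta> < \<alpha> / 2" .
  have b0: "0 \<le> \<beta>" unfolding \<beta>_def using eps_nonneg e1 by (intro arcsin_nonneg) auto
  have "sin \<beta> < sin (\<alpha> - \<beta>)"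
    using a b0 ba by (intro sin_monotone_2pi) auto
  then have es: "\<epsilon> < s" using eps_nonneg e1 by (simp add: \<beta>_def s_def \<alpha>_def)
  then show "\<epsilon>\<^sup>2 < s\<^sup>2" using eps_nonneg by (simp add: power_strict_mono)
  assume z: "\<And>x. x \<in> X \<Longrightarrow> \<rho> \<le> dist x z"
  let ?\<phi> = "plane_wave \<kappa> z"
  have "A_const \<gamma> \<mu> \<nu> \<le> (norm (signal.Q ?\<phi>))\<^sup>2"
    using music_signal_ge[OF z] by (simp add: music_def)
  then have sA: "sqrt (A_const \<gamma> \<mu> \<nu>) \<le> norm (signal.Q ?\<phi>)"
    by (simp add: real_le_lsqrt)
  have sQ: "norm (signal.Q ?\<phi>) \<le> 1" using signal.norm_orth_proj_residual_le[of ?\<phi>] by simp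
  have nQ': "-1 \<le> norm (noise.Q ?\<phi>)"
    by (rule order_trans[OF _ norm_ge_zero]) simp
  have nQ: "norm (noise.Q ?\<phi>) \<le> 1" using noise.norm_orth_proj_residual_le[of ?\<phi>] by simp
  have "\<alpha> \<le> arcsin (norm (signal.Q ?\<phi>))"
    unfolding \<alpha>_def by (rule arcsin_le_arcsin[OF A0(1) sA sQ])
  also have "\<dots> \<le> arcsin (norm (noise.Q ?\<phi>)) + \<beta>"
    unfolding \<beta>_def using eps_nonneg e1
    by (intro angle_triangle_subspaces noise.finite_span_axioms signal.finite_span_axioms eps_bound) auto
  finally have "sin (\<alpha> - \<beta>) \<le> sin (arcsin (norm (noise.Q ?\<phi>)))"
    using a b0 ba arcsin_ubound[OF nQ' nQ] by (intro sin_monotone_2pi_le) auto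
  also have "\<dots> = norm (noise.Q ?\<phi>)" using nQ nQ' by (intro sin_arcsin)
  finally have "s \<le> norm (noise.Q ?\<phi>)" by (simp add: s_def \<alpha>_def \<beta>_def)
  then show "s\<^sup>2 \<le> q z" unfolding music_def using es eps_nonneg by (intro power_mono) auto
qed

end

theorem theorem2p2:
  fixes \<kappa> \<rho> \<gamma> \<delta> \<mu> \<nu> C2 A \<epsilon> \<tau>0 \<tau>1 Cm Cp :: real
    and s :: nat and X :: "(real^3) set" and U :: "L2_sphere set" and q :: "real^3 \<Rightarrow> real"
  assumes "\<kappa> > 0" and "s \<ge> 2" and "finite X" and "card X = s" and "\<rho> > 0"
    and "\<delta> = min_separation X"
    and "(\<Union>x\<in>X. cball x \<rho>) \<subseteq> ball 0 1" and "\<rho> \<le> \<delta> / 2"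
    and "\<gamma> = \<rho> * \<kappa>" and "\<mu> = mu_const s \<kappa> \<delta>" and "\<mu> < 1"
    and "complex_L2.subspace U" and "complex_L2.dim U = s"
    and "\<epsilon> = onorm (\<lambda>f. orth_proj U f - orth_proj (signal_space \<kappa> X) f)"
    and "\<nu> = nu_const s \<kappa> \<delta>" and "C2 = C2_const \<gamma> \<mu> \<nu>" and "A = A_const \<gamma> \<mu> \<nu>"
    and "A > 0" and "C2 < 2/3"
    and "\<epsilon> < min (sqrt 3 / 2 * \<gamma> * (2/3 - C2) / (1 + sqrt 3 / 2 * \<gamma> * (2 / sqrt 5 + 2/3)))
                 (sin (1/2 * arcsin (sqrt A)))"
    and "\<tau>0 = \<epsilon>\<^sup>2" and "\<tau>1 = (sin (arcsin (sqrt A) - arcsin \<epsilon>))\<^sup>2"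
    and "Cm = 2/3 - C2 - (2 / sqrt 5 + 2/3) * \<epsilon>"
    and "Cp = 2/3 + C2 + (2 / sqrt 5 + 2/3) * \<epsilon>"
    and "q = music U \<kappa>"
  shows "\<tau>0 < \<tau>1 \<and>
    \<comment> \<open>(i)\<close>
    Cm > (2/3 - C2) / (1 + sqrt 3 / 2 * \<gamma> * (2 / sqrt 5 + 2/3)) \<and>
    (\<forall>x\<in>X. \<forall>z\<in>cball x \<rho>. twice_differentiable_at q z \<and>
       loewner_le (mat (Cm * \<kappa>\<^sup>2)) (hessian q z) \<and>
       loewner_le (hessian q z) (mat (Cp * \<kappa>\<^sup>2))) \<and>
    \<comment> \<open>(ii)\<close>
    (\<forall>z \<in> ball 0 1 - (\<Union>x\<in>X. ball x \<rho>). q z \<ge> \<tau>1) \<and>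
    \<comment> \<open>(iv)\<close>
    (\<forall>G. finite G \<and> G \<subseteq> ball 0 1 \<and>
       fill_distance G < ereal (min (\<rho> - 2 * \<epsilon> / (sqrt 3 * Cm * \<kappa>))
                                    (sqrt 3 / (2 * \<kappa>) * (\<tau>1 - \<tau>0))) \<longrightarrow>
       (\<forall>x\<in>X. {g\<in>G. q g < \<tau>1} \<inter> ball x \<rho> \<noteq> {}) \<and>
       {g\<in>G. q g < \<tau>1} \<subseteq> (\<Union>x\<in>X. ball x \<rho>)) \<and>
    \<comment> \<open>(iii) and (v), where \<open>xt x\<close> is the minimizer in the ball around \<open>x\<close>\<close>
    (\<exists>xt :: real^3 \<Rightarrow> real^3.
       (\<forall>x\<in>X. (\<forall>z. z \<in> ball x \<rho> \<and> critical_point q z \<longleftrightarrow> z = xt x) \<and>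
              (\<forall>z. is_arg_min q (\<lambda>y. y \<in> ball x \<rho>) z \<longleftrightarrow> z = xt x) \<and>
              norm (xt x - x) \<le> 2 * \<epsilon> / (sqrt 3 * Cm * \<kappa>) \<and>
              2 * \<epsilon> / (sqrt 3 * Cm * \<kappa>) < \<rho> \<and>
              q (xt x) \<le> \<tau>0) \<and>
       2 / ((Cm + Cp) * \<kappa>\<^sup>2) = 3 / (2 * \<kappa>\<^sup>2) \<and>
       (\<forall>h. 0 < h \<and> h \<le> 2 / ((Cm + Cp) * \<kappa>\<^sup>2) \<longrightarrow>
          1 - h * Cm * \<kappa>\<^sup>2 < 1 \<and>
          (\<forall>x\<in>X. grad_step q h ` cball x \<rho> \<subseteq> ball x \<rho> \<and>
                 (1 - h * Cm * \<kappa>\<^sup>2)-lipschitz_on (cball x \<rho>) (grad_step q h)) \<and>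
          (\<forall>G. finite G \<and> G \<subseteq> ball 0 1 \<longrightarrow>
             (\<forall>g \<in> {g\<in>G. q g < \<tau>1}.
                (\<exists>x\<in>X. g \<in> ball x \<rho>) \<and>
                (\<forall>x\<in>X. g \<in> ball x \<rho> \<longrightarrow>
                   (\<forall>n. norm ((grad_step q h ^^ n) g - xt x)
                        \<le> (1 - h * Cm * \<kappa>\<^sup>2) ^ n * norm (g - xt x)))))))"
proof -
  note eps_def = assms(14)
  interpret source_configuration \<kappa> \<rho> X
    by standard (use assms in simp_all)
  interpret noise: finite_span U
    by (rule finite_span_if_dim_pos) (use assms in simp_all)
  have "bounded_linear (\<lambda>f. noise.P f - signal.P f)"
    by (intro bounded_linear_sub noise.bounded_linear_orth_proj signal.bounded_linear_orth_proj)
  from onorm[OF this] interpret perturbed_configuration \<kappa> \<rho> X U \<epsilon>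
    by unfold_locales (simp add: eps_def)
  let ?\<mu> = "mu_const (card X) \<kappa> (min_separation X)" and ?\<nu> = "nu_const (card X) \<kappa> (min_separation X)"
  let ?L = "2 / sqrt 5 + 2/3 :: real"
  have mu: "\<mu> = ?\<mu>" and nu: "\<nu> = ?\<nu>" and C2: "C2 = C2_const (\<rho> * \<kappa>) ?\<mu> ?\<nu>"
    and A: "A = A_const (\<rho> * \<kappa>) ?\<mu> ?\<nu>" and q: "q = music U \<kappa>"
    using assms by simp_all
  have Cm_eq: "Cm = 2/3 - C2_const (\<rho> * \<kappa>) ?\<mu> ?\<nu> - ?L * \<epsilon>"
    and Cp_eq: "Cp = 2/3 + C2_const (\<rho> * \<kappa>) ?\<mu> ?\<nu> + ?L * \<epsilon>"
    using assms(23,24) C2 by simp_all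
  have gamma0: "\<gamma> > 0" using assms gamma_pos by simp
  \<comment> \<open>F is the solution of F = 2/3 - C2 - D F, the value of \<open>Cm\<close> at the
    extreme \<epsilon> = (sqrt 3/2) \<gamma> F. Below this threshold, \<open>Cm\<close> is larger
    than F, which resolves the circular dependence of \<open>Cm\<close> on \<epsilon>.\<close>
  define D where "D = sqrt 3 / 2 * \<gamma> * ?L"
  define F where "F = (2/3 - C2) / (1 + D)"
  have D0: "D > 0" unfolding D_def using gamma0 by (intro mult_pos_pos add_pos_pos) auto
  have L0: "?L > 0" by (intro add_pos_pos) auto
  have eps1: "\<epsilon> < sqrt 3 / 2 * \<gamma> * F"
    using assms(20) by (simp add: F_def D_def)
  have eps2: "\<epsilon> < sin (1/2 * arcsin (sqrt A))"
    using assms(20) by simp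
  have F_less: "F < Cm"
  proof -
    have "?L * \<epsilon> < ?L * (sqrt 3 / 2 * \<gamma> * F)"
      using eps1 L0 by (rule mult_strict_left_mono)
    also have "\<dots> = D * F" by (simp add: D_def)
    finally have "?L * \<epsilon> < D * F" .
    moreover have "(1 + D) * F = 2/3 - C2" using D0 by (simp add: F_def)
    then have "F + D * F = 2/3 - C2" by (simp add: distrib_right)
    ultimately show ?thesis unfolding assms(23) by linarith
  qed
  have "F > 0" unfolding F_def using D0 assms(19) by simp
  with F_less have Cm0: "Cm > 0" by simp
  \<comment> \<open>With \<gamma> = \<rho> \<kappa>, this is \<epsilon> < (sqrt 3/2) \<gamma>
    \<open>Cm\<close>, which follows from the threshold because F < \<open>Cm\<close>.\<close>
  have small: "2 * \<epsilon> / (sqrt 3 * Cm * \<kappa>) < \<rho>"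
  proof -
    have "\<epsilon> < sqrt 3 / 2 * \<gamma> * Cm"
      by (rule less_trans[OF eps1 mult_strict_left_mono[OF F_less]]) (use gamma0 in simp)
    then have "2 * \<epsilon> < \<rho> * (sqrt 3 * Cm * \<kappa>)"
      unfolding assms(9) by (simp add: mult_ac)
    then show ?thesis using Cm0 assms(1) by (subst pos_divide_less_eq) simp_all
  qed
  have tau: "\<tau>0 < \<tau>1"
    using music_outside(1) assms(18) eps2 unfolding assms(21,22) A by blast
  have outside: "\<tau>1 \<le> q z" if "z \<in> ball 0 1 - (\<Union>x\<in>X. ball x \<rho>)" for z
    using music_outside(2)[of z] that assms(18) eps2
    unfolding assms(22) A q by (auto simp: not_less)
  obtain xt where xt: "\<And>x. x \<in> X \<Longrightarrow> xt x \<in> ball x \<rho>"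
    "\<And>x. x \<in> X \<Longrightarrow> gradient q (xt x) = 0"
    "\<And>x z. x \<in> X \<Longrightarrow> z \<in> ball x \<rho> \<and> critical_point q z \<longleftrightarrow> z = xt x"
    "\<And>x z. x \<in> X \<Longrightarrow> is_arg_min q (\<lambda>y. y \<in> ball x \<rho>) z \<longleftrightarrow> z = xt x"
    "\<And>x. x \<in> X \<Longrightarrow> norm (xt x - x) \<le> 2 * \<epsilon> / (sqrt 3 * Cm * \<kappa>)"
    "\<And>x. x \<in> X \<Longrightarrow> q (xt x) \<le> \<epsilon>\<^sup>2"
    by (rule critical_points[folded Cm_eq q, OF Cm0 small]) (rule that; blast)
  have hess: "twice_differentiable_at q z \<and> loewner_le (mat (Cm * \<kappa>\<^sup>2)) (hessian q z) \<and>
      loewner_le (hessian q z) (mat (Cp * \<kappa>\<^sup>2))" if "x \<in> X" "z \<in> cball x \<rho>" for x z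
    using hessian_bounds[OF that, folded Cm_eq Cp_eq] noise.twice_differentiable_music unfolding q by blast
  have accepted: "\<exists>x\<in>X. g \<in> ball x \<rho>" if "g \<in> ball 0 1" "q g < \<tau>1" for g
  proof (rule ccontr)
    assume "\<not> (\<exists>x\<in>X. g \<in> ball x \<rho>)"
    then have "g \<in> ball 0 1 - (\<Union>x\<in>X. ball x \<rho>)" using that(1) by blast
    from outside[OF this] that(2) show False by simp
  qed
  \<comment> \<open>The grid point is sought near the minimizer rather than the source. One entry of
    the minimum leaves room for the offset between the two, so the point stays in the ball; the
    other limits the Lipschitz increase from \<tau>0 to below \<tau>1.\<close>
  have mesh: "\<exists>g\<in>G. q g < \<tau>1 \<and> g \<in> ball x \<rho>"
    if x: "x \<in> X" and G: "fill_distance G < ereal (min (\<rho> - 2 * \<epsilon> / (sqrt 3 * Cm * \<kappa>)) (sqrt 3 / (2 * \<kappa>) * (\<tau>1 - \<tau>0)))" for x G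
  proof -
    \<comment> \<open>The fill distance only controls points of the unit ball, so this is where the
      containment of the closed balls enters. A finite bound on the infimum also yields a grid
      point, since the infimum over an empty G is infinite.\<close>
    have "xt x \<in> ball 0 1" using xt(1)[OF x] ball_subset_cball assms(7) x by blast
    then have "(INF g\<in>G. ereal (dist (xt x) g)) \<le> fill_distance G"
      unfolding fill_distance_def by (rule SUP_upper)
    also note G
    finally obtain g where g: "g \<in> G" "dist (xt x) g < \<rho> - 2 * \<epsilon> / (sqrt 3 * Cm * \<kappa>)"
        "dist (xt x) g < sqrt 3 / (2 * \<kappa>) * (\<tau>1 - \<tau>0)"
      unfolding INF_less_iff by auto
    have "dist x g \<le> dist x (xt x) + dist (xt x) g" by (rule dist_triangle)
    also have "dist x (xt x) \<le> 2 * \<epsilon> / (sqrt 3 * Cm * \<kappa>)"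
      using xt(5)[OF x] by (simp add: dist_norm norm_minus_commute)
    finally have "g \<in> ball x \<rho>" using g by simp
    moreover have "q g < \<tau>1"
    proof -
      have "q g \<le> q (xt x) + 2 * \<kappa> / sqrt 3 * dist (xt x) g"
        using noise.music_lipschitz[OF assms(1), of g "xt x"] by (simp add: q dist_norm norm_minus_commute)
      also have "q (xt x) \<le> \<tau>0" using xt(6)[OF x] by (simp add: assms(21))
      also have "2 * \<kappa> / sqrt 3 * dist (xt x) g < 2 * \<kappa> / sqrt 3 * (sqrt 3 / (2 * \<kappa>) * (\<tau>1 - \<tau>0))"
        using g(3) assms(1) by (intro mult_strict_left_mono) auto
      also have "\<dots> = \<tau>1 - \<tau>0" using assms(1) by simp
      finally show ?thesis by simp
    qed
    ultimately show ?thesis using g(1) by blast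
  qed
  \<comment> \<open>The C2 and \<epsilon> terms enter \<open>Cm\<close> and \<open>Cp\<close> with
    opposite signs, so the largest step size is free of them.\<close>
  have CmCp: "Cm + Cp = 4 / 3" unfolding assms(23,24) by simp
  have rate: "2 / ((Cm + Cp) * \<kappa>\<^sup>2) = 3 / (2 * \<kappa>\<^sup>2)" unfolding CmCp by simp
  have descent: "1 - h * Cm * \<kappa>\<^sup>2 < 1" "grad_step q h ` cball x \<rho> \<subseteq> ball x \<rho>"
    "(1 - h * Cm * \<kappa>\<^sup>2)-lipschitz_on (cball x \<rho>) (grad_step q h)"
    "g \<in> ball x \<rho> \<Longrightarrow> norm ((grad_step q h ^^ n) g - xt x) \<le> (1 - h * Cm * \<kappa>\<^sup>2) ^ n * norm (g - xt x)"
    if "0 < h" "h \<le> 2 / ((Cm + Cp) * \<kappa>\<^sup>2)" "x \<in> X" for h x g n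
    using gradient_descent[folded Cm_eq Cp_eq, OF Cm0 small that] xt(1,2)[OF that(3)] unfolding q by blast+
  have rate_less_1: "1 - h * Cm * \<kappa>\<^sup>2 < 1" if "0 < h" for h
    using that Cm0 assms(1) by simp
  show ?thesis
  proof (intro conjI exI[of _ xt])
    show "\<tau>0 < \<tau>1" by (rule tau)
    show "(2/3 - C2) / (1 + sqrt 3 / 2 * \<gamma> * ?L) < Cm"
      using F_less by (simp only: F_def D_def)
    show "\<forall>x\<in>X. \<forall>z\<in>cball x \<rho>. twice_differentiable_at q z \<and>
       loewner_le (mat (Cm * \<kappa>\<^sup>2)) (hessian q z) \<and> loewner_le (hessian q z) (mat (Cp * \<kappa>\<^sup>2))"
      using hess by blast
    show "\<forall>z \<in> ball 0 1 - (\<Union>x\<in>X. ball x \<rho>). q z \<ge> \<tau>1"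
      using outside by blast
    show "\<forall>G. finite G \<and> G \<subseteq> ball 0 1 \<and>
       fill_distance G < ereal (min (\<rho> - 2 * \<epsilon> / (sqrt 3 * Cm * \<kappa>)) (sqrt 3 / (2 * \<kappa>) * (\<tau>1 - \<tau>0))) \<longrightarrow>
       (\<forall>x\<in>X. {g\<in>G. q g < \<tau>1} \<inter> ball x \<rho> \<noteq> {}) \<and> {g\<in>G. q g < \<tau>1} \<subseteq> (\<Union>x\<in>X. ball x \<rho>)"
      using mesh accepted by blast
    show "\<forall>x\<in>X. (\<forall>z. z \<in> ball x \<rho> \<and> critical_point q z \<longleftrightarrow> z = xt x) \<and>
       (\<forall>z. is_arg_min q (\<lambda>y. y \<in> ball x \<rho>) z \<longleftrightarrow> z = xt x) \<and>
       norm (xt x - x) \<le> 2 * \<epsilon> / (sqrt 3 * Cm * \<kappa>) \<and>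
       2 * \<epsilon> / (sqrt 3 * Cm * \<kappa>) < \<rho> \<and> q (xt x) \<le> \<tau>0"
      using xt(3-6) small by (simp only: assms(21)) blast
    show "2 / ((Cm + Cp) * \<kappa>\<^sup>2) = 3 / (2 * \<kappa>\<^sup>2)" by (rule rate)
    show "\<forall>h. 0 < h \<and> h \<le> 2 / ((Cm + Cp) * \<kappa>\<^sup>2) \<longrightarrow>
          1 - h * Cm * \<kappa>\<^sup>2 < 1 \<and>
          (\<forall>x\<in>X. grad_step q h ` cball x \<rho> \<subseteq> ball x \<rho> \<and>
                 (1 - h * Cm * \<kappa>\<^sup>2)-lipschitz_on (cball x \<rho>) (grad_step q h)) \<and>
          (\<forall>G. finite G \<and> G \<subseteq> ball 0 1 \<longrightarrow>
             (\<forall>g \<in> {g\<in>G. q g < \<tau>1}.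
                (\<exists>x\<in>X. g \<in> ball x \<rho>) \<and>
                (\<forall>x\<in>X. g \<in> ball x \<rho> \<longrightarrow>
                   (\<forall>n. norm ((grad_step q h ^^ n) g - xt x)
                        \<le> (1 - h * Cm * \<kappa>\<^sup>2) ^ n * norm (g - xt x)))))"
      using descent rate_less_1 accepted by (auto simp del: mem_ball mem_cball)
  qed
qed

end
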